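(* Let $\mathbf{k}$ be a field of characteristic zero, and let $\mathcal{P}$ be a symmetric operad over $\mathbf{k}$ minimally generated by an $\mathbb{S}$-module $X\subset\mathcal{P}$ with a minimal $\mathbb{S}$-module of relations $R\subset\mathcal{F}(X)$. Assume that both these $\mathbb{S}$-modules are locally finite, that is, all their graded components are of finite dimension. Suppose that the formal power series $t/f(t)$ has non-negative coefficients, where $f(t)=t-X(t)+R(t)$. Then the operad $\mathcal{P}$ is infinite and there is a coefficient-wise inequality of formal power series $$\mathcal{P}(z)\ \ge\ f^{[-1]}(z),$$ where $f^{[-1]}(z)$ is the composition inverse power series of $f(t)$.
   Context: An $\mathbb{S}$-module is a sequence $Q=\{Q(n)\}$ of $\mathbf{k}$-linear representations $Q(n)$ of the symmetric groups $S_n$. Its generating series is the exponential one: $Q(z)=\sum_{n\ge 1}\frac{\dim Q(n)}{n!}z^n$; the same notation is used for operads, so $\mathcal{P}(z)=\sum_{n\ge1}\frac{\dim\mathcal{P}(n)}{n!}z^n$, $X(t)=\sum_n\frac{\dim X(n)}{n!}t^n$, $R(t)=\sum_n\frac{\dim R(n)}{n!}t^n$. All operads are symmetric $\mathbf{k}$-linear connected operads with identity: there are no operations of arity $0$ and $\mathcal{P}(1)=\mathbf{k}\cdot\mathrm{id}$. Put $\mathcal{P}_+=\mathcal{P}(2)\oplus\mathcal{P}(3)\oplus\cdots$. The minimal $\mathbb{S}$-module of generators $X\subset\mathcal{P}_+$ is an $\mathbb{S}$-submodule generating $\mathcal{P}$ and mapping isomorphically onto $\mathcal{P}_+/(\mathcal{P}_+\circ\mathcal{P}_+)$,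 where $\mathcal{P}_+\circ\mathcal{P}_+$ denotes the span of all compositions of elements of $\mathcal{P}_+$; in particular $X$ is concentrated in arities $\ge 2$. $\mathcal{F}(X)$ denotes the free symmetric operad generated by $X$. A minimal $\mathbb{S}$-module of relations is a minimal $\mathbb{S}$-submodule $R\subset\mathcal{F}(X)$ generating, as an operadic ideal, the kernel of the natural surjection $\mathcal{F}(X)\to\mathcal{P}$. The operad $\mathcal{P}$ is infinite if its total dimension $\sum_n\dim\mathcal{P}(n)$ is infinite.
   Formalization: The conclusion that P is infinite is stated only for X ≠ 0: for X = 0 one has P = k·id, R = 0, f(t) = t and t/f(t) = 1, yet P has total dimension 1; the coefficient-wise inequality is unrestricted. *)

theory Defs
  imports
    "HOL-Computational_Algebra.Formal_Power_Series"
    "HOL-Combinatorics.Permutations"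
    "HOL-Library.Poly_Mapping"
begin

section \<open>Symmetric modules\<close>

text \<open>
  The components of an \<open>\<bbbS>\<close>-module are subspaces of one ambient vector space (every sequence of
  vector spaces embeds into its direct sum). The components may overlap, so all structure maps
  carry their arities as arguments.

  The inputs of an operation of arity \<open>n\<close> are numbered \<open>0, \<dots>, n - 1\<close>, and \<open>S\<^sub>n\<close> consists of the
  \<open>\<sigma>\<close> with \<open>\<sigma> permutes {..<n}\<close>. It acts from the left: \<open>act n \<sigma> x\<close> is \<open>x\<close> with input \<open>i\<close> renamed
  to \<open>\<sigma> i\<close>, that is \<open>(\<sigma> x)(v\<^sub>0, \<dots>, v\<^sub>n\<^sub>-\<^sub>1) = x(v\<^bsub>\<sigma> 0\<^esub>, \<dots>, v\<^bsub>\<sigma> (n-1)\<^esub>)\<close> for multilinear maps.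
\<close>

record ('k, 'v) smodule =
  scl :: "'k \<Rightarrow> 'v \<Rightarrow> 'v"
  cmpt :: "nat \<Rightarrow> 'v set"
  act :: "nat \<Rightarrow> (nat \<Rightarrow> nat) \<Rightarrow> 'v \<Rightarrow> 'v"

locale S_module =
  fixes M :: "('k::field, 'v::ab_group_add, 'z) smodule_scheme" (structure)
  assumes vector_space_scl: "vector_space (scl M)"
    and subspace_cmpt: "module.subspace (scl M) (cmpt M n)"
    and act_closed: "\<sigma> permutes {..<n} \<Longrightarrow> x \<in> cmpt M n \<Longrightarrow> act M n \<sigma> x \<in> cmpt M n"
    and act_add: "\<sigma> permutes {..<n} \<Longrightarrow> x \<in> cmpt M n \<Longrightarrow> y \<in> cmpt M n \<Longrightarrow>
      act M n \<sigma> (x + y) = act M n \<sigma> x + act M n \<sigma> y"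
    and act_scl: "\<sigma> permutes {..<n} \<Longrightarrow> x \<in> cmpt M n \<Longrightarrow>
      act M n \<sigma> (scl M c x) = scl M c (act M n \<sigma> x)"
    and act_id: "x \<in> cmpt M n \<Longrightarrow> act M n id x = x"
    and act_comp: "\<sigma> permutes {..<n} \<Longrightarrow> \<tau> permutes {..<n} \<Longrightarrow> x \<in> cmpt M n \<Longrightarrow>
      act M n (\<sigma> \<circ> \<tau>) x = act M n \<sigma> (act M n \<tau> x)"

definition S_submodule ::
  "('k::field, 'v::ab_group_add, 'z) smodule_scheme \<Rightarrow> (nat \<Rightarrow> 'v set) \<Rightarrow> bool" where
  "S_submodule M X \<longleftrightarrow>
    (\<forall>n. module.subspace (scl M) (X n) \<and> X n \<subseteq> cmpt M n) \<and>
    (\<forall>n \<sigma>. \<sigma> permutes {..<n} \<longrightarrow> act M n \<sigma> ` X n \<subseteq> X n)"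

definition restrict_smodule ::
  "('k, 'v, 'z) smodule_scheme \<Rightarrow> (nat \<Rightarrow> 'v set) \<Rightarrow> ('k, 'v) smodule" where
  "restrict_smodule M X = \<lparr>scl = scl M, cmpt = X, act = act M\<rparr>"

definition finite_dim :: "('k::field \<Rightarrow> 'v::ab_group_add \<Rightarrow> 'v) \<Rightarrow> 'v set \<Rightarrow> bool" where
  "finite_dim s V \<longleftrightarrow> (\<exists>B. finite B \<and> V \<subseteq> module.span s B)"

definition locally_finite ::
  "('k::field, 'v::ab_group_add, 'z) smodule_scheme \<Rightarrow> (nat \<Rightarrow> 'v set) \<Rightarrow> bool" where
  "locally_finite M X \<longleftrightarrow> (\<forall>n. finite_dim (scl M) (X n))"

definition gen_series ::
  "('k::field, 'v::ab_group_add, 'z) smodule_scheme \<Rightarrow> (nat \<Rightarrow> 'v set) \<Rightarrow> real fps" where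
  "gen_series M X =
    Abs_fps (\<lambda>n. if n = 0 then 0 else real (vector_space.dim (scl M) (X n)) / fact n)"


section \<open>Symmetric operads\<close>

text \<open>
  \<open>pcomp m i n f g\<close> is the partial composition \<open>f \<circ>\<^sub>i g\<close> of \<open>f\<close> of arity \<open>m\<close> with \<open>g\<close> of arity \<open>n\<close>.
\<close>

record ('k, 'v) operad = "('k, 'v) smodule" +
  pcomp :: "nat \<Rightarrow> nat \<Rightarrow> nat \<Rightarrow> 'v \<Rightarrow> 'v \<Rightarrow> 'v"
  one :: "'v"

text \<open>
  In \<open>f \<circ>\<^sub>i g\<close>, with \<open>g\<close> of arity \<open>n\<close>, input \<open>j \<noteq> i\<close> of \<open>f\<close> becomes input \<open>slot i n j\<close>, and
  input \<open>l\<close> of \<open>g\<close> becomes input \<open>i + l\<close>.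
\<close>

definition slot :: "nat \<Rightarrow> nat \<Rightarrow> nat \<Rightarrow> nat" where
  "slot i n j = (if j < i then j else j + n - 1)"

text \<open>
  The permutation of \<open>{..<m + n - 1}\<close> that takes each input of \<open>f \<circ>\<^sub>i g\<close> to the corresponding input
  of \<open>(\<sigma> f) \<circ>\<^bsub>\<sigma> i\<^esub> (\<tau> g)\<close>: \<open>slot i n j \<mapsto> slot (\<sigma> i) n (\<sigma> j)\<close> and \<open>i + l \<mapsto> \<sigma> i + \<tau> l\<close>.
\<close>

definition perm_pcomp ::
  "nat \<Rightarrow> nat \<Rightarrow> nat \<Rightarrow> (nat \<Rightarrow> nat) \<Rightarrow> (nat \<Rightarrow> nat) \<Rightarrow> nat \<Rightarrow> nat" where
  "perm_pcomp m i n \<sigma> \<tau> p =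
    (if p \<ge> m + n - 1 then p
     else if p < i then slot (\<sigma> i) n (\<sigma> p)
     else if p < i + n then \<sigma> i + \<tau> (p - i)
     else slot (\<sigma> i) n (\<sigma> (p + 1 - n)))"

locale symmetric_operad = S_module Q
  for Q :: "('k::field, 'v::ab_group_add) operad" (structure) +
  assumes one_closed: "one Q \<in> cmpt Q 1"
    and pcomp_closed: "i < m \<Longrightarrow> f \<in> cmpt Q m \<Longrightarrow> g \<in> cmpt Q n \<Longrightarrow>
      pcomp Q m i n f g \<in> cmpt Q (m + n - 1)"
    and pcomp_add_left: "i < m \<Longrightarrow> f \<in> cmpt Q m \<Longrightarrow> f' \<in> cmpt Q m \<Longrightarrow> g \<in> cmpt Q n \<Longrightarrow>
      pcomp Q m i n (f + f') g = pcomp Q m i n f g + pcomp Q m i n f' g"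
    and pcomp_add_right: "i < m \<Longrightarrow> f \<in> cmpt Q m \<Longrightarrow> g \<in> cmpt Q n \<Longrightarrow> g' \<in> cmpt Q n \<Longrightarrow>
      pcomp Q m i n f (g + g') = pcomp Q m i n f g + pcomp Q m i n f g'"
    and pcomp_scl_left: "i < m \<Longrightarrow> f \<in> cmpt Q m \<Longrightarrow> g \<in> cmpt Q n \<Longrightarrow>
      pcomp Q m i n (scl Q c f) g = scl Q c (pcomp Q m i n f g)"
    and pcomp_scl_right: "i < m \<Longrightarrow> f \<in> cmpt Q m \<Longrightarrow> g \<in> cmpt Q n \<Longrightarrow>
      pcomp Q m i n f (scl Q c g) = scl Q c (pcomp Q m i n f g)"
    and one_pcomp: "f \<in> cmpt Q n \<Longrightarrow> pcomp Q 1 0 n (one Q) f = f"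
    and pcomp_one: "i < n \<Longrightarrow> f \<in> cmpt Q n \<Longrightarrow> pcomp Q n i 1 f (one Q) = f"
    and pcomp_sequential: "i < l \<Longrightarrow> j < m \<Longrightarrow>
      f \<in> cmpt Q l \<Longrightarrow> g \<in> cmpt Q m \<Longrightarrow> h \<in> cmpt Q n \<Longrightarrow>
      pcomp Q (l + m - 1) (i + j) n (pcomp Q l i m f g) h =
      pcomp Q l i (m + n - 1) f (pcomp Q m j n g h)"
    and pcomp_parallel: "i < k \<Longrightarrow> k < l \<Longrightarrow>
      f \<in> cmpt Q l \<Longrightarrow> g \<in> cmpt Q m \<Longrightarrow> h \<in> cmpt Q n \<Longrightarrow>
      pcomp Q (l + m - 1) (k + m - 1) n (pcomp Q l i m f g) h =
      pcomp Q (l + n - 1) i m (pcomp Q l k n f h) g"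
    and pcomp_equivariant: "i < m \<Longrightarrow> \<sigma> permutes {..<m} \<Longrightarrow> \<tau> permutes {..<n} \<Longrightarrow>
      f \<in> cmpt Q m \<Longrightarrow> g \<in> cmpt Q n \<Longrightarrow>
      pcomp Q m (\<sigma> i) n (act Q m \<sigma> f) (act Q n \<tau> g) =
      act Q (m + n - 1) (perm_pcomp m i n \<sigma> \<tau>) (pcomp Q m i n f g)"

definition connected_operad :: "('k::field, 'v::ab_group_add) operad \<Rightarrow> bool" where
  "connected_operad Q \<longleftrightarrow>
    cmpt Q 0 = {0} \<and> cmpt Q 1 = range (\<lambda>c. scl Q c (one Q)) \<and> one Q \<noteq> 0"

text \<open>The total dimension \<open>\<Sum>\<^sub>n dim Q(n)\<close> is infinite.\<close>

definition infinite_operad :: "('k::field, 'v::ab_group_add) operad \<Rightarrow> bool" where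
  "infinite_operad Q \<longleftrightarrow>
    \<not> ((\<forall>n. finite_dim (scl Q) (cmpt Q n)) \<and> finite {n. cmpt Q n \<noteq> {0}})"

definition operad_hom ::
  "('k::field, 'v::ab_group_add) operad \<Rightarrow> ('k, 'w::ab_group_add) operad \<Rightarrow>
    (nat \<Rightarrow> 'v \<Rightarrow> 'w) \<Rightarrow> bool" where
  "operad_hom Q Q' \<phi> \<longleftrightarrow>
    (\<forall>n. \<forall>x\<in>cmpt Q n. \<phi> n x \<in> cmpt Q' n) \<and>
    (\<forall>n. \<forall>x\<in>cmpt Q n. \<forall>y\<in>cmpt Q n. \<phi> n (x + y) = \<phi> n x + \<phi> n y) \<and>
    (\<forall>n c. \<forall>x\<in>cmpt Q n. \<phi> n (scl Q c x) = scl Q' c (\<phi> n x)) \<and>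
    (\<forall>n \<sigma>. \<sigma> permutes {..<n} \<longrightarrow>
      (\<forall>x\<in>cmpt Q n. \<phi> n (act Q n \<sigma> x) = act Q' n \<sigma> (\<phi> n x))) \<and>
    \<phi> 1 (one Q) = one Q' \<and>
    (\<forall>m n i. i < m \<longrightarrow> (\<forall>f\<in>cmpt Q m. \<forall>g\<in>cmpt Q n.
      \<phi> (m + n - 1) (pcomp Q m i n f g) = pcomp Q' m i n (\<phi> m f) (\<phi> n g)))"

definition kernel ::
  "('k, 'v, 'z) smodule_scheme \<Rightarrow> (nat \<Rightarrow> 'v \<Rightarrow> 'w::zero) \<Rightarrow> nat \<Rightarrow> 'v set" where
  "kernel Q \<phi> n = {x \<in> cmpt Q n. \<phi> n x = 0}"

definition suboperad ::
  "('k::field, 'v::ab_group_add) operad \<Rightarrow> (nat \<Rightarrow> 'v set) \<Rightarrow> bool" where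
  "suboperad Q S \<longleftrightarrow> S_submodule Q S \<and> one Q \<in> S 1 \<and>
    (\<forall>m n i. i < m \<longrightarrow> (\<forall>f\<in>S m. \<forall>g\<in>S n. pcomp Q m i n f g \<in> S (m + n - 1)))"

definition generates ::
  "('k::field, 'v::ab_group_add) operad \<Rightarrow> (nat \<Rightarrow> 'v set) \<Rightarrow> bool" where
  "generates Q X \<longleftrightarrow>
    (\<forall>S. suboperad Q S \<and> (\<forall>n. X n \<subseteq> S n) \<longrightarrow> (\<forall>n. S n = cmpt Q n))"

definition operad_ideal ::
  "('k::field, 'v::ab_group_add) operad \<Rightarrow> (nat \<Rightarrow> 'v set) \<Rightarrow> bool" where
  "operad_ideal Q I \<longleftrightarrow> S_submodule Q I \<and>
    (\<forall>m n i. i < m \<longrightarrow> (\<forall>f\<in>I m. \<forall>g\<in>cmpt Q n. pcomp Q m i n f g \<in> I (m + n - 1))) \<and>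
    (\<forall>m n i. i < m \<longrightarrow> (\<forall>f\<in>cmpt Q m. \<forall>g\<in>I n. pcomp Q m i n f g \<in> I (m + n - 1)))"

definition ideal_generated ::
  "('k::field, 'v::ab_group_add) operad \<Rightarrow> (nat \<Rightarrow> 'v set) \<Rightarrow> nat \<Rightarrow> 'v set" where
  "ideal_generated Q R n = \<Inter> {I n |I. operad_ideal Q I \<and> (\<forall>k. R k \<subseteq> I k)}"

text \<open>
  The component of arity \<open>n\<close> of \<open>Q\<^sub>+ \<circ> Q\<^sub>+\<close>, the span of all compositions of elements of \<open>Q\<^sub>+\<close>.
  An iterated composition is again a composition of two elements of \<open>Q\<^sub>+\<close>. The permutations are
  needed because \<open>act\<close> applied to the two factors reaches only some permutations of the inputs
  of \<open>f \<circ>\<^sub>i g\<close>.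
\<close>

definition decomposables ::
  "('k::field, 'v::ab_group_add) operad \<Rightarrow> nat \<Rightarrow> 'v set" where
  "decomposables Q n = module.span (scl Q)
    {act Q n \<sigma> (pcomp Q m i k f g) |\<sigma> m i k f g.
      \<sigma> permutes {..<n} \<and> 2 \<le> m \<and> 2 \<le> k \<and> i < m \<and> m + k - 1 = n \<and>
      f \<in> cmpt Q m \<and> g \<in> cmpt Q k}"

text \<open>
  The last two conditions say that \<open>X n \<rightarrow> Q\<^sub>+(n) / (Q\<^sub>+ \<circ> Q\<^sub>+)(n)\<close> is injective and surjective.
\<close>

definition minimal_generators ::
  "('k::field, 'v::ab_group_add) operad \<Rightarrow> (nat \<Rightarrow> 'v set) \<Rightarrow> bool" where
  "minimal_generators Q X \<longleftrightarrow>
    S_submodule Q X \<and> (\<forall>n<2. X n = {0}) \<and> generates Q X \<and>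
    (\<forall>n\<ge>2. X n \<inter> decomposables Q n = {0} \<and>
      (\<forall>y\<in>cmpt Q n. \<exists>x\<in>X n. y - x \<in> decomposables Q n))"


section \<open>The free operad\<close>

text \<open>
  Rooted planar trees. A vertex with \<open>k\<close> inputs is decorated by an element of \<open>X(k)\<close>, and the
  leaves are labelled by the inputs of the operation.
\<close>

datatype 'v optree = Leaf nat | Node 'v "'v optree list"

primrec leaves :: "'v optree \<Rightarrow> nat list" where
  "leaves (Leaf j) = [j]"
| "leaves (Node x ts) = concat (map leaves ts)"

primrec decorated :: "(nat \<Rightarrow> 'v set) \<Rightarrow> 'v optree \<Rightarrow> bool" where
  "decorated X (Leaf j) \<longleftrightarrow> True"
| "decorated X (Node x ts) \<longleftrightarrow> x \<in> X (length ts) \<and> list_all (decorated X) ts"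

primrec bind :: "'v optree \<Rightarrow> (nat \<Rightarrow> 'v optree) \<Rightarrow> 'v optree" where
  "bind (Leaf j) u = u j"
| "bind (Node x ts) u = Node x (map (\<lambda>t. bind t u) ts)"

definition relabel :: "(nat \<Rightarrow> nat) \<Rightarrow> 'v optree \<Rightarrow> 'v optree" where
  "relabel \<sigma> t = bind t (\<lambda>j. Leaf (\<sigma> j))"

text \<open>Grafting of \<open>s\<close>, which has \<open>n\<close> leaves, onto the leaf \<open>i\<close> of \<open>t\<close>.\<close>

definition graft :: "nat \<Rightarrow> nat \<Rightarrow> 'v optree \<Rightarrow> 'v optree \<Rightarrow> 'v optree" where
  "graft i n t s =
    bind t (\<lambda>j. if j = i then relabel (\<lambda>l. i + l) s else Leaf (slot i n j))"

definition trees :: "(nat \<Rightarrow> 'v set) \<Rightarrow> nat \<Rightarrow> 'v optree set" where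
  "trees X n = {t. decorated X t \<and> distinct (leaves t) \<and> set (leaves t) = {..<n}}"

text \<open>
  Formal linear combinations: \<open>tscale\<close> is scalar multiplication, \<open>tmap\<close> and \<open>tmap2\<close> are
  the linear and bilinear extensions of maps on trees.
\<close>

type_synonym ('k, 'v) tvec = "'v optree \<Rightarrow>\<^sub>0 'k"

abbreviation tvec :: "'v optree \<Rightarrow> ('k::field, 'v) tvec" where
  "tvec t \<equiv> Poly_Mapping.single t 1"

definition tscale :: "'k::field \<Rightarrow> ('k, 'v) tvec \<Rightarrow> ('k, 'v) tvec" where
  "tscale c w = Poly_Mapping.map ((*) c) w"

definition tmap ::
  "('v optree \<Rightarrow> 'v optree) \<Rightarrow> ('k::field, 'v) tvec \<Rightarrow> ('k, 'v) tvec" where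
  "tmap h w = (\<Sum>t\<in>Poly_Mapping.keys w.
    Poly_Mapping.single (h t) (Poly_Mapping.lookup w t))"

definition tmap2 ::
  "('v optree \<Rightarrow> 'v optree \<Rightarrow> 'v optree) \<Rightarrow>
    ('k::field, 'v) tvec \<Rightarrow> ('k, 'v) tvec \<Rightarrow> ('k, 'v) tvec" where
  "tmap2 h v w = (\<Sum>t\<in>Poly_Mapping.keys v. \<Sum>s\<in>Poly_Mapping.keys w.
    Poly_Mapping.single (h t s) (Poly_Mapping.lookup v t * Poly_Mapping.lookup w s))"

definition tree_space :: "(nat \<Rightarrow> 'v set) \<Rightarrow> nat \<Rightarrow> ('k::field, 'v) tvec set" where
  "tree_space X n = {w. Poly_Mapping.keys w \<subseteq> trees X n}"

text \<open>
  The relations imposed on formal combinations of decorated trees: a tree is linear in the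
  decoration of each vertex, and \<open>(\<sigma> x)(t\<^sub>0, \<dots>, t\<^sub>k\<^sub>-\<^sub>1) = x(t\<^bsub>\<sigma> 0\<^esub>, \<dots>, t\<^bsub>\<sigma> (k-1)\<^esub>)\<close>. With rule
  \<open>at_subtree\<close> these are imposed at every vertex.
\<close>

inductive_set tree_relations ::
  "('k::field, 'v::ab_group_add, 'z) smodule_scheme \<Rightarrow> ('k, 'v) tvec set"
  for M :: "('k, 'v, 'z) smodule_scheme" where
  additive: "tvec (Node (x + y) ts) - tvec (Node x ts) - tvec (Node y ts) \<in> tree_relations M"
    if "x \<in> cmpt M (length ts)" "y \<in> cmpt M (length ts)" "list_all (decorated (cmpt M)) ts"
| homogeneous: "tvec (Node (scl M c x) ts) - tscale c (tvec (Node x ts)) \<in> tree_relations M"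
    if "x \<in> cmpt M (length ts)" "list_all (decorated (cmpt M)) ts"
| equivariant: "tvec (Node (act M (length ts) \<sigma> x) ts) -
      tvec (Node x (map (\<lambda>i. ts ! \<sigma> i) [0..<length ts])) \<in> tree_relations M"
    if "x \<in> cmpt M (length ts)" "list_all (decorated (cmpt M)) ts"
      "\<sigma> permutes {..<length ts}"
| at_subtree: "tmap (\<lambda>t. Node x (ss @ t # ts)) w \<in> tree_relations M"
    if "w \<in> tree_relations M" "x \<in> cmpt M (length ss + 1 + length ts)"
      "list_all (decorated (cmpt M)) (ss @ ts)"

text \<open>
  The quotient of \<open>tree_space (cmpt M) n\<close> by the relations is realised on the same type by means
  of a linear choice \<open>tree_rep M n\<close> of representatives of the cosets (as quotients depend on
  \<open>M\<close>, they cannot be formed as a type): its restriction to \<open>tree_space (cmpt M) n\<close>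
  is a projection whose kernel consists of the relations.
\<close>

definition tree_rep ::
  "('k::field, 'v::ab_group_add, 'z) smodule_scheme \<Rightarrow> nat \<Rightarrow>
    ('k, 'v) tvec \<Rightarrow> ('k, 'v) tvec" where
  "tree_rep M n = (SOME q. Vector_Spaces.linear tscale tscale q \<and>
    (\<forall>w\<in>tree_space (cmpt M) n. q w \<in> tree_space (cmpt M) n \<and>
      w - q w \<in> module.span tscale (tree_relations M) \<and>
      (w \<in> module.span tscale (tree_relations M) \<longrightarrow> q w = 0)))"

definition free_operad ::
  "('k::field, 'v::ab_group_add, 'z) smodule_scheme \<Rightarrow> ('k, ('k, 'v) tvec) operad" where
  "free_operad M = \<lparr>
    scl = tscale,
    cmpt = (\<lambda>n. tree_rep M n ` tree_space (cmpt M) n),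
    act = (\<lambda>n \<sigma> w. tree_rep M n (tmap (relabel \<sigma>) w)),
    pcomp = (\<lambda>m i n v w. tree_rep M (m + n - 1) (tmap2 (graft i n) v w)),
    one = tree_rep M 1 (tvec (Leaf 0))\<rparr>"

definition free_gen ::
  "('k::field, 'v::ab_group_add, 'z) smodule_scheme \<Rightarrow> nat \<Rightarrow> 'v \<Rightarrow> ('k, 'v) tvec" where
  "free_gen M n x = tree_rep M n (tvec (Node x (map Leaf [0..<n])))"


subsection \<open>The free operad is an operad\<close>

text \<open>
  The choice \<open>tree_rep\<close> exists, the free operad satisfies the operad axioms, and the corollas
  \<open>free_gen\<close> form a morphism of \<open>\<bbbS>\<close>-modules into it.
\<close>

lemma lookup_tscale [simp]: "Poly_Mapping.lookup (tscale c w) t = c * Poly_Mapping.lookup w t"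
  by (simp add: tscale_def Poly_Mapping.map.rep_eq when_def)

interpretation tv: vector_space "tscale :: 'k::field \<Rightarrow> ('k,'v) tvec \<Rightarrow> ('k,'v) tvec"
  by unfold_locales (auto intro!: poly_mapping_eqI simp: lookup_add algebra_simps)

interpretation tvp: vector_space_pair "tscale :: 'k::field \<Rightarrow> ('k,'v) tvec \<Rightarrow> ('k,'v) tvec" 
  "tscale :: 'k::field \<Rightarrow> ('k,'v) tvec \<Rightarrow> ('k,'v) tvec" ..

lemma tscale_single [simp]: "tscale c (Poly_Mapping.single t d) = Poly_Mapping.single t (c * d)"
  by (auto intro!: poly_mapping_eqI simp: lookup_single when_def)

lemma tmap_superset:
  assumes "finite A" "Poly_Mapping.keys w \<subseteq> A"
  shows "tmap h w = (\<Sum>t\<in>A. Poly_Mapping.single (h t) (Poly_Mapping.lookup w t))"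
  unfolding tmap_def by (rule sum.mono_neutral_left) (use assms in \<open>auto simp: in_keys_iff\<close>)

lemma tmap_add [simp]: "tmap h (v + w) = tmap h v + tmap h w"
proof -
  let ?A = "Poly_Mapping.keys v \<union> Poly_Mapping.keys w"
  have "Poly_Mapping.keys (v + w) \<subseteq> ?A" by (rule Poly_Mapping.keys_add)
  then show ?thesis
    by (subst (1 2 3) tmap_superset[where A = ?A])
      (auto simp: lookup_add single_add sum.distrib)
qed

lemma tmap_single [simp]: "tmap h (Poly_Mapping.single t c) = Poly_Mapping.single (h t) c"
  by (simp add: tmap_def)

lemma tmap_scale [simp]: "tmap h (tscale c w) = tscale c (tmap h w)"
proof -
  have "Poly_Mapping.keys (tscale c w) \<subseteq> Poly_Mapping.keys w" by (auto simp: in_keys_iff)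
  then show ?thesis
    by (subst tmap_superset[where A = "Poly_Mapping.keys w"])
      (auto simp: tmap_def tv.scale_sum_right)
qed

lemma linear_tmap: "Vector_Spaces.linear tscale tscale (tmap h)"
  by unfold_locales auto

lemma tmap_zero [simp]: "tmap h 0 = 0" by (simp add: tmap_def)

lemma tmap_diff [simp]: "tmap h (v - w) = tmap h v - tmap h w"
  using tvp.linear_diff[OF linear_tmap] by blast

lemma tvec_induct [case_names zero add scale]:
  assumes "Poly_Mapping.keys w \<subseteq> A" and "P 0"
   and add: "\<And>v w. Poly_Mapping.keys v \<subseteq> A \<Longrightarrow> Poly_Mapping.keys w \<subseteq> A \<Longrightarrow> P v \<Longrightarrow> P w \<Longrightarrow> P (v + w)"
   and single: "\<And>t c. t \<in> A \<Longrightarrow> P (tscale c (tvec t))"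
  shows "P w"
  using assms(1)
proof (induction "card (Poly_Mapping.keys w)" arbitrary: w rule: less_induct)
  case less
  show ?case
  proof (cases "Poly_Mapping.keys w = {}")
    case True then show ?thesis using \<open>P 0\<close> by simp
  next
    case False
    then obtain t where t: "t \<in> Poly_Mapping.keys w" by blast
    define w' where "w' = w - tscale (Poly_Mapping.lookup w t) (tvec t)"
    have "t \<notin> Poly_Mapping.keys w'" by (simp add: w'_def in_keys_iff lookup_minus)
    moreover have "Poly_Mapping.keys w' \<subseteq> Poly_Mapping.keys w"
      using t by (auto simp: w'_def in_keys_iff lookup_minus lookup_single when_def split: if_splits)
    ultimately have sub: "Poly_Mapping.keys w' \<subset> Poly_Mapping.keys w" using t by blast
    then have "P w'" using less by (meson finite_keys psubset_card_mono psubset_imp_subset subset_trans)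
    moreover have "P (tscale (Poly_Mapping.lookup w t) (tvec t))" using t less single by auto
    moreover have "w = w' + tscale (Poly_Mapping.lookup w t) (tvec t)" by (simp add: w'_def)
    moreover have "Poly_Mapping.keys w' \<subseteq> A" using sub less by auto
    moreover have "Poly_Mapping.keys (tscale (Poly_Mapping.lookup w t) (tvec t)) \<subseteq> A" using t less by (auto simp: in_keys_iff)
    ultimately show ?thesis using add by metis
  qed
qed

lemma tmap_tmap: "tmap g (tmap h w) = tmap (\<lambda>t. g (h t)) w"
  by (rule tvec_induct[where A=UNIV]) auto

lemma tmap_cong: "(\<And>t. t \<in> Poly_Mapping.keys w \<Longrightarrow> g t = h t) \<Longrightarrow> tmap g w = tmap h w"
  by (simp add: tmap_def)

lemma tmap2_single_right: "tmap2 h v (Poly_Mapping.single s c) = tscale c (tmap (\<lambda>t. h t s) v)"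
  by (simp add: tmap2_def tmap_def tv.scale_sum_right algebra_simps)
lemma tmap2_single_left: "tmap2 h (Poly_Mapping.single s c) v = tscale c (tmap (h s) v)"
  by (simp add: tmap2_def tmap_def tv.scale_sum_right algebra_simps)
lemma tmap2_left: "tmap2 h v w = (\<Sum>t\<in>Poly_Mapping.keys v. tscale (Poly_Mapping.lookup v t) (tmap (h t) w))"
  by (simp add: tmap2_def tmap_def tv.scale_sum_right)
lemma tmap2_right: "tmap2 h v w = (\<Sum>s\<in>Poly_Mapping.keys w. tscale (Poly_Mapping.lookup w s) (tmap (\<lambda>t. h t s) v))"
  unfolding tmap2_def by (subst sum.swap) (simp add: tmap_def tv.scale_sum_right mult.commute)
lemma tmap2_add_right [simp]: "tmap2 h v (w + w') = tmap2 h v w + tmap2 h v w'"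
  by (simp add: tmap2_left tv.scale_right_distrib sum.distrib)
lemma tmap2_add_left [simp]: "tmap2 h (v + v') w = tmap2 h v w + tmap2 h v' w"
  by (simp add: tmap2_right tv.scale_right_distrib sum.distrib)
lemma tmap2_scale_right [simp]: "tmap2 h v (tscale c w) = tscale c (tmap2 h v w)"
  by (simp add: tmap2_left tv.scale_sum_right mult.commute)
lemma tmap2_scale_left [simp]: "tmap2 h (tscale c v) w = tscale c (tmap2 h v w)"
  by (simp add: tmap2_right tv.scale_sum_right mult.commute)
lemma tmap2_zero [simp]: "tmap2 h 0 w = 0" "tmap2 h v 0 = 0" by (simp_all add: tmap2_def)
lemma tmap2_diff_right: "tmap2 h v (w - w') = tmap2 h v w - tmap2 h v w'"
  by (metis tmap2_add_right add_diff_cancel_right' diff_add_cancel)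
lemma tmap2_diff_left: "tmap2 h (v - v') w = tmap2 h v w - tmap2 h v' w"
  by (metis tmap2_add_left add_diff_cancel_right' diff_add_cancel)

lemma subspace_tree_space: "tv.subspace (tree_space X n)"
  unfolding tv.subspace_def tree_space_def
  by (auto simp: in_keys_iff lookup_add dest!: subsetD[OF Poly_Mapping.keys_add]) 

abbreviation "trel M \<equiv> module.span tscale (tree_relations M)"

lemma tree_rep:
  fixes M :: "('k::field, 'v::ab_group_add, 'z) smodule_scheme"
  shows linear_tree_rep: "Vector_Spaces.linear tscale tscale (tree_rep M n)"
    and tree_rep_closed: "w \<in> tree_space (cmpt M) n \<Longrightarrow> tree_rep M n w \<in> tree_space (cmpt M) n"
    and tree_rep_diff: "w \<in> tree_space (cmpt M) n \<Longrightarrow> w - tree_rep M n w \<in> trel M"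
    and tree_rep_eq_0: "w \<in> tree_space (cmpt M) n \<Longrightarrow> w \<in> trel M \<Longrightarrow> tree_rep M n w = 0"
proof -
  let ?V = "tree_space (cmpt M) n :: ('k,'v) tvec set" and ?N = "trel M"
  have lin: "Vector_Spaces.linear tscale tscale (\<lambda>v :: ('k,'v) tvec. v)"
    by (rule tv.linear_ident)
  have "\<exists>g. range g \<subseteq> ?V \<inter> ?N \<and> Vector_Spaces.linear tscale tscale g \<and>
      (\<forall>v\<in>?V \<inter> ?N. g (id v) = v)"
    by (rule tvp.linear_exists_left_inverse_on)
      (use lin in \<open>auto intro: tv.subspace_inter subspace_tree_space tv.subspace_span simp: id_def\<close>)
  then obtain g where g: "range g \<subseteq> ?V \<inter> ?N" "Vector_Spaces.linear tscale tscale g"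
    "\<And>v. v \<in> ?V \<inter> ?N \<Longrightarrow> g v = v" by auto
  let ?P = "\<lambda>q. Vector_Spaces.linear tscale tscale q \<and>
    (\<forall>w\<in>?V. q w \<in> ?V \<and> w - q w \<in> ?N \<and> (w \<in> ?N \<longrightarrow> q w = 0))"
  have "?P (\<lambda>w. w - g w)"
    using g lin by (auto intro!: tvp.linear_compose_sub tv.subspace_diff[OF subspace_tree_space])
  then have "?P (tree_rep M n)" unfolding tree_rep_def by (rule someI[where P = ?P])
  then show "Vector_Spaces.linear tscale tscale (tree_rep M n)"
    "w \<in> tree_space (cmpt M) n \<Longrightarrow> tree_rep M n w \<in> tree_space (cmpt M) n"
    "w \<in> tree_space (cmpt M) n \<Longrightarrow> w - tree_rep M n w \<in> trel M"
    "w \<in> tree_space (cmpt M) n \<Longrightarrow> w \<in> trel M \<Longrightarrow> tree_rep M n w = 0" by blast+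
qed

lemma concat_map_concat: "concat (map (\<lambda>t. concat (map g (h t))) ts) = concat (map g (concat (map h ts)))"
  by (induction ts) auto

lemma leaves_bind: "leaves (bind t u) = concat (map (\<lambda>j. leaves (u j)) (leaves t))"
proof (induction t)
  case (Node x ts)
  then have "map (\<lambda>t. leaves (bind t u)) ts =
      map (\<lambda>t. concat (map (\<lambda>j. leaves (u j)) (leaves t))) ts" by simp
  then show ?case by (simp add: concat_map_concat comp_def del: map_eq_conv)
qed simp

lemma bind_bind: "bind (bind t u) v = bind t (\<lambda>j. bind (u j) v)"
  by (induction t) auto

lemma bind_cong: "(\<And>j. j \<in> set (leaves t) \<Longrightarrow> u j = v j) \<Longrightarrow> bind t u = bind t v"
  by (induction t) auto

lemma bind_Leaf [simp]: "bind t Leaf = t"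
  by (induction t) (auto intro: map_idI)

lemma decorated_bind:
  "decorated X t \<Longrightarrow> (\<And>j. j \<in> set (leaves t) \<Longrightarrow> decorated X (u j)) \<Longrightarrow> decorated X (bind t u)"
  by (induction t) (auto simp: list_all_iff)

lemma relabel_trees:
  assumes "\<sigma> permutes {..<n}" "t \<in> trees X n" shows "relabel \<sigma> t \<in> trees X n"
proof -
  have "leaves (relabel \<sigma> t) = map \<sigma> (leaves t)"
    by (simp add: relabel_def leaves_bind)
  then show ?thesis using assms permutes_image[OF assms(1)] permutes_inj_on[OF assms(1)]
    by (auto simp: trees_def distinct_map relabel_def intro!: decorated_bind)
qed

lemma distinct_concat_map_iff:
  "distinct xs \<Longrightarrow> (\<And>x. x \<in> set xs \<Longrightarrow> distinct (f x)) \<Longrightarrow>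
   (\<And>x y. x \<in> set xs \<Longrightarrow> y \<in> set xs \<Longrightarrow> x \<noteq> y \<Longrightarrow> set (f x) \<inter> set (f y) = {}) \<Longrightarrow>
   distinct (concat (map f xs))"
  by (induction xs) auto

lemma graft_trees:
  assumes "i < m" "t \<in> trees X m" "s \<in> trees X n" shows "graft i n t s \<in> trees X (m + n - 1)"
proof -
  define g where "g j = (if j = i then map (\<lambda>l. i + l) (leaves s) else [slot i n j])" for j
  have lv: "set (leaves t) = {..<m}" "set (leaves s) = {..<n}" "distinct (leaves t)" "distinct (leaves s)"
    using assms by (auto simp: trees_def)
  have gi: "set (g i) = {i..<i+n}" unfolding g_def using lv(2)
    by (simp add: lessThan_atLeast0 add.commute)
  have gj: "set (g j) = {slot i n j}" if "j \<noteq> i" for j using that by (simp add: g_def)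
  have sl: "slot i n j \<notin> {i..<i+n}" if "j \<noteq> i" for j using that by (auto simp: slot_def)
  have sli: "slot i n j \<noteq> slot i n k" if "j \<noteq> i" "k \<noteq> i" "j \<noteq> k" for j k
    using that by (auto simp: slot_def split: if_splits)
  have "leaves (if j = i then relabel (\<lambda>l. i + l) s else Leaf (slot i n j)) = g j" for j
    by (simp add: g_def relabel_def leaves_bind)
  then have L: "leaves (graft i n t s) = concat (map g (leaves t))"
    unfolding graft_def leaves_bind by simp
  have "decorated X (graft i n t s)"
    using assms unfolding graft_def relabel_def trees_def by (auto intro!: decorated_bind)
  moreover have "distinct (leaves (graft i n t s))"
    unfolding L
  proof (rule distinct_concat_map_iff)
    fix x y :: nat assume "x \<noteq> y"
    then show "set (g x) \<inter> set (g y) = {}"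
      using gi gj sl sli by (cases "x = i"; cases "y = i") simp_all
  next
    show "distinct (g x)" for x using lv by (simp add: g_def distinct_map)
  qed (rule lv)
  moreover have "set (leaves (graft i n t s)) = {..<m+n-1}"
  proof -
    have "set (leaves (graft i n t s)) = (\<Union>j<m. set (g j))"
      unfolding L set_concat set_map image_image lv ..
    also have "\<dots> = {..<m+n-1}"
    proof (intro equalityI subsetI)
      fix p assume "p \<in> {..<m+n-1}"
      then have p: "p < m + n - 1" by simp
      consider "p < i" | "i \<le> p" "p < i + n" | "i + n \<le> p" by linarith
      then show "p \<in> (\<Union>j<m. set (g j))"
      proof cases
        case 1 then have "p \<in> set (g p)" by (simp add: g_def slot_def)
        moreover have "p < m" using 1 assms(1) by simp
        ultimately show ?thesis by blast
      next
        case 2 then have "p \<in> set (g i)" unfolding gi by simp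
        then show ?thesis using assms(1) by blast
      next
        case 3 then have "p \<in> set (g (p + 1 - n))" by (simp add: g_def slot_def)
        moreover have "p + 1 - n < m" using 3 assms(1) p by linarith
        ultimately show ?thesis by blast
      qed
    next
      fix p assume "p \<in> (\<Union>j<m. set (g j))"
      then obtain j where "j < m" "p \<in> set (g j)" by blast
      then show "p \<in> {..<m+n-1}"
        using assms(1) gi gj[of j] by (cases "j = i") (auto simp: slot_def)
    qed
    finally show ?thesis .
  qed
  ultimately show ?thesis unfolding trees_def by simp
qed

lemma tree_relations_bind:
  assumes "w \<in> tree_relations M" "\<And>j. decorated (cmpt M) (u j)"
  shows "tmap (\<lambda>t. bind t u) w \<in> tree_relations M"
  using assms(1)
proof induction
  case (additive x ts y)
  then show ?case using assms(2) tree_relations.additive[of x M "map (\<lambda>t. bind t u) ts" y]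
    by (auto simp: list_all_iff intro!: decorated_bind)
next
  case (homogeneous x ts c)
  then show ?case using assms(2) tree_relations.homogeneous[of x M "map (\<lambda>t. bind t u) ts" c]
    by (auto simp: list_all_iff intro!: decorated_bind)
next
  case (equivariant x ts \<sigma>)
  have [simp]: "map (\<lambda>i. map (\<lambda>t. bind t u) ts ! \<sigma> i) [0..<length ts] = map (\<lambda>i. bind (ts ! \<sigma> i) u) [0..<length ts]"
    using permutes_in_image[OF equivariant(3)] by auto
  then show ?case using equivariant assms(2) tree_relations.equivariant[of x M "map (\<lambda>t. bind t u) ts" \<sigma>]
    by (auto simp: list_all_iff comp_def intro!: decorated_bind simp del: map_eq_conv)
next
  case (at_subtree w x ss ts)
  then show ?case using assms(2)
     tree_relations.at_subtree[of "tmap (\<lambda>t. bind t u) w" M x "map (\<lambda>t. bind t u) ss" "map (\<lambda>t. bind t u) ts"]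
    by (auto simp: list_all_iff tmap_tmap intro!: decorated_bind)
qed

lemma trel_tmap:
  assumes "w \<in> trel M" "\<And>w. w \<in> tree_relations M \<Longrightarrow> tmap h w \<in> trel M"
  shows "tmap h w \<in> trel M"
  using assms(1)
  by (induction rule: tv.span_induct_alt) (use assms(2) in \<open>auto intro: tv.span_add tv.span_scale tv.span_zero\<close>)

lemma trel_bind:
  "w \<in> trel M \<Longrightarrow> (\<And>j. decorated (cmpt M) (u j)) \<Longrightarrow> tmap (\<lambda>t. bind t u) w \<in> trel M"
  by (erule trel_tmap) (auto intro: tv.span_base tree_relations_bind)

lemma trel_relabel: "w \<in> trel M \<Longrightarrow> tmap (relabel \<sigma>) w \<in> trel M"
  unfolding relabel_def by (rule trel_bind) auto

lemma trel_inside: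
  "w \<in> trel M \<Longrightarrow> x \<in> cmpt M (length ss + 1 + length ts) \<Longrightarrow>
   list_all (decorated (cmpt M)) (ss @ ts) \<Longrightarrow> tmap (\<lambda>t. Node x (ss @ t # ts)) w \<in> trel M"
  by (erule trel_tmap) (auto intro!: tv.span_base tree_relations.at_subtree)

lemma trel_graft_left:
  "w \<in> trel M \<Longrightarrow> decorated (cmpt M) s \<Longrightarrow> tmap (\<lambda>t. graft i n t s) w \<in> trel M"
  unfolding graft_def by (rule trel_bind) (auto simp: relabel_def intro: decorated_bind)

lemma trel_graft_right:
  assumes "w \<in> trel M"
  shows "decorated (cmpt M) t \<Longrightarrow> distinct (leaves t) \<Longrightarrow> i \<in> set (leaves t) \<Longrightarrow> tmap (graft i n t) w \<in> trel M"
proof (induction t)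
  case (Leaf j)
  then show ?case using trel_relabel[OF assms] by (simp add: graft_def)
next
  case (Node x ts)
  then obtain t where t: "t \<in> set ts" "i \<in> set (leaves t)" by auto
  then obtain as bs where ts: "ts = as @ t # bs" by (auto dest: split_list)
  let ?u = "\<lambda>j. Leaf (slot i n j) :: 'a optree"
  have "graft i n (Node x ts) s = Node x (map (\<lambda>t. bind t ?u) as @ graft i n t s # map (\<lambda>t. bind t ?u) bs)" for s
  proof -
    have "i \<notin> set (leaves t')" if "t' \<in> set as \<union> set bs" for t'
      using Node.prems(2) t that unfolding ts by auto
    then show ?thesis unfolding ts by (auto simp: graft_def intro!: bind_cong)
  qed
  then have eq: "graft i n (Node x ts) =
    (\<lambda>s. Node x (map (\<lambda>t. bind t ?u) as @ graft i n t s # map (\<lambda>t. bind t ?u) bs))"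
    by (rule ext)
  have "tmap (graft i n (Node x ts)) w =
    tmap (\<lambda>t'. Node x (map (\<lambda>t. bind t ?u) as @ t' # map (\<lambda>t. bind t ?u) bs)) (tmap (graft i n t) w)"
    by (simp only: tmap_tmap eq)
  also have "\<dots> \<in> trel M"
    using Node t unfolding ts by (intro trel_inside) (auto simp: list_all_iff intro!: decorated_bind)
  finally show ?case .
qed

lemma tree_space_induct [consumes 1, case_names zero add single]:
  assumes "w \<in> tree_space X n" "P 0"
   and "\<And>v w. v \<in> tree_space X n \<Longrightarrow> w \<in> tree_space X n \<Longrightarrow> P v \<Longrightarrow> P w \<Longrightarrow> P (v + w)"
   and "\<And>t c. t \<in> trees X n \<Longrightarrow> P (tscale c (tvec t))"
 shows "P w"
  using assms(1) unfolding tree_space_def mem_Collect_eq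
  by (rule tvec_induct) (use assms in \<open>auto simp: tree_space_def\<close>)

lemmas tree_space_intros = tv.subspace_0[OF subspace_tree_space] tv.subspace_add[OF subspace_tree_space]
  tv.subspace_scale[OF subspace_tree_space]

lemma tvec_tree_space: "t \<in> trees X n \<Longrightarrow> tvec t \<in> tree_space X n"
  by (auto simp: tree_space_def in_keys_iff lookup_single when_def split: if_splits)

lemma tmap_tree_space:
  "w \<in> tree_space X n \<Longrightarrow> (\<And>t. t \<in> trees X n \<Longrightarrow> h t \<in> trees X m) \<Longrightarrow> tmap h w \<in> tree_space X m"
  by (induction rule: tree_space_induct) (auto intro!: tree_space_intros tvec_tree_space simp del: tscale_single)

lemma tmap2_tree_space:
  assumes "v \<in> tree_space X n" "w \<in> tree_space X k" "\<And>t s. t \<in> trees X n \<Longrightarrow> s \<in> trees X k \<Longrightarrow> h t s \<in> trees X m"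
  shows "tmap2 h v w \<in> tree_space X m"
  using assms(1)
  by (induction rule: tree_space_induct) (use assms in \<open>auto intro!: tree_space_intros tmap_tree_space simp: tmap2_single_left simp del: tscale_single\<close>)

lemma trel_graft2_left:
  assumes "v \<in> trel M" "w \<in> tree_space (cmpt M) n" shows "tmap2 (graft i n) v w \<in> trel M"
  using assms(2)
  by (induction rule: tree_space_induct) (use assms in \<open>auto intro!: tv.span_zero tv.span_add tv.span_scale trel_graft_left simp: tmap2_single_right trees_def simp del: tscale_single\<close>)

lemma trel_graft2_right:
  assumes "i < m" "v \<in> tree_space (cmpt M) m" "w \<in> trel M" shows "tmap2 (graft i n) v w \<in> trel M"
  using assms(2)
  by (induction rule: tree_space_induct) (use assms in \<open>auto intro!: tv.span_zero tv.span_add tv.span_scale trel_graft_right simp: tmap2_single_left trees_def simp del: tscale_single\<close>)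

lemma tree_rep_cong:
  assumes "v \<in> tree_space (cmpt M) n" "w \<in> tree_space (cmpt M) n" "v - w \<in> trel M"
  shows "tree_rep M n v = tree_rep M n w"
proof -
  have "tree_rep M n (v - w) = 0" 
    using assms tv.subspace_diff[OF subspace_tree_space] by (intro tree_rep_eq_0) auto
  then show ?thesis using tvp.linear_diff[OF linear_tree_rep[of M n], of v w] by auto
qed

lemma tree_rep_idem: "w \<in> tree_space (cmpt M) n \<Longrightarrow> tree_rep M n (tree_rep M n w) = tree_rep M n w"
  by (metis tree_rep_cong tree_rep_closed tree_rep_diff)

lemma tree_rep_tmap:
  assumes "w \<in> tree_space (cmpt M) n" "\<And>t. t \<in> trees (cmpt M) n \<Longrightarrow> h t \<in> trees (cmpt M) m" "\<And>w. w \<in> trel M \<Longrightarrow> tmap h w \<in> trel M"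
  shows "tree_rep M m (tmap h (tree_rep M n w)) = tree_rep M m (tmap h w)"
  by (rule HOL.sym, rule tree_rep_cong)
   (use assms tree_rep_closed[OF assms(1)] tree_rep_diff[OF assms(1)] in \<open>auto simp flip: tmap_diff intro!: tmap_tree_space\<close>)

lemma tree_rep_graft:
  assumes "i < m" "v \<in> tree_space (cmpt M) m" "w \<in> tree_space (cmpt M) n"
  shows "tree_rep M (m+n-1) (tmap2 (graft i n) (tree_rep M m v) w) = tree_rep M (m+n-1) (tmap2 (graft i n) v w)"
    "tree_rep M (m+n-1) (tmap2 (graft i n) v (tree_rep M n w)) = tree_rep M (m+n-1) (tmap2 (graft i n) v w)"
proof -
  note [simp del] = One_nat_def
  have v: "tree_rep M m v \<in> tree_space (cmpt M) m" "v - tree_rep M m v \<in> trel M"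
    and w: "tree_rep M n w \<in> tree_space (cmpt M) n" "w - tree_rep M n w \<in> trel M"
    using assms tree_rep_closed tree_rep_diff by auto
  have "tree_rep M (m+n-1) (tmap2 (graft i n) v w) = tree_rep M (m+n-1) (tmap2 (graft i n) (tree_rep M m v) w)"
    by (rule tree_rep_cong) (use assms v in \<open>auto simp flip: tmap2_diff_left intro: tmap2_tree_space graft_trees trel_graft2_left\<close>)
  then show "tree_rep M (m+n-1) (tmap2 (graft i n) (tree_rep M m v) w) = tree_rep M (m+n-1) (tmap2 (graft i n) v w)" ..
  have "tree_rep M (m+n-1) (tmap2 (graft i n) v w) = tree_rep M (m+n-1) (tmap2 (graft i n) v (tree_rep M n w))"
    by (rule tree_rep_cong) (use assms w in \<open>auto simp flip: tmap2_diff_right intro: tmap2_tree_space graft_trees trel_graft2_right\<close>)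
  then show "tree_rep M (m+n-1) (tmap2 (graft i n) v (tree_rep M n w)) = tree_rep M (m+n-1) (tmap2 (graft i n) v w)" ..
qed

lemma relabel_relabel: "relabel \<sigma> (relabel \<tau> t) = relabel (\<sigma> \<circ> \<tau>) t"
  by (simp add: relabel_def bind_bind)

lemma bind_if: "bind (if b then s else t) u = (if b then bind s u else bind t u)" by simp

lemma graft_sequential:
  assumes "i < l" "j < m" "f \<in> trees X l" "g \<in> trees X m"
  shows "graft (i+j) n (graft i m f g) h = graft i (m + n - 1) f (graft j n g h)"
  unfolding graft_def relabel_def bind_bind
proof (rule bind_cong)
  fix p
  have 1: "bind g (\<lambda>r. bind (Leaf (i + r)) (\<lambda>q. if q = i + j then bind h (\<lambda>r. Leaf (i + j + r)) else Leaf (slot (i+j) n q))) =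
    bind g (\<lambda>r. bind (if r = j then bind h (\<lambda>r. Leaf (j + r)) else Leaf (slot j n r)) (\<lambda>r. Leaf (i + r)))" (is "?a = ?b")
  proof (rule bind_cong)
    fix r
    show "bind (Leaf (i + r)) (\<lambda>q. if q = i + j then bind h (\<lambda>r. Leaf (i + j + r)) else Leaf (slot (i+j) n q)) =
       bind (if r = j then bind h (\<lambda>r. Leaf (j + r)) else Leaf (slot j n r)) (\<lambda>r. Leaf (i + r))"
      by (cases "r = j") (simp_all add: bind_bind add.assoc slot_def)
  qed
  have 2: "slot i m p \<noteq> i + j" "slot (i+j) n (slot i m p) = slot i (m + n - 1) p" if "p \<noteq> i"
    using that assms(2) by (auto simp: slot_def)
  show "bind (if p = i then bind g (\<lambda>j. Leaf (i + j)) else Leaf (slot i m p))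
            (\<lambda>ja. if ja = i + j then bind h (\<lambda>ja. Leaf (i + j + ja)) else Leaf (slot (i + j) n ja)) =
           (if p = i then bind g (\<lambda>ja. bind (if ja = j then bind h (\<lambda>ja. Leaf (j + ja)) else Leaf (slot j n ja)) (\<lambda>j. Leaf (i + j)))
            else Leaf (slot i (m + n - 1) p))"
  proof (cases "p = i")
    case True
    show ?thesis unfolding if_P[OF True] bind_bind by (rule 1)
  next
    case False
    show ?thesis unfolding if_not_P[OF False] bind.simps if_not_P[OF 2(1)[OF False]] 2(2)[OF False] ..
  qed
qed

lemma graft_parallel:
  assumes "i < k" "k < l" "f \<in> trees X l" "g \<in> trees X m" "h \<in> trees X n"
  shows "graft (k + m - 1) n (graft i m f g) h = graft i m (graft k n f h) g"
  unfolding graft_def relabel_def bind_bind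
proof (rule bind_cong)
  fix p 
  let ?u = "\<lambda>q. if q = k + m - 1 then bind h (\<lambda>r. Leaf (k + m - 1 + r)) else Leaf (slot (k+m-1) n q)"
  let ?v = "\<lambda>q. if q = i then bind g (\<lambda>r. Leaf (i + r)) else Leaf (slot i m q)"
  have g: "r < m" if "r \<in> set (leaves g)" for r using that assms(4) by (simp add: trees_def)
  have A: "bind (bind g (\<lambda>r. Leaf (i + r))) ?u = bind g (\<lambda>r. Leaf (i + r))"
    unfolding bind_bind
  proof (rule bind_cong)
    fix r assume "r \<in> set (leaves g)"
    then have "i + r \<noteq> k + m - 1" "i + r < k + m - 1" using g assms(1) by fastforce+
    then show "bind (Leaf (i + r)) ?u = Leaf (i + r)" unfolding bind.simps slot_def by simp
  qed
  have B: "bind (bind h (\<lambda>r. Leaf (k + r))) ?v = bind h (\<lambda>r. Leaf (k + m - 1 + r))"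
    unfolding bind_bind
  proof (rule bind_cong)
    fix r
    have "k + r \<noteq> i" "\<not> k + r < i" "k + r + m - 1 = k + m - 1 + r" using assms(1) by auto
    then show "bind (Leaf (k + r)) ?v = Leaf (k + m - 1 + r)" unfolding bind.simps slot_def by simp
  qed
  have 3: "slot i m p \<noteq> k + m - 1" "slot k n p \<noteq> i" "slot (k+m-1) n (slot i m p) = slot i m (slot k n p)" if "p \<noteq> i" "p \<noteq> k"
    using that assms(1) by (auto simp: slot_def)
  have 4: "slot i m k = k + m - 1" "slot k n i = i" using assms(1) by (auto simp: slot_def)
  consider "p = i" "p \<noteq> k" | "p = k" "p \<noteq> i" | "p \<noteq> i" "p \<noteq> k" using assms(1) by blast
  then show "bind (if p = i then bind g (\<lambda>r. Leaf (i + r)) else Leaf (slot i m p)) ?u =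
    bind (if p = k then bind h (\<lambda>r. Leaf (k + r)) else Leaf (slot k n p)) ?v"
  proof cases
    case 1: 1
    show ?thesis unfolding if_P[OF 1(1)] if_not_P[OF 1(2)] A
      unfolding 1(1) 4 bind.simps by simp
  next
    case 2: 2
    show ?thesis unfolding if_P[OF 2(1)] if_not_P[OF 2(2)] B
      unfolding 2(1) 4 bind.simps by simp
  next
    case c: 3
    show ?thesis unfolding if_not_P[OF c(1)] if_not_P[OF c(2)] bind.simps 3(3)[OF c] if_not_P[OF 3(1)[OF c]] if_not_P[OF 3(2)[OF c]] ..
  qed
qed

lemma graft_equivariant:
  assumes "i < m" "\<sigma> permutes {..<m}" "\<tau> permutes {..<n}" "f \<in> trees X m" "g \<in> trees X n"
  shows "graft (\<sigma> i) n (relabel \<sigma> f) (relabel \<tau> g) = relabel (perm_pcomp m i n \<sigma> \<tau>) (graft i n f g)"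
  unfolding graft_def relabel_def bind_bind bind.simps
proof (rule bind_cong)
  let ?\<rho> = "perm_pcomp m i n \<sigma> \<tau>"
  have 1: "\<sigma> j = \<sigma> i \<longleftrightarrow> j = i" for j using permutes_inj[OF assms(2)] by (auto dest: injD)
  have 2: "bind g (\<lambda>j. Leaf (\<sigma> i + \<tau> j)) = bind g (\<lambda>l. Leaf (?\<rho> (i + l)))"
  proof (rule bind_cong)
    fix l assume "l \<in> set (leaves g)"
    then have "l < n" using assms(5) by (simp add: trees_def)
    then have "\<not> i + l \<ge> m + n - 1" "l < n" using assms(1) by linarith+
    then show "Leaf (\<sigma> i + \<tau> l) = Leaf (?\<rho> (i + l))" using assms(1) by (simp add: perm_pcomp_def)
  qed
  fix j assume "j \<in> set (leaves f)"
  then have j: "j < m" using assms(4) by (simp add: trees_def)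
  have 3: "slot (\<sigma> i) n (\<sigma> j) = ?\<rho> (slot i n j)" if "j \<noteq> i"
  proof (cases "j < i")
    case True
    then have "\<not> j \<ge> m + n - 1" using assms(1) by linarith
    then show ?thesis using True by (simp add: slot_def[of i] perm_pcomp_def)
  next
    case False
    then have "j > i" using that by simp
    then have "\<not> j + n - 1 \<ge> m + n - 1" "\<not> j + n - 1 < i" "\<not> j + n - 1 < i + n" "j + n - 1 + 1 - n = j"
      using j by linarith+
    then show ?thesis using False unfolding slot_def[of i] perm_pcomp_def by simp
  qed
  show "(if \<sigma> j = \<sigma> i then bind g (\<lambda>j. Leaf (\<sigma> i + \<tau> j)) else Leaf (slot (\<sigma> i) n (\<sigma> j))) =
    bind (if j = i then bind g (\<lambda>l. Leaf (i + l)) else Leaf (slot i n j)) (\<lambda>j. Leaf (?\<rho> j))"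
    unfolding 1 using 2 3 by (cases "j = i") (simp_all only: if_True if_False bind_bind bind.simps simp_thms)
qed

lemma perm_pcomp_permutes:
  assumes "i < m" "\<sigma> permutes {..<m}" "\<tau> permutes {..<n}"
  shows "perm_pcomp m i n \<sigma> \<tau> permutes {..<m+n-1}"
proof -
  let ?\<rho> = "perm_pcomp m i n \<sigma> \<tau>"
  have \<sigma>: "\<sigma> j < m \<longleftrightarrow> j < m" "\<sigma> j = \<sigma> k \<longleftrightarrow> j = k" for j k
    using permutes_in_image[OF assms(2)] permutes_inj[OF assms(2)] by (auto dest: injD)
  have \<tau>: "\<tau> j < n \<longleftrightarrow> j < n" "\<tau> j = \<tau> k \<longleftrightarrow> j = k" for j k
    using permutes_in_image[OF assms(3)] permutes_inj[OF assms(3)] by (auto dest: injD)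
  define a where "a p = (if p < i then p else p + 1 - n)" for p
  define b where "b p \<longleftrightarrow> i \<le> p \<and> p < i + n" for p
  have 1: "?\<rho> r = (if b r then \<sigma> i + \<tau> (r - i) else slot (\<sigma> i) n (\<sigma> (a r)))" if "r < m + n - 1" for r
    using that by (auto simp: perm_pcomp_def a_def b_def)
  have 2: "\<sigma> (a r) \<noteq> \<sigma> i" if "\<not> b r" "r < m + n - 1" for r
    using that unfolding \<sigma>(2) by (auto simp: a_def b_def)
  have 3: "b r \<Longrightarrow> \<tau> (r - i) < n" for r using \<tau>(1)[of "r-i"] by (auto simp: b_def)
  have \<sigma>i: "\<sigma> i < m" using assms(1) \<sigma>(1) by blast
  have 4: "\<sigma> (a r) < m" if "\<not> b r" "r < m + n - 1" for r
    using that assms(1) unfolding \<sigma>(1) by (auto simp: a_def b_def)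
  have into: "?\<rho> p < m + n - 1" if "p < m + n - 1" for p
    using 1[OF that] 2[OF _ that] 3[of p] 4[OF _ that] \<sigma>i by (cases "b p") (simp_all add: slot_def, linarith?)
  have inj: "inj_on ?\<rho> {..<m+n-1}"
  proof (rule inj_onI)
    fix p q assume pq: "p \<in> {..<m+n-1}" "q \<in> {..<m+n-1}" "?\<rho> p = ?\<rho> q"
    have bb: "b r \<longleftrightarrow> \<sigma> i \<le> ?\<rho> r \<and> ?\<rho> r < \<sigma> i + n" if "r < m + n - 1" for r
      using 1[OF that] 2[OF _ that] 3[of r] that by (auto simp: slot_def)
    show "p = q"
    proof (cases "b p")
      case True
      then have "b q" using bb[of p] bb[of q] pq by auto
      then have "\<tau> (p - i) = \<tau> (q - i)" using 1[of p] 1[of q] True pq by auto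
      then show ?thesis using True \<open>b q\<close> by (auto simp: \<tau> b_def)
    next
      case False
      then have nq: "\<not> b q" using bb[of p] bb[of q] pq by auto
      then have "slot (\<sigma> i) n (\<sigma> (a p)) = slot (\<sigma> i) n (\<sigma> (a q))" using 1[of p] 1[of q] False pq by auto
      then have "\<sigma> (a p) = \<sigma> (a q)" using 2[of p] 2[of q] False nq pq by (auto simp: slot_def split: if_splits)
      then have "a p = a q" by (simp add: \<sigma>)
      then show ?thesis using False nq by (auto simp: a_def b_def split: if_splits)
    qed
  qed
  have "?\<rho> ` {..<m+n-1} = {..<m+n-1}"
    by (rule endo_inj_surj[OF _ _ inj]) (use into in \<open>auto simp del: One_nat_def\<close>)
  then show ?thesis using inj
    by (intro bij_imp_permutes) (auto simp: bij_betw_def perm_pcomp_def)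
qed

lemma free_simps [simp]:
  "scl (free_operad M) = tscale"
  "act (free_operad M) n \<sigma> w = tree_rep M n (tmap (relabel \<sigma>) w)"
  "pcomp (free_operad M) m i n v w = tree_rep M (m + n - 1) (tmap2 (graft i n) v w)"
  "one (free_operad M) = tree_rep M 1 (tvec (Leaf 0))"
  by (simp_all add: free_operad_def)

lemma cmpt_free: "w \<in> cmpt (free_operad M) n \<longleftrightarrow> w \<in> tree_space (cmpt M) n \<and> tree_rep M n w = w"
  by (auto simp: free_operad_def tree_rep_idem tree_rep_closed intro: image_eqI[of w _ w for w])

lemmas tree_rep_add [simp] = tvp.linear_add[OF linear_tree_rep]
  and tree_rep_scale [simp] = tvp.linear_scale[OF linear_tree_rep]

lemma act_tree_space: "\<sigma> permutes {..<n} \<Longrightarrow> w \<in> tree_space X n \<Longrightarrow> tmap (relabel \<sigma>) w \<in> tree_space X n"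
  by (rule tmap_tree_space) (auto intro: relabel_trees)

lemma pcomp_tree_space: "i < m \<Longrightarrow> v \<in> tree_space X m \<Longrightarrow> w \<in> tree_space X n \<Longrightarrow> tmap2 (graft i n) v w \<in> tree_space X (m + n - 1)"
  by (rule tmap2_tree_space) (auto intro: graft_trees simp del: One_nat_def)

lemma tree_rep_act: "\<sigma> permutes {..<n} \<Longrightarrow> w \<in> tree_space (cmpt M) n \<Longrightarrow> 
  tree_rep M n (tmap (relabel \<sigma>) (tree_rep M n w)) = tree_rep M n (tmap (relabel \<sigma>) w)"
  by (rule tree_rep_tmap) (auto intro: relabel_trees trel_relabel)

lemma Leaf_tree: "Leaf 0 \<in> trees X (Suc 0)" by (auto simp: trees_def)

lemma relabel_id [simp]: "relabel id = id" "relabel (\<lambda>x. x) = id"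
  by (auto simp: relabel_def fun_eq_iff id_def)
lemma tmap_id [simp]: "tmap id w = w" 
  by (rule tvec_induct[where A=UNIV]) auto

lemma graft_one: "graft 0 n (Leaf 0) f = f" "f \<in> trees X n \<Longrightarrow> graft i (Suc 0) f (Leaf 0) = f"
proof -
  show "graft 0 n (Leaf 0) f = f" by (simp add: graft_def relabel_def)
  have "bind f (\<lambda>j. if j = i then relabel (\<lambda>l. i + l) (Leaf 0) else Leaf (slot i (Suc 0) j)) = bind f Leaf"
    by (intro bind_cong) (auto simp: relabel_def slot_def)
  then show "graft i (Suc 0) f (Leaf 0) = f" by (simp add: graft_def)
qed

lemma tmap2_sequential:
  assumes "i < l" "j < m" "f \<in> tree_space X l" "g \<in> tree_space X m" "h \<in> tree_space X n"
  shows "tmap2 (graft (i+j) n) (tmap2 (graft i m) f g) h = tmap2 (graft i (m+n-1)) f (tmap2 (graft j n) g h)"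
  using assms(3)
proof (induction rule: tree_space_induct)
  case (single t c)
  show ?case using assms(4)
  proof (induction rule: tree_space_induct)
    case (single s d)
    show ?case using assms(5)
    proof (induction rule: tree_space_induct)
      case (single r e)
      show ?case using graft_sequential[OF assms(1,2) \<open>t \<in> _\<close> \<open>s \<in> _\<close>, of n r]
        by (simp add: tmap2_single_left tmap2_single_right mult_ac)
    qed (auto simp del: tscale_single)
  qed (auto simp del: tscale_single)
qed auto

lemma tmap2_parallel:
  assumes "i < k" "k < l" "f \<in> tree_space X l" "g \<in> tree_space X m" "h \<in> tree_space X n"
  shows "tmap2 (graft (k+m-1) n) (tmap2 (graft i m) f g) h = tmap2 (graft i m) (tmap2 (graft k n) f h) g"
  using assms(3)
proof (induction rule: tree_space_induct)
  case (single t c)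
  show ?case using assms(4)
  proof (induction rule: tree_space_induct)
    case (single s d)
    show ?case using assms(5)
    proof (induction rule: tree_space_induct)
      case (single r e)
      show ?case using graft_parallel[OF assms(1,2) \<open>t \<in> _\<close> \<open>s \<in> _\<close> \<open>r \<in> _\<close>]
        by (simp add: tmap2_single_left tmap2_single_right mult_ac)
    qed (auto simp: tv.scale_right_distrib mult.commute simp del: tscale_single)
  qed (auto simp: tv.scale_right_distrib mult.commute simp del: tscale_single)
qed auto

lemma tmap2_equivariant:
  assumes "i < m" "\<sigma> permutes {..<m}" "\<tau> permutes {..<n}" "f \<in> tree_space X m" "g \<in> tree_space X n"
  shows "tmap2 (graft (\<sigma> i) n) (tmap (relabel \<sigma>) f) (tmap (relabel \<tau>) g) = 
    tmap (relabel (perm_pcomp m i n \<sigma> \<tau>)) (tmap2 (graft i n) f g)"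
  using assms(4)
proof (induction rule: tree_space_induct)
  case (single t c)
  show ?case using assms(5)
  proof (induction rule: tree_space_induct)
    case (single s d)
    show ?case using graft_equivariant[OF assms(1-3) \<open>t \<in> _\<close> \<open>s \<in> _\<close>]
        by (simp add: tmap2_single_left tmap2_single_right mult_ac)
  qed (auto simp del: tscale_single)
qed auto

lemma tmap2_one: 
  "f \<in> tree_space X n \<Longrightarrow> tmap2 (graft 0 n) (tvec (Leaf 0)) f = f"
  "f \<in> tree_space X n \<Longrightarrow> tmap2 (graft i (Suc 0)) f (tvec (Leaf 0)) = f"
  by (induction rule: tree_space_induct, auto simp: tmap2_single_left tmap2_single_right graft_one)+

lemma subspace_free: "tv.subspace (cmpt (free_operad M) n)"
  unfolding tv.subspace_def by (auto simp: cmpt_free tree_space_intros tvp.linear_0[OF linear_tree_rep])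

lemma one_free: "one (free_operad M) \<in> cmpt (free_operad M) 1"
  by (simp add: cmpt_free tree_rep_closed tree_rep_idem tvec_tree_space Leaf_tree)

lemma tree_rep_fix: "w \<in> cmpt (free_operad M) n \<Longrightarrow> tree_rep M n w = w" "w \<in> cmpt (free_operad M) n \<Longrightarrow> w \<in> tree_space (cmpt M) n"
  by (simp_all add: cmpt_free)

theorem free_operad_symmetric_operad:
  "symmetric_operad (free_operad M)"
  unfolding symmetric_operad_def symmetric_operad_axioms_def S_module_def free_simps
proof (intro conjI allI impI, goal_cases)
  case 1 show ?case by (rule tv.vector_space_axioms)
next case 2 show ?case by (rule subspace_free)
next case (3 \<sigma> n x) then show ?case by (simp add: cmpt_free tree_rep_closed tree_rep_idem act_tree_space)
next case (4 \<sigma> n x y) then show ?case by simp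
next case (5 \<sigma> n x c) then show ?case by simp
next case (6 x n) then show ?case by (simp add: tree_rep_fix)
next case (7 \<sigma> n \<tau> x) then show ?case by (simp add: tree_rep_fix tree_rep_act act_tree_space tmap_tmap relabel_relabel)
next case 8 show ?case using one_free by simp
next case (9 i m f g n) then show ?case by (simp add: cmpt_free tree_rep_closed tree_rep_idem pcomp_tree_space del: One_nat_def)
next case (10 i m f f' g n) then show ?case by simp
next case (11 i m f g n g') then show ?case by simp
next case (12 i m f g n c) then show ?case by simp
next case (13 i m f g n c) then show ?case by simp
next case (14 f n) 
  have "tree_rep M (1 + n - 1) (tmap2 (graft 0 n) (tree_rep M 1 (tvec (Leaf 0))) f) = tree_rep M (1+n-1) (tmap2 (graft 0 n) (tvec (Leaf 0)) f)"
    using 14 by (intro tree_rep_graft) (auto intro: tree_rep_fix tvec_tree_space simp: Leaf_tree)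
  also have "\<dots> = f" using 14 tmap2_one(1)[OF tree_rep_fix(2)[OF 14]] by (simp add: tree_rep_fix)
  finally show ?case .
next case (15 i n f)
  have "tree_rep M (n + 1 - 1) (tmap2 (graft i 1) f (tree_rep M 1 (tvec (Leaf 0)))) = tree_rep M (n+1-1) (tmap2 (graft i 1) f (tvec (Leaf 0)))"
    using 15 by (intro tree_rep_graft) (auto intro: tree_rep_fix tvec_tree_space simp: Leaf_tree)
  also have "\<dots> = f" using tmap2_one(2)[OF tree_rep_fix(2)[OF 15(2)]] 15 by (simp add: tree_rep_fix)
  finally show ?case .
next case (16 i l j m f g h n)
  note t = 16(3-5)[THEN tree_rep_fix(2)]
  have 1: "i + j < l + m - 1" using 16 by linarith
  have 2: "(l + m - 1) + n - 1 = l + (m + n - 1) - 1" using 16 by linarith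
  show ?case
    unfolding tree_rep_graft(1)[OF 1 pcomp_tree_space[OF 16(1) t(1,2)] t(3)]
      tree_rep_graft(2)[OF 16(1) t(1) pcomp_tree_space[OF 16(2) t(2,3)]]
    unfolding 2 tmap2_sequential[OF 16(1,2) t] ..
next case (17 i k l f g m h n)
  note t = 17(3-5)[THEN tree_rep_fix(2)]
  have 0: "i < l" "i < l + n - 1" "k + m - 1 < l + m - 1" using 17 by linarith+
  have 2: "(l + m - 1) + n - 1 = (l + n - 1) + m - 1" using 17 by linarith
  show ?case
    unfolding tree_rep_graft(1)[OF 0(3) pcomp_tree_space[OF 0(1) t(1,2)] t(3)]
     tree_rep_graft(1)[OF 0(2) pcomp_tree_space[OF 17(2) t(1,3)] t(2)]
    unfolding 2 tmap2_parallel[OF 17(1,2) t] ..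
next case (18 i m \<sigma> \<tau> n f g)
  note t = 18(4-5)[THEN tree_rep_fix(2)]
  note s = act_tree_space[OF 18(2) t(1)] act_tree_space[OF 18(3) t(2)]
  have 0: "\<sigma> i < m" using 18 by (meson lessThan_iff permutes_in_image)
  show ?case
    unfolding tree_rep_graft(1)[OF 0 s(1) tree_rep_closed[OF s(2)]] tree_rep_graft(2)[OF 0 s]
      tree_rep_act[OF perm_pcomp_permutes[OF 18(1-3)] pcomp_tree_space[OF 18(1) t]]
      tmap2_equivariant[OF 18(1-3) t] ..
qed

lemma corolla_tree: "x \<in> cmpt M n \<Longrightarrow> Node x (map Leaf [0..<n]) \<in> trees (cmpt M) n"
  by (auto simp: trees_def list_all_iff comp_def concat_map_singleton)

lemma free_gen_closed: "x \<in> cmpt M n \<Longrightarrow> free_gen M n x \<in> cmpt (free_operad M) n"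
  by (simp add: free_gen_def cmpt_free tree_rep_closed tree_rep_idem tvec_tree_space corolla_tree)

lemma free_gen_add:
  assumes "x \<in> cmpt M n" "y \<in> cmpt M n" "x + y \<in> cmpt M n"
  shows "free_gen M n (x + y) = free_gen M n x + free_gen M n y"
proof -
  let ?t = "\<lambda>x. tvec (Node x (map Leaf [0..<n])) :: (_, _) tvec"
  have "?t (x + y) - (?t x + ?t y) \<in> trel M"
    using tree_relations.additive[of x M "map Leaf [0..<n]" y] assms
    by (auto intro!: tv.span_base simp: list_all_iff diff_diff_eq)
  then have "tree_rep M n (?t (x + y)) = tree_rep M n (?t x + ?t y)"
    using assms by (intro tree_rep_cong tree_space_intros tvec_tree_space corolla_tree)
  then show ?thesis by (simp add: free_gen_def)
qed

lemma free_gen_scl: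
  assumes "x \<in> cmpt M n" "scl M c x \<in> cmpt M n"
  shows "free_gen M n (scl M c x) = tscale c (free_gen M n x)"
proof -
  let ?t = "\<lambda>x. tvec (Node x (map Leaf [0..<n])) :: (_, _) tvec"
  have "?t (scl M c x) - tscale c (?t x) \<in> trel M"
    using tree_relations.homogeneous[of x M "map Leaf [0..<n]" c] assms
    by (auto intro!: tv.span_base simp: list_all_iff simp del: tscale_single)
  then have "tree_rep M n (?t (scl M c x)) = tree_rep M n (tscale c (?t x))"
    using assms by (intro tree_rep_cong tree_space_intros tvec_tree_space corolla_tree)
  then show ?thesis by (simp add: free_gen_def del: tscale_single)
qed

lemma free_gen_act:
  assumes "\<sigma> permutes {..<n}" "x \<in> cmpt M n" "act M n \<sigma> x \<in> cmpt M n"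
  shows "free_gen M n (act M n \<sigma> x) = act (free_operad M) n \<sigma> (free_gen M n x)"
proof -
  let ?t = "\<lambda>x. tvec (Node x (map Leaf [0..<n])) :: (_, _) tvec"
  have 1: "map (\<lambda>i. map Leaf [0..<n] ! \<sigma> i) [0..<length (map Leaf [0..<n])] = map (\<lambda>j. Leaf (\<sigma> j)) [0..<n]"
    using permutes_in_image[OF assms(1)] by auto
  have r: "?t (act M n \<sigma> x) - tvec (Node x (map (\<lambda>j. Leaf (\<sigma> j)) [0..<n])) \<in> trel M"
    using tree_relations.equivariant[of x M "map Leaf [0..<n]" \<sigma>] assms(1,2)
    unfolding 1 by (intro tv.span_base) (simp add: list_all_iff)
  have e: "(tvec (Node x (map (\<lambda>j. Leaf (\<sigma> j)) [0..<n])) :: (_, _) tvec) = tmap (relabel \<sigma>) (?t x)"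
    by (simp add: relabel_def comp_def)
  have "tree_rep M n (?t (act M n \<sigma> x)) = tree_rep M n (tmap (relabel \<sigma>) (?t x))"
    by (intro tree_rep_cong act_tree_space tvec_tree_space corolla_tree assms r[unfolded e])
  then show ?thesis unfolding free_gen_def free_simps
    using assms by (simp only: tree_rep_act tvec_tree_space corolla_tree)
qed


section \<open>Presentations\<close>

text \<open>The operad homomorphism \<open>\<F>(X) \<rightarrow> Q\<close> that extends the inclusion of \<open>X\<close>.\<close>

definition natural_surjection ::
  "('k::field, 'v::ab_group_add) operad \<Rightarrow> (nat \<Rightarrow> 'v set) \<Rightarrow>
    (nat \<Rightarrow> ('k, 'v) tvec \<Rightarrow> 'v) \<Rightarrow> bool" where
  "natural_surjection Q X \<pi> \<longleftrightarrow>
    operad_hom (free_operad (restrict_smodule Q X)) Q \<pi> \<and>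
    (\<forall>n. \<forall>x\<in>X n. \<pi> n (free_gen (restrict_smodule Q X) n x) = x)"

definition minimal_ideal_generators ::
  "('k::field, 'v::ab_group_add) operad \<Rightarrow> (nat \<Rightarrow> 'v set) \<Rightarrow> (nat \<Rightarrow> 'v set) \<Rightarrow> bool" where
  "minimal_ideal_generators Q I R \<longleftrightarrow>
    S_submodule Q R \<and> ideal_generated Q R = I \<and>
    (\<forall>R'. S_submodule Q R' \<and> (\<forall>n. R' n \<subseteq> R n) \<and> ideal_generated Q R' = I \<longrightarrow> R' = R)"

definition minimal_relations ::
  "('k::field, 'v::ab_group_add) operad \<Rightarrow> (nat \<Rightarrow> 'v set) \<Rightarrow>
    (nat \<Rightarrow> ('k, 'v) tvec set) \<Rightarrow> bool" where
  "minimal_relations Q X R \<longleftrightarrow>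
    (\<exists>\<pi>. natural_surjection Q X \<pi> \<and>
      minimal_ideal_generators (free_operad (restrict_smodule Q X))
        (kernel (free_operad (restrict_smodule Q X)) \<pi>) R)"

end

theory Submission
  imports Defs "HOL-Combinatorics.Multiset_Permutations"
begin

text \<open>
  Every element of positive weight of \<open>\<F>(X)\<close> has a root vertex, so \<open>P\<close> is the quotient of
  \<open>k \<oplus> X \<circ> P\<close> by the image of the kernel \<open>I\<close> of \<open>\<F>(X) \<rightarrow> P\<close>. Elements of \<open>I\<close> in which a
  relation sits above the root vanish in \<open>X \<circ> P\<close>, and those with a relation at the root come
  from \<open>R \<circ> P\<close>. Counting dimensions gives \<open>P(z) \<ge> z + X(P(z)) - R(P(z))\<close>, that is
  \<open>f(P(z)) \<ge> z\<close>. With \<open>g = t / f \<ge> 0\<close> this yields \<open>P = f(P) g(P) \<ge> z g(P)\<close>, and comparison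
  with the fixed point \<open>f\<^sup>-\<^sup>1 = z g(f\<^sup>-\<^sup>1)\<close> is an induction on coefficients. A polynomial \<open>P(z)\<close> would
  contradict \<open>P \<ge> z g(P)\<close> by its degree, because minimality of \<open>X\<close> forbids relations in the
  lowest arity of \<open>X\<close>, so that \<open>g \<noteq> 1\<close>.
\<close>

text \<open>The composite \<open>X \<circ> P\<close> is never built as a quotient space. Coordinates
  take its place: linear functionals on formal combinations of trees that vanish on the tree
  relations and on relations above the root, and that are dual to the trees whose root carries a
  basis element of \<open>X(k)\<close> and whose children are basis elements of \<open>P\<close> on
  disjoint label sets. The map \<open>Lam\<close> collects them. The obstacle is the symmetric
  group: the children are tensored over \<open>S\<^sub>k\<close>, and their label sets are
  arbitrary. Since \<open>P(0) = 0\<close>, these label sets are non-empty, so that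
  \<open>S\<^sub>k\<close> permutes the children freely; choosing one ordering for each unordered
  family gives a basis, counted by the composition of exponential series. The elements of a
  generated ideal are not described one by one either: the elements of the kernel that lie in the
  span of tree relations, relations above the root and relations at the root form an ideal
  containing \<open>R\<close>, and this ideal must be the whole kernel.\<close>

unbundle fps_syntax

section \<open>Power series with non-negative coefficients\<close>

text \<open>Coefficients up to \<open>n\<close> of a power involve only coefficients up to
  \<open>n\<close> of the base. Comparing no more than these allows the use of the lemma inside an
  induction on coefficients.\<close>

lemma fps_power_coeff_mono:
  fixes p q :: "real fps"
  assumes "\<And>j. j \<le> n \<Longrightarrow> 0 \<le> p $ j \<and> p $ j \<le> q $ j" "j \<le> n"
  shows "0 \<le> (p ^ k) $ j \<and> (p ^ k) $ j \<le> (q ^ k) $ j"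
  using assms(2)
proof (induction k arbitrary: j)
  case (Suc k)
  have le: "0 \<le> p $ i * (p ^ k) $ (j - i) \<and> p $ i * (p ^ k) $ (j - i) \<le> q $ i * (q ^ k) $ (j - i)"
    if "i \<in> {0..j}" for i
  proof -
    have i: "i \<le> n" "j - i \<le> n" using that Suc.prems by auto
    from assms(1)[OF i(1)] Suc.IH[OF i(2)] show ?thesis
      by (auto intro!: mult_mono)
  qed
  then show ?case by (auto simp: fps_mult_nth intro!: sum_nonneg sum_mono)
qed simp

text \<open>Taking the term of degree \<open>d\<close> from every factor is one of the non-negative
  contributions in degree \<open>k * d\<close>.\<close>

lemma fps_power_top_coeff_ge:
  fixes p :: "real fps"
  assumes "\<And>j. 0 \<le> p $ j"
  shows "(p $ d) ^ k \<le> (p ^ k) $ (k * d)"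
proof (induction k)
  case (Suc k)
  have nn: "0 \<le> (p ^ k) $ j" for j
    using fps_power_coeff_mono[of j p p j k] assms by auto
  have "p $ d * (p $ d) ^ k \<le> p $ d * (p ^ k) $ (k * d)"
    using Suc assms by (intro mult_left_mono) auto
  also have "\<dots> = (\<Sum>i\<in>{d}. p $ i * (p ^ k) $ (Suc k * d - i))" by simp
  also have "\<dots> \<le> (\<Sum>i=0..Suc k * d. p $ i * (p ^ k) $ (Suc k * d - i))"
    using assms nn by (intro sum_mono2) auto
  finally show ?case by (simp add: fps_mult_nth)
qed simp

context
  fixes f P :: "real fps"
  assumes f: "f $ 0 = 0" "f $ 1 = 1"
    and quot_nonneg: "\<And>n. 0 \<le> (fps_X / f) $ n"
    and P: "P $ 0 = 0" "\<And>n. 0 \<le> P $ n"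
    and ge: "\<And>n. fps_X $ n \<le> (f oo P) $ n"
begin

text \<open>The quotient in the ring of power series is exact once \<open>f\<close> divides
  \<open>fps_X\<close>; it does, being \<open>fps_X\<close> times a series with constant term 1,
  hence a unit.\<close>

lemma fps_times_quot: "f * (fps_X / f) = fps_X"
proof -
  have "f = fps_X * fps_shift 1 f"
    by (rule fps_ext) (use f in \<open>auto simp: fps_X_mult_nth\<close>)
  moreover have "fps_shift 1 f dvd 1"
    using f by (simp add: fps_is_unit_iff)
  ultimately have "f dvd fps_X"
    by (metis dvd_refl mult.right_neutral mult_dvd_mono)
  then show ?thesis by simp
qed

lemma quot_0: "(fps_X / f) $ 0 = 1"
proof -
  have "(f * (fps_X / f)) $ 1 = 1" unfolding fps_times_quot by simp
  then show ?thesis using f by (simp add: fps_mult_nth)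
qed

text \<open>With \<open>g = t / f\<close>, one has \<open>P = f(P) g(P)\<close> and \<open>f(P) \<ge> z\<close>.\<close>

lemma fixed_point_inequality: "(fps_X * ((fps_X / f) oo P)) $ n \<le> P $ n"
proof -
  have nn: "0 \<le> ((fps_X / f) oo P) $ j" for j
    unfolding fps_compose_nth
    using fps_power_coeff_mono[of j P P j] P quot_nonneg by (auto intro!: sum_nonneg)
  have "P = (f * (fps_X / f)) oo P" unfolding fps_times_quot using P by simp
  also have "\<dots> = (f oo P) * ((fps_X / f) oo P)"
    using P by (simp add: fps_compose_mult_distrib)
  finally have eq: "P = (f oo P) * ((fps_X / f) oo P)" .
  show ?thesis
    by (subst (2) eq, unfold fps_mult_nth, intro sum_mono mult_right_mono nn ge)
qed

lemma fps_inv_le: "fps_inv f $ n \<le> P $ n"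
proof -
  let ?p = "fps_inv f"
  have p: "f oo ?p = fps_X" "?p $ 0 = 0"
    using f fps_inv_right[of f] by (auto simp: fps_inv_def)
  have "?p = (f * (fps_X / f)) oo ?p" unfolding fps_times_quot using p by simp
  also have "\<dots> = fps_X * ((fps_X / f) oo ?p)"
    using p by (simp add: fps_compose_mult_distrib)
  finally have eq: "?p = fps_X * ((fps_X / f) oo ?p)" .
  \<comment> \<open>The factor \<open>fps_X\<close> in the fixed point equation makes coefficient
    \<open>n\<close> depend only on earlier coefficients of \<open>?p\<close>. Non-negativity of
    \<open>?p\<close> is carried along because monotonicity of powers needs it.\<close>
  have "0 \<le> ?p $ n \<and> ?p $ n \<le> P $ n"
  proof (induction n rule: less_induct)
    case (less n)
    show ?case
    proof (cases n)
      case 0 then show ?thesis using p P by simp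
    next
      case (Suc m)
      have pm: "0 \<le> (?p ^ i) $ m \<and> (?p ^ i) $ m \<le> (P ^ i) $ m" for i
        by (rule fps_power_coeff_mono[where n = m]) (use less Suc in auto)
      have pn: "?p $ n = (\<Sum>i=0..m. (fps_X / f) $ i * (?p ^ i) $ m)"
        by (subst eq) (simp add: Suc fps_X_mult_nth fps_compose_nth)
      also have "\<dots> \<le> (\<Sum>i=0..m. (fps_X / f) $ i * (P ^ i) $ m)"
        using pm quot_nonneg by (intro sum_mono mult_left_mono) auto
      also have "\<dots> \<le> P $ n"
        using fixed_point_inequality[of n] by (simp add: Suc fps_X_mult_nth fps_compose_nth)
      finally show ?thesis using pn pm quot_nonneg by (auto intro!: sum_nonneg)
    qed
  qed
  then show ?thesis ..
qed

text \<open>Write g for \<open>fps_X / f\<close>. If \<open>P\<close> had degree \<open>d\<close>,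
  the term of index \<open>m - 1\<close> in g(P) would reach degree \<open>(m - 1) * d\<close>, so
  that \<open>P\<close>, which dominates z g(P), would have a non-zero coefficient in degree
  \<open>(m - 1) * d + 1 > d\<close>.\<close>

lemma fps_not_polynomial:
  assumes m: "2 \<le> m" "\<And>j. 1 < j \<Longrightarrow> j < m \<Longrightarrow> f $ j = 0" "f $ m < 0"
  shows "infinite {n. P $ n \<noteq> 0}"
proof
  assume fin: "finite {n. P $ n \<noteq> 0}"
  have P1: "1 \<le> P $ 1"
    using fixed_point_inequality[of 1] quot_0 by (simp add: fps_X_mult_nth)
  define d where "d = Max {n. P $ n \<noteq> 0}"
  have d: "P $ d \<noteq> 0" "1 \<le> d" and top: "P $ n \<noteq> 0 \<Longrightarrow> n \<le> d" for n
  proof -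
    have "1 \<in> {n. P $ n \<noteq> 0}" using P1 by simp
    then show "P $ d \<noteq> 0" "1 \<le> d"
      using Max_in[OF fin] Max_ge[OF fin, of 1] unfolding d_def by auto
    show "n \<le> d" if "P $ n \<noteq> 0" for n
      using Max_ge[OF fin, of n] that unfolding d_def by simp
  qed
  \<comment> \<open>In the coefficient of degree \<open>m\<close> of f g = t only the indices 1 and
    \<open>m\<close> of \<open>f\<close> contribute, so the coefficient \<open>m - 1\<close> of g is
    minus the coefficient \<open>m\<close> of \<open>f\<close>, hence positive.\<close>
  have "(f * (fps_X / f)) $ m = 0" unfolding fps_times_quot using m by simp
  moreover have "(f * (fps_X / f)) $ m = (\<Sum>i\<in>{1, m}. f $ i * (fps_X / f) $ (m - i))"
    unfolding fps_mult_nth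
  proof (rule sum.mono_neutral_right)
    show "\<forall>i\<in>{0..m} - {1, m}. f $ i * (fps_X / f) $ (m - i) = 0"
    proof
      fix i assume "i \<in> {0..m} - {1, m}"
      then have "i = 0 \<or> 1 < i \<and> i < m" by auto
      then show "f $ i * (fps_X / f) $ (m - i) = 0" using m(2) f by auto
    qed
  qed (use m in auto)
  ultimately have g: "(fps_X / f) $ (m - 1) > 0"
    using f m(1,3) quot_0 by simp
  let ?N = "(m - 1) * d"
  have "0 < (fps_X / f) $ (m - 1) * (P $ d) ^ (m - 1)"
    using g d P(2)[of d] by (simp add: less_le)
  also have "\<dots> \<le> (fps_X / f) $ (m - 1) * (P ^ (m - 1)) $ ?N"
    using fps_power_top_coeff_ge[of P d "m - 1"] P g by (intro mult_left_mono) auto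
  also have "\<dots> = (\<Sum>i\<in>{m - 1}. (fps_X / f) $ i * (P ^ i) $ ?N)" by simp
  also have "\<dots> \<le> (\<Sum>i=0..?N. (fps_X / f) $ i * (P ^ i) $ ?N)"
    using d quot_nonneg fps_power_coeff_mono[of ?N P P ?N] P
    by (intro sum_mono2) auto
  also have "\<dots> \<le> P $ (?N + 1)"
    using fixed_point_inequality[of "?N + 1"] by (simp add: fps_X_mult_nth fps_compose_nth)
  finally have "?N + 1 \<le> d" using top[of "?N + 1"] by simp
  moreover have "1 * d \<le> ?N" using m(1) by (intro mult_right_mono) auto
  ultimately show False by linarith
qed

end

section \<open>Linear extension of functions on trees\<close>

definition lin_ext :: "('v optree \<Rightarrow> 'k) \<Rightarrow> ('k::field, 'v) tvec \<Rightarrow> 'k" where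
  "lin_ext \<phi> w = (\<Sum>t\<in>Poly_Mapping.keys w. Poly_Mapping.lookup w t * \<phi> t)"

lemma lin_ext_superset:
  assumes "finite A" "Poly_Mapping.keys w \<subseteq> A"
  shows "lin_ext \<phi> w = (\<Sum>t\<in>A. Poly_Mapping.lookup w t * \<phi> t)"
  unfolding lin_ext_def by (rule sum.mono_neutral_left) (use assms in \<open>auto simp: in_keys_iff\<close>)

lemma lin_ext_add [simp]: "lin_ext \<phi> (v + w) = lin_ext \<phi> v + lin_ext \<phi> w"
proof -
  let ?A = "Poly_Mapping.keys v \<union> Poly_Mapping.keys w"
  have "Poly_Mapping.keys (v + w) \<subseteq> ?A" by (rule Poly_Mapping.keys_add)
  then show ?thesis
    by (subst (1 2 3) lin_ext_superset[where A = ?A])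
      (auto simp: lookup_add algebra_simps sum.distrib)
qed

lemma lin_ext_scale [simp]: "lin_ext \<phi> (tscale c w) = c * lin_ext \<phi> w"
proof -
  have "Poly_Mapping.keys (tscale c w) \<subseteq> Poly_Mapping.keys w" by (auto simp: in_keys_iff)
  then show ?thesis
    by (subst lin_ext_superset[where A = "Poly_Mapping.keys w"])
      (auto simp: lin_ext_def sum_distrib_left mult.assoc)
qed

lemma lin_ext_single [simp]: "lin_ext \<phi> (Poly_Mapping.single t c) = c * \<phi> t"
  by (simp add: lin_ext_def)

lemma lin_ext_zero [simp]: "lin_ext \<phi> 0 = 0"
  by (simp add: lin_ext_def)

lemma lin_ext_diff [simp]: "lin_ext \<phi> (v - w) = lin_ext \<phi> v - lin_ext \<phi> w"
  by (metis add_diff_cancel_right' diff_add_cancel lin_ext_add)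

lemma lin_ext_tmap: "lin_ext \<phi> (tmap h w) = lin_ext (\<lambda>t. \<phi> (h t)) w"
  by (rule tvec_induct[where A = UNIV]) auto

lemma lin_ext_eq_0:
  "(\<And>t. t \<in> Poly_Mapping.keys w \<Longrightarrow> \<phi> t = 0) \<Longrightarrow> lin_ext \<phi> w = 0"
  by (simp add: lin_ext_def)

lemma lin_ext_mult_right: "lin_ext (\<lambda>t. \<phi> t * c) w = lin_ext \<phi> w * c"
  by (simp add: lin_ext_def sum_distrib_right mult.assoc)

lemma lin_ext_mult_left: "lin_ext (\<lambda>t. c * \<phi> t) w = c * lin_ext \<phi> w"
  by (simp add: lin_ext_def sum_distrib_left mult_ac)

lemma lin_ext_fun_sum: "lin_ext (\<lambda>t. \<Sum>i\<in>A. \<phi> i t) w = (\<Sum>i\<in>A. lin_ext (\<phi> i) w)"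
  by (simp add: lin_ext_def sum_distrib_left sum.swap[of _ A])

lemma lin_ext_span_eq_0:
  assumes "w \<in> tv.span S" "\<And>v. v \<in> S \<Longrightarrow> lin_ext \<phi> v = 0"
  shows "lin_ext \<phi> w = 0"
  using assms(1) by (induction rule: tv.span_induct_alt) (use assms(2) in auto)

lemma keys_tmap: "Poly_Mapping.keys (tmap h w) \<subseteq> h ` Poly_Mapping.keys w"
proof -
  have "Poly_Mapping.keys (tmap h w) \<subseteq>
    (\<Union>t\<in>Poly_Mapping.keys w. Poly_Mapping.keys (Poly_Mapping.single (h t) (Poly_Mapping.lookup w t)))"
    unfolding tmap_def by (rule Poly_Mapping.keys_sum)
  then show ?thesis by (auto split: if_splits)
qed

lemma tvec_expand: "w = (\<Sum>t\<in>Poly_Mapping.keys w. tscale (Poly_Mapping.lookup w t) (tvec t))"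
proof -
  have "w = tmap id w" by simp
  then show ?thesis by (simp add: tmap_def)
qed

section \<open>Leaves and labellings of trees\<close>

text \<open>Multisets are used because the trees \<open>u j\<close> may share or repeat labels. All
  trees with the same leaves thus acquire the same multiset of leaves under a common
  substitution.\<close>

lemma mset_leaves_bind:
  "mset (leaves (bind t u)) = \<Sum>\<^sub># (image_mset (\<lambda>j. mset (leaves (u j))) (mset (leaves t)))"
proof -
  have "mset (leaves (bind t u)) = sum_list (map (\<lambda>j. mset (leaves (u j))) (leaves t))"
    by (simp add: leaves_bind mset_concat comp_def)
  also have "\<dots> = \<Sum>\<^sub># (mset (map (\<lambda>j. mset (leaves (u j))) (leaves t)))"
    by (simp only: sum_mset_sum_list)
  finally show ?thesis by (simp only: mset_map)
qed

lemma mset_leaves_trees: "t \<in> trees X n \<Longrightarrow> mset (leaves t) = mset [0..<n]"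
  unfolding trees_def mem_Collect_eq
  by (rule iffD1[OF set_eq_iff_mset_eq_distinct]) (auto simp only: distinct_upt set_upt atLeast0LessThan)

lemma leaves_relabel [simp]: "leaves (relabel \<sigma> t) = map \<sigma> (leaves t)"
  by (simp add: relabel_def leaves_bind)

lemma decorated_relabel: "decorated X t \<Longrightarrow> decorated X (relabel \<sigma> t)"
  unfolding relabel_def by (rule decorated_bind) auto

definition en :: "nat set \<Rightarrow> nat \<Rightarrow> nat" where
  "en S = (SOME h. bij_betw h {..<card S} S)"

definition rk :: "nat set \<Rightarrow> nat \<Rightarrow> nat" where
  "rk S = inv_into {..<card S} (en S)"

lemma bij_en: "finite S \<Longrightarrow> bij_betw (en S) {..<card S} S"
  unfolding en_def using ex_bij_betw_nat_finite[of S] by (metis atLeast0LessThan someI_ex)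

lemma bij_rk: "finite S \<Longrightarrow> bij_betw (rk S) S {..<card S}"
  unfolding rk_def by (rule bij_betw_inv_into[OF bij_en])

lemma en_rk: "finite S \<Longrightarrow> x \<in> S \<Longrightarrow> en S (rk S x) = x"
  unfolding rk_def by (rule bij_betw_inv_into_right[OF bij_en])

lemma rk_en: "finite S \<Longrightarrow> i < card S \<Longrightarrow> rk S (en S i) = i"
  unfolding rk_def by (rule bij_betw_inv_into_left[OF bij_en]) auto

lemma relabel_cong: "(\<And>j. j \<in> set (leaves t) \<Longrightarrow> g j = h j) \<Longrightarrow> relabel g t = relabel h t"
  unfolding relabel_def by (rule bind_cong) auto

lemma relabel_en_rk: "finite S \<Longrightarrow> set (leaves t) \<subseteq> S \<Longrightarrow> relabel (en S) (relabel (rk S) t) = t"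
  using relabel_cong[of t "en S \<circ> rk S" id] by (simp add: relabel_relabel en_rk subset_iff)

lemma relabel_rk_en:
  "finite S \<Longrightarrow> set (leaves t) \<subseteq> {..<card S} \<Longrightarrow> relabel (rk S) (relabel (en S) t) = t"
  using relabel_cong[of t "rk S \<circ> en S" id] by (simp add: relabel_relabel rk_en subset_iff)

lemma relabel_rk_trees:
  assumes "decorated X t" "distinct (leaves t)" "set (leaves t) = S"
  shows "relabel (rk S) t \<in> trees X (card S)"
  using assms bij_rk[of S] unfolding trees_def bij_betw_def
  by (auto simp: decorated_relabel distinct_map)

lemma relabel_en_leaves:
  assumes "finite S" "t \<in> trees X (card S)"
  shows "distinct (leaves (relabel (en S) t))" "set (leaves (relabel (en S) t)) = S"
  using assms bij_en[of S] unfolding trees_def bij_betw_def by (auto simp: distinct_map)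

text \<open>
  Replacing the leaf \<open>i\<close> of a tree \<open>q\<close> by \<open>bind t u\<close>, where \<open>t\<close> has \<open>n\<close> leaves, and the other
  leaves by \<open>s\<close>, amounts to grafting \<open>t\<close> onto \<open>q\<close> followed by the substitution \<open>plug\<close>.
\<close>

definition plug :: "nat \<Rightarrow> nat \<Rightarrow> (nat \<Rightarrow> 'a) \<Rightarrow> (nat \<Rightarrow> 'a) \<Rightarrow> nat \<Rightarrow> 'a" where
  "plug i n s u p = (if p < i then s p else if p < i + n then u (p - i) else s (p + 1 - n))"

lemma plug_slot: "j \<noteq> i \<Longrightarrow> plug i n s u (slot i n j) = s j"
  by (auto simp: plug_def slot_def)

lemma plug_inner: "l < n \<Longrightarrow> plug i n s u (i + l) = u l"
  by (auto simp: plug_def)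

lemma bind_graft_plug:
  assumes "t \<in> trees X n"
  shows "bind (graft i n q t) (plug i n s u) = bind q (s(i := bind t u))"
  unfolding graft_def bind_bind
proof (rule bind_cong)
  fix j
  have "bind t (\<lambda>l. plug i n s u (i + l)) = bind t u"
    using assms by (intro bind_cong) (auto simp: trees_def plug_inner)
  then show "bind (if j = i then relabel (\<lambda>l. i + l) t else Leaf (slot i n j)) (plug i n s u) =
      (s(i := bind t u)) j"
    by (simp add: relabel_def bind_bind plug_slot)
qed

section \<open>The projection onto the operad\<close>

locale presented_operad = symmetric_operad P
  for P :: "('k::field, 'v::ab_group_add) operad" +
  fixes X :: "nat \<Rightarrow> 'v set" and \<pi> :: "nat \<Rightarrow> ('k, 'v) tvec \<Rightarrow> 'v"
  assumes connected: "connected_operad P"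
    and generators: "minimal_generators P X"
    and surjection: "natural_surjection P X \<pi>"
begin

sublocale vs: vector_space "scl P"
  by (rule vector_space_scl)

abbreviation M :: "('k, 'v) smodule" where
  "M \<equiv> restrict_smodule P X"

abbreviation F :: "('k, ('k, 'v) tvec) operad" where
  "F \<equiv> free_operad M"

lemma M_simps [simp]: "cmpt M = X" "scl M = scl P" "act M = act P"
  by (simp_all add: restrict_smodule_def)

text \<open>The map \<open>\<pi>\<close> is controlled only on the chosen representatives. Composing
  it with \<open>tree_rep\<close> yields a map on all formal combinations, where grafting and
  relabelling need no choice of representatives.\<close>

definition pi :: "nat \<Rightarrow> ('k, 'v) tvec \<Rightarrow> 'v" where
  "pi n w = \<pi> n (tree_rep M n w)"

lemma X_subspace: "vs.subspace (X n)" and X_subset: "X n \<subseteq> cmpt P n"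
  and X_act: "\<sigma> permutes {..<n} \<Longrightarrow> x \<in> X n \<Longrightarrow> act P n \<sigma> x \<in> X n"
  and X_small: "n < 2 \<Longrightarrow> X n = {0}"
proof -
  note g = generators[unfolded minimal_generators_def S_submodule_def]
  show "vs.subspace (X n)" "X n \<subseteq> cmpt P n" using g[THEN conjunct1, THEN conjunct1] by simp_all
  show "act P n \<sigma> x \<in> X n" if "\<sigma> permutes {..<n}" "x \<in> X n"
    using g[THEN conjunct1, THEN conjunct2, rule_format, OF that(1)] that(2) by blast
  show "X n = {0}" if "n < 2"
    using g[THEN conjunct2, THEN conjunct1] that by simp
qed

lemma P0: "cmpt P 0 = {0}" and P1: "cmpt P 1 = range (\<lambda>c. scl P c (one P))" and one_nz: "one P \<noteq> 0"
  using connected unfolding connected_operad_def by blast+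

lemma pcomp_zero_left: "i < m \<Longrightarrow> g \<in> cmpt P n \<Longrightarrow> pcomp P m i n 0 g = 0"
  using pcomp_scl_left[of i m 0 g n 0] vs.subspace_0[OF subspace_cmpt] by simp

lemma pcomp_zero_right: "i < m \<Longrightarrow> f \<in> cmpt P m \<Longrightarrow> pcomp P m i n f 0 = 0"
  using pcomp_scl_right[of i m f 0 n 0] vs.subspace_0[OF subspace_cmpt] by simp

lemma act_zero: "\<sigma> permutes {..<n} \<Longrightarrow> act P n \<sigma> 0 = 0"
  using act_scl[of \<sigma> n 0 0] vs.subspace_0[OF subspace_cmpt] by simp

lemma tree_rep_cmpt: "w \<in> tree_space X n \<Longrightarrow> tree_rep M n w \<in> cmpt F n"
  by (simp add: cmpt_free tree_rep_closed[of _ M, simplified] tree_rep_idem[of _ M, simplified])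

lemma hom:
  "x \<in> cmpt F n \<Longrightarrow> \<pi> n x \<in> cmpt P n"
  "x \<in> cmpt F n \<Longrightarrow> y \<in> cmpt F n \<Longrightarrow> \<pi> n (x + y) = \<pi> n x + \<pi> n y"
  "x \<in> cmpt F n \<Longrightarrow> \<pi> n (tscale c x) = scl P c (\<pi> n x)"
  "\<sigma> permutes {..<n} \<Longrightarrow> x \<in> cmpt F n \<Longrightarrow> \<pi> n (act F n \<sigma> x) = act P n \<sigma> (\<pi> n x)"
  "\<pi> 1 (one F) = one P"
  "i < m \<Longrightarrow> f \<in> cmpt F m \<Longrightarrow> g \<in> cmpt F n \<Longrightarrow>
    \<pi> (m + n - 1) (pcomp F m i n f g) = pcomp P m i n (\<pi> m f) (\<pi> n g)"
  "z \<in> X n \<Longrightarrow> \<pi> n (free_gen M n z) = z"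
proof -
  have h: "operad_hom F P \<pi>" and g: "\<And>n x. x \<in> X n \<Longrightarrow> \<pi> n (free_gen M n x) = x"
    using surjection unfolding natural_surjection_def by blast+
  note h = h[unfolded operad_hom_def]
  note c1 = h[THEN conjunct1] and h = h[THEN conjunct2]
  note c2 = h[THEN conjunct1] and h = h[THEN conjunct2]
  note c3 = h[THEN conjunct1] and h = h[THEN conjunct2]
  note c4 = h[THEN conjunct1] and h = h[THEN conjunct2]
  note c5 = h[THEN conjunct1] and c6 = h[THEN conjunct2]
  show "x \<in> cmpt F n \<Longrightarrow> \<pi> n x \<in> cmpt P n"
    using c1 by blast
  show "x \<in> cmpt F n \<Longrightarrow> y \<in> cmpt F n \<Longrightarrow> \<pi> n (x + y) = \<pi> n x + \<pi> n y"
    using c2 by blast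
  show "\<pi> n (tscale c x) = scl P c (\<pi> n x)" if "x \<in> cmpt F n"
    using c3[rule_format, OF that, of c] by (simp only: free_simps)
  show "\<sigma> permutes {..<n} \<Longrightarrow> x \<in> cmpt F n \<Longrightarrow> \<pi> n (act F n \<sigma> x) = act P n \<sigma> (\<pi> n x)"
    by (rule c4[rule_format])
  show "\<pi> 1 (one F) = one P" by (rule c5)
  show "i < m \<Longrightarrow> f \<in> cmpt F m \<Longrightarrow> g \<in> cmpt F n \<Longrightarrow>
      \<pi> (m + n - 1) (pcomp F m i n f g) = pcomp P m i n (\<pi> m f) (\<pi> n g)"
    by (rule c6[rule_format])
  show "z \<in> X n \<Longrightarrow> \<pi> n (free_gen M n z) = z" by (rule g)
qed

lemma pi_closed: "w \<in> tree_space X n \<Longrightarrow> pi n w \<in> cmpt P n"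
  unfolding pi_def by (intro hom tree_rep_cmpt)

lemma pi_add: "v \<in> tree_space X n \<Longrightarrow> w \<in> tree_space X n \<Longrightarrow> pi n (v + w) = pi n v + pi n w"
  unfolding pi_def tree_rep_add by (intro hom tree_rep_cmpt)

lemma pi_scale: "w \<in> tree_space X n \<Longrightarrow> pi n (tscale c w) = scl P c (pi n w)"
  unfolding pi_def tree_rep_scale by (intro hom tree_rep_cmpt)

lemma pi_zero [simp]: "pi n 0 = 0"
  using pi_scale[of 0 n 0] tree_space_intros(1)[of X n] by simp

lemma pi_diff:
  assumes "v \<in> tree_space X n" "w \<in> tree_space X n"
  shows "pi n (v - w) = pi n v - pi n w"
  using pi_add[of "v - w" n w] assms tv.subspace_diff[OF subspace_tree_space assms] by simp

lemma pi_sum: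
  "(\<And>i. i \<in> A \<Longrightarrow> w i \<in> tree_space X n) \<Longrightarrow> pi n (sum w A) = (\<Sum>i\<in>A. pi n (w i))"
proof (induction A rule: infinite_finite_induct)
  case (insert x A)
  then have "sum w A \<in> tree_space X n" by (intro tv.subspace_sum[OF subspace_tree_space]) auto
  with insert show ?case by (simp add: pi_add)
qed auto

lemma pi_trel: "w \<in> tree_space X n \<Longrightarrow> w \<in> trel M \<Longrightarrow> pi n w = 0"
  using tree_rep_eq_0[of w M n] pi_zero[of n] tree_rep_eq_0[of 0 M n]
  by (simp add: pi_def tree_space_intros tv.span_zero)

lemma pi_act:
  assumes "\<sigma> permutes {..<n}" "w \<in> tree_space X n"
  shows "pi n (tmap (relabel \<sigma>) w) = act P n \<sigma> (pi n w)"
proof -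
  have "act P n \<sigma> (pi n w) = \<pi> n (act F n \<sigma> (tree_rep M n w))"
    unfolding pi_def by (rule hom(4)[symmetric]) (intro assms tree_rep_cmpt)+
  also have "\<dots> = pi n (tmap (relabel \<sigma>) w)"
    unfolding pi_def free_simps using assms by (simp add: tree_rep_act)
  finally show ?thesis ..
qed

lemma pi_pcomp:
  assumes "i < m" "v \<in> tree_space X m" "w \<in> tree_space X n"
  shows "pi (m + n - 1) (tmap2 (graft i n) v w) = pcomp P m i n (pi m v) (pi n w)"
proof -
  have t: "tree_rep M n w \<in> tree_space X n"
    using tree_rep_closed[of w M n] assms by simp
  have "pcomp P m i n (pi m v) (pi n w) = \<pi> (m + n - 1) (pcomp F m i n (tree_rep M m v) (tree_rep M n w))"
    unfolding pi_def by (rule hom(6)[symmetric]) (intro assms tree_rep_cmpt)+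
  also have "\<dots> = pi (m + n - 1) (tmap2 (graft i n) v w)"
    unfolding pi_def free_simps
    using tree_rep_graft[of i m v M w n] tree_rep_graft(1)[of i m v M "tree_rep M n w" n] assms t by simp
  finally show ?thesis ..
qed

lemma pi_one: "pi 1 (tvec (Leaf 0)) = one P"
  using hom(5) unfolding pi_def free_simps .

text \<open>The image of \<open>pi\<close> is a suboperad containing \<open>X\<close>, and
  \<open>X\<close> generates \<open>P\<close>.\<close>

lemma pi_surj: "pi n ` tree_space X n = cmpt P n"
proof -
  have "suboperad P (\<lambda>n. pi n ` tree_space X n)"
    unfolding suboperad_def S_submodule_def
  proof (intro conjI allI impI ballI)
    fix n
    show "vs.subspace (pi n ` tree_space X n)"
      unfolding vs.subspace_def
    proof (intro conjI ballI allI)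
      show "0 \<in> pi n ` tree_space X n"
        using tree_space_intros(1) by (rule image_eqI[rotated]) simp
    next
      fix x y assume "x \<in> pi n ` tree_space X n" "y \<in> pi n ` tree_space X n"
      then show "x + y \<in> pi n ` tree_space X n"
        by (auto simp flip: pi_add intro!: imageI tree_space_intros)
    next
      fix c x assume "x \<in> pi n ` tree_space X n"
      then show "scl P c x \<in> pi n ` tree_space X n"
        by (auto simp flip: pi_scale intro!: imageI tree_space_intros)
    qed
    show "pi n ` tree_space X n \<subseteq> cmpt P n" using pi_closed by auto
    fix \<sigma> :: "nat \<Rightarrow> nat" assume "\<sigma> permutes {..<n}"
    then show "act P n \<sigma> ` pi n ` tree_space X n \<subseteq> pi n ` tree_space X n"
      by (auto simp flip: pi_act intro!: imageI act_tree_space)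
  next
    show "one P \<in> pi 1 ` tree_space X 1"
      unfolding pi_one[symmetric] using tvec_tree_space[OF Leaf_tree] by (intro imageI) simp
  next
    fix m n i :: nat and f g
    assume "i < m" "f \<in> pi m ` tree_space X m" "g \<in> pi n ` tree_space X n"
    then show "pcomp P m i n f g \<in> pi (m + n - 1) ` tree_space X (m + n - 1)"
      by (auto simp flip: pi_pcomp simp del: One_nat_def intro!: imageI pcomp_tree_space)
  qed
  moreover have "X n \<subseteq> pi n ` tree_space X n" for n
  proof
    fix x assume x: "x \<in> X n"
    then have "pi n (tvec (Node x (map Leaf [0..<n]))) = x"
      using hom(7)[of x n] by (simp add: pi_def free_gen_def)
    moreover have "tvec (Node x (map Leaf [0..<n])) \<in> tree_space X n"
      using corolla_tree[of x M n] x by (intro tvec_tree_space) simp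
    ultimately show "x \<in> pi n ` tree_space X n" by (metis imageI)
  qed
  ultimately show ?thesis
    using generators unfolding minimal_generators_def generates_def by blast
qed

section \<open>Compositions with elements of the kernel\<close>

text \<open>This is the kernel before passing to representatives, so it also contains the
  combinations of arity \<open>n\<close> in \<open>trel M\<close>.\<close>

definition ker_pi :: "nat \<Rightarrow> ('k, 'v) tvec set" where
  "ker_pi n = {w \<in> tree_space X n. pi n w = 0}"

lemma tmap_graft_left: "tmap (\<lambda>t. graft j n t s) w = tmap2 (graft j n) w (tvec s)"
  by (simp add: tmap2_single_right)

lemma tmap_graft_right: "tmap (graft j n t) w = tmap2 (graft j n) (tvec t) w"
  by (simp add: tmap2_single_left)

lemma ker_pi_graft_left:
  assumes "w \<in> ker_pi m" "j < m" "s \<in> trees X n"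
  shows "tmap (\<lambda>t. graft j n t s) w \<in> ker_pi (m + n - 1)"
  using assms pi_closed[OF tvec_tree_space[OF assms(3)]] unfolding ker_pi_def tmap_graft_left
  by (simp add: pi_pcomp pcomp_tree_space tvec_tree_space pcomp_zero_left del: One_nat_def)

lemma ker_pi_graft_right:
  assumes "w \<in> ker_pi n" "j < m" "t \<in> trees X m"
  shows "tmap (graft j n t) w \<in> ker_pi (m + n - 1)"
  using assms pi_closed[OF tvec_tree_space[OF assms(3)]] unfolding ker_pi_def tmap_graft_right
  by (simp add: pi_pcomp pcomp_tree_space tvec_tree_space pcomp_zero_right del: One_nat_def)

lemma distinct_leaves_bind:
  assumes "distinct (leaves (bind t u))" "j \<in> set (leaves t)"
  shows "distinct (leaves (u j))"
  using assms unfolding leaves_bind by (auto simp: distinct_concat_iff)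

lemma leaves_bind_Leaf: "(\<And>j. j \<in> set (leaves t) \<Longrightarrow> u j = Leaf (\<sigma> j)) \<Longrightarrow> bind t u = relabel \<sigma> t"
  unfolding relabel_def by (rule bind_cong)

text \<open>
  The induction grafts the non-trivial trees \<open>u j\<close> one at a time, so that each step is a partial
  composition in the operad.
\<close>

lemma ker_pi_bind:
  assumes "w \<in> ker_pi m" "\<And>j. decorated X (u j)"
    and "\<And>t. t \<in> Poly_Mapping.keys w \<Longrightarrow> bind t u \<in> trees X n"
  shows "tmap (\<lambda>t. bind t u) w \<in> ker_pi n"
  using assms
proof (induction "card {j. j < m \<and> u j \<notin> range Leaf}" arbitrary: m w u rule: less_induct)
  case less
  note keys = \<open>w \<in> ker_pi m\<close>[unfolded ker_pi_def tree_space_def, simplified]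
  show ?case
  proof (cases "w = 0")
    case True
    then show ?thesis by (simp add: ker_pi_def tree_space_intros)
  next
    case False
    then obtain t0 where t0: "t0 \<in> Poly_Mapping.keys w" by (metis all_not_in_conv keys_eq_empty)
    then have t0m: "distinct (leaves t0)" "set (leaves t0) = {..<m}" using keys by (auto simp: trees_def)
    have b0: "distinct (leaves (bind t0 u))" "set (leaves (bind t0 u)) = {..<n}"
      using less.prems(3)[OF t0] by (auto simp: trees_def)
    show ?thesis
    proof (cases "\<exists>j<m. u j \<notin> range Leaf")
      \<comment> \<open>Only leaves are substituted. As \<open>bind t0 u\<close> has the leaves
        \<open>0, ..., n - 1\<close> without repetition, the substitution is a relabelling by a
        permutation.\<close>
      case False
      then have "\<forall>j. \<exists>l. j < m \<longrightarrow> u j = Leaf l" by blast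
      then obtain \<sigma>0 where \<sigma>0: "\<And>j. j < m \<Longrightarrow> u j = Leaf (\<sigma>0 j)" by metis
      define \<sigma> where "\<sigma> j = (if j < m then \<sigma>0 j else j)" for j
      have u: "bind t u = relabel \<sigma> t" if "t \<in> Poly_Mapping.keys w" for t
        using that keys by (intro leaves_bind_Leaf) (auto simp: trees_def \<sigma>_def \<sigma>0)
      have "inj_on \<sigma> {..<m}" "\<sigma> ` {..<m} = {..<n}"
        using b0 t0m unfolding u[OF t0] leaves_relabel distinct_map by auto
      moreover from this have mn: "m = n" using card_image[of \<sigma> "{..<m}"] by simp
      ultimately have "\<sigma> permutes {..<m}"
        by (intro bij_imp_permutes) (auto simp: bij_betw_def \<sigma>_def)
      moreover have "tmap (\<lambda>t. bind t u) w = tmap (relabel \<sigma>) w"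
        by (rule tmap_cong) (rule u)
      ultimately show ?thesis using less.prems(1) mn
        by (simp add: ker_pi_def pi_act act_tree_space act_zero)
    next
      case True
      then obtain j where j: "j < m" "u j \<notin> range Leaf" by blast
      define S where "S = set (leaves (u j))"
      define k where "k = card S"
      define c where "c = relabel (rk S) (u j)"
      \<comment> \<open>After the standardised copy \<open>c\<close> of \<open>u j\<close> has been
        grafted, \<open>u'\<close> restores its labels and performs the remaining substitutions. The
        inputs of \<open>c\<close> receive leaves, so the number of proper trees drops.\<close>
      define u' where "u' = plug j k u (\<lambda>l. Leaf (en S l))"
      let ?w = "tmap (\<lambda>t. graft j k t c) w"
      have fS: "finite S" by (simp add: S_def)
      have c: "c \<in> trees X k"
        unfolding c_def k_def using less.prems(2) distinct_leaves_bind[OF b0(1), of j] t0m j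
        by (intro relabel_rk_trees) (auto simp: S_def)
      have "bind c (\<lambda>l. Leaf (en S l)) = u j"
        unfolding c_def relabel_def[of "en S", symmetric] using fS by (intro relabel_en_rk) (auto simp: S_def)
      then have bind_eq: "bind (graft j k t c) u' = bind t u" for t
        unfolding u'_def bind_graft_plug[OF c] by simp
      have u'_dec: "decorated X (u' l)" for l
        using less.prems(2) by (simp add: u'_def plug_def)
      have "{p. p < m + k - 1 \<and> u' p \<notin> range Leaf} \<subseteq> slot j k ` ({l. l < m \<and> u l \<notin> range Leaf} - {j})"
      proof
        fix p assume "p \<in> {p. p < m + k - 1 \<and> u' p \<notin> range Leaf}"
        then have p: "p < m + k - 1" "u' p \<notin> range Leaf" by auto
        show "p \<in> slot j k ` ({l. l < m \<and> u l \<notin> range Leaf} - {j})"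
        proof (cases "p < j")
          case True
          then show ?thesis using p j by (intro image_eqI[of _ _ p]) (auto simp: u'_def plug_def slot_def)
        next
          case False
          then have "\<not> p < j + k" using p(2) by (auto simp: u'_def plug_def)
          then show ?thesis using False p j
            by (intro image_eqI[of _ _ "p + 1 - k"]) (auto simp: u'_def plug_def slot_def)
        qed
      qed
      then have "card {p. p < m + k - 1 \<and> u' p \<notin> range Leaf} \<le>
          card ({l. l < m \<and> u l \<notin> range Leaf} - {j})"
        by (intro surj_card_le) auto
      also have "\<dots> < card {l. l < m \<and> u l \<notin> range Leaf}"
        using j by (intro psubset_card_mono) auto
      finally have "tmap (\<lambda>t. bind t u') ?w \<in> ker_pi n"
      proof (rule less.hyps[OF _ _ u'_dec])
        show "?w \<in> ker_pi (m + k - 1)" by (rule ker_pi_graft_left) (use less.prems(1) j c in auto)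
        fix t assume "t \<in> Poly_Mapping.keys ?w"
        then obtain t' where "t' \<in> Poly_Mapping.keys w" "t = graft j k t' c"
          using keys_tmap by blast
        then show "bind t u' \<in> trees X n" using less.prems(3) by (simp add: bind_eq)
      qed
      then show ?thesis by (simp add: tmap_tmap bind_eq)
    qed
  qed
qed

text \<open>A subtree of a tree may have any leaf labels, whereas \<open>ker_pi\<close> admits only
  \<open>0, ..., n - 1\<close>. Closing the kernel under arbitrary substitutions removes this
  restriction; labels may even be repeated.\<close>

definition null :: "('k, 'v) tvec set" where
  "null = {tmap (\<lambda>t. bind t u) w |u w m. w \<in> ker_pi m \<and> (\<forall>j. decorated X (u j))}"

lemma null_bind:
  assumes "w \<in> null" "\<And>j. decorated X (v j)"
  shows "tmap (\<lambda>t. bind t v) w \<in> null"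
proof -
  obtain u w0 m where w: "w = tmap (\<lambda>t. bind t u) w0" "w0 \<in> ker_pi m" "\<And>j. decorated X (u j)"
    using assms(1) unfolding null_def by blast
  have "tmap (\<lambda>t. bind t v) w = tmap (\<lambda>t. bind t (\<lambda>j. bind (u j) v)) w0"
    unfolding w tmap_tmap bind_bind ..
  moreover have "decorated X (bind (u j) v)" for j
    using w(3) assms(2) by (intro decorated_bind) auto
  ultimately show ?thesis using w(2) unfolding null_def by blast
qed

text \<open>Once the labels of \<open>q\<close> are standardised, this is a graft of
  \<open>w\<close> onto the tree \<open>q0\<close>, which the kernel absorbs, followed by the single
  substitution \<open>v\<close>.\<close>

lemma null_substitute:
  assumes q: "decorated X q" "distinct (leaves q)" "i \<in> set (leaves q)"
    and w: "w \<in> ker_pi n" and dec: "\<And>j. decorated X (s j)" "\<And>j. decorated X (u j)"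
  shows "tmap (\<lambda>t. bind q (s(i := bind t u))) w \<in> null"
proof -
  define S where "S = set (leaves q)"
  define q0 where "q0 = relabel (rk S) q"
  define i0 where "i0 = rk S i"
  define v where "v = plug i0 n (\<lambda>j. s (en S j)) u"
  have fS: "finite S" "i \<in> S" using q by (auto simp: S_def)
  have q0: "q0 \<in> trees X (card S)"
    unfolding q0_def using q by (intro relabel_rk_trees) (auto simp: S_def)
  have i0: "i0 < card S" using bij_betwE[OF bij_rk[OF fS(1)]] fS(2) by (auto simp: i0_def)
  have eq: "bind (graft i0 n q0 t) v = bind q (s(i := bind t u))" if "t \<in> trees X n" for t
  proof -
    have "bind (graft i0 n q0 t) v = bind q0 ((\<lambda>j. s (en S j))(i0 := bind t u))"
      unfolding v_def by (rule bind_graft_plug[OF that])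
    also have "\<dots> = bind q (s(i := bind t u))"
      unfolding q0_def relabel_def bind_bind
    proof (rule bind_cong)
      fix j assume "j \<in> set (leaves q)"
      then have "rk S j = i0 \<longleftrightarrow> j = i" and "en S (rk S j) = j"
        using en_rk[OF fS(1)] fS(2) unfolding i0_def S_def by metis+
      then show "bind (Leaf (rk S j)) ((\<lambda>j. s (en S j))(i0 := bind t u)) = (s(i := bind t u)) j"
        by simp
    qed
    finally show ?thesis .
  qed
  have "tmap (\<lambda>t. bind q (s(i := bind t u))) w = tmap (\<lambda>t. bind (graft i0 n q0 t) v) w"
    using w by (intro tmap_cong) (auto simp: eq ker_pi_def tree_space_def)
  also have "\<dots> = tmap (\<lambda>t. bind t v) (tmap (graft i0 n q0) w)"
    unfolding tmap_tmap ..
  finally have "tmap (\<lambda>t. bind q (s(i := bind t u))) w =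
    tmap (\<lambda>t. bind t v) (tmap (graft i0 n q0) w)" .
  moreover have "decorated X (v j)" for j using dec by (simp add: v_def plug_def)
  ultimately show ?thesis
    using ker_pi_graft_right[OF w i0 q0] unfolding null_def by blast
qed

end

section \<open>The ideal of relations\<close>

lemma span_tmap:
  assumes "w \<in> tv.span S" "\<And>v. v \<in> S \<Longrightarrow> tmap h v \<in> tv.span S'"
  shows "tmap h w \<in> tv.span S'"
  using assms(1)
  by (induction rule: tv.span_induct_alt) (use assms(2) in \<open>auto intro: tv.span_add tv.span_scale tv.span_zero\<close>)

lemma Leaf_trees:
  assumes "Leaf j \<in> trees X n"
  shows "j = 0" "n = 1"
proof -
  have n: "{..<n} = {j}" using assms unfolding trees_def by auto
  then have "card {..<n} = card {j}" by (rule arg_cong)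
  then show "n = 1" by simp
  then have "0 \<in> {..<n}" by simp
  then show "j = 0" unfolding n by simp
qed

locale presented_operad_relations = presented_operad P X \<pi>
  for P :: "('k::field, 'v::ab_group_add) operad" and X \<pi> +
  fixes R :: "nat \<Rightarrow> ('k, 'v) tvec set"
  assumes R_submodule: "S_submodule (free_operad (restrict_smodule P X)) R"
    and R_generates: "ideal_generated (free_operad (restrict_smodule P X)) R =
      kernel (free_operad (restrict_smodule P X)) \<pi>"
begin

lemma R_subspace: "tv.subspace (R n)" and R_cmpt: "R n \<subseteq> cmpt F n"
  and R_act: "\<sigma> permutes {..<n} \<Longrightarrow> r \<in> R n \<Longrightarrow> tree_rep M n (tmap (relabel \<sigma>) r) \<in> R n"
proof -
  note g = R_submodule[unfolded S_submodule_def free_simps]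
  show "tv.subspace (R n)" "R n \<subseteq> cmpt F n" using g[THEN conjunct1] by simp_all
  show "tree_rep M n (tmap (relabel \<sigma>) r) \<in> R n" if "\<sigma> permutes {..<n}" "r \<in> R n"
    using g[THEN conjunct2, rule_format, OF that(1)] that(2) by blast
qed

lemma subspace_ker_pi: "tv.subspace (ker_pi n)"
proof (rule tv.subspaceI)
  show "0 \<in> ker_pi n" by (simp add: ker_pi_def tree_space_intros)
  show "v + w \<in> ker_pi n" if "v \<in> ker_pi n" "w \<in> ker_pi n" for v w
    using that tree_space_intros(2)[of v X n w] by (simp add: ker_pi_def pi_add)
  show "tscale c w \<in> ker_pi n" if "w \<in> ker_pi n" for c w
    using that tree_space_intros(3)[of w X n c] by (simp add: ker_pi_def pi_scale)
qed

lemma cmpt_F_iff: "w \<in> cmpt F n \<longleftrightarrow> w \<in> tree_space X n \<and> tree_rep M n w = w"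
  by (simp add: cmpt_free)

lemma pi_cmpt_F: "w \<in> cmpt F n \<Longrightarrow> pi n w = \<pi> n w"
  by (simp add: pi_def cmpt_F_iff)

lemma R_ker: "R n \<subseteq> ker_pi n"
proof
  fix r assume r: "r \<in> R n"
  then have "r \<in> ideal_generated F R n" unfolding ideal_generated_def by blast
  then have "r \<in> cmpt F n" "\<pi> n r = 0" unfolding R_generates kernel_def by auto
  then show "r \<in> ker_pi n" using pi_cmpt_F by (simp add: ker_pi_def cmpt_F_iff)
qed

definition inner_relations :: "('k, 'v) tvec set" where
  "inner_relations = {tmap (\<lambda>t. Node x (ss @ t # ts)) w |x ss ts w.
    w \<in> null \<and> x \<in> X (length ss + 1 + length ts) \<and> list_all (decorated X) (ss @ ts)}"

text \<open>The substituted trees \<open>s j\<close> may share labels, which keeps the set stable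
  under every further substitution. The combinations with unsuitable labels are sorted out in
  \<open>Lam_root_relations\<close>.\<close>

definition root_relations :: "('k, 'v) tvec set" where
  "root_relations = {tmap (\<lambda>t. bind t s) r |s r k. r \<in> R k \<and> (\<forall>j. decorated X (s j))}"

definition all_relations :: "('k, 'v) tvec set" where
  "all_relations = tree_relations M \<union> inner_relations \<union> root_relations"

lemma trel_all_relations: "w \<in> trel M \<Longrightarrow> w \<in> tv.span all_relations"
  using tv.span_mono[of "tree_relations M" all_relations] by (auto simp: all_relations_def)

text \<open>A substitution acts on the leaves and leaves the root in place, so each of the three
  kinds of relations is preserved. This covers both relabelling and composition with an ideal
  element as the outer operation.\<close>

lemma all_relations_bind:
  assumes "w \<in> tv.span all_relations" "\<And>j. decorated X (u j)"
  shows "tmap (\<lambda>t. bind t u) w \<in> tv.span all_relations"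
  using assms(1)
proof (rule span_tmap)
  fix v assume "v \<in> all_relations"
  then consider "v \<in> tree_relations M" | "v \<in> inner_relations" | "v \<in> root_relations"
    unfolding all_relations_def by blast
  then show "tmap (\<lambda>t. bind t u) v \<in> tv.span all_relations"
  proof cases
    case 1
    then have "tmap (\<lambda>t. bind t u) v \<in> tree_relations M"
      using assms(2) by (intro tree_relations_bind) auto
    then show ?thesis unfolding all_relations_def by (intro tv.span_base) blast
  next
    case 2
    then obtain x ss ts w where v: "v = tmap (\<lambda>t. Node x (ss @ t # ts)) w" and w: "w \<in> null"
      and x: "x \<in> X (length ss + 1 + length ts)" and dec: "list_all (decorated X) (ss @ ts)"
      unfolding inner_relations_def by blast
    let ?b = "map (\<lambda>t. bind t u)"
    have "tmap (\<lambda>t. bind t u) v = tmap (\<lambda>t. Node x (?b ss @ t # ?b ts)) (tmap (\<lambda>t. bind t u) w)"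
      unfolding v tmap_tmap by simp
    moreover have "tmap (\<lambda>t. bind t u) w \<in> null" using w assms(2) by (rule null_bind)
    moreover have "x \<in> X (length (?b ss) + 1 + length (?b ts))" using x by simp
    moreover have "list_all (decorated X) (?b ss @ ?b ts)"
      using dec assms(2) by (auto simp: list_all_iff intro!: decorated_bind)
    ultimately have "tmap (\<lambda>t. bind t u) v \<in> inner_relations"
      unfolding inner_relations_def by blast
    then show ?thesis unfolding all_relations_def by (intro tv.span_base) blast
  next
    case 3
    then obtain s r k where v: "v = tmap (\<lambda>t. bind t s) r" "r \<in> R k" "\<And>j. decorated X (s j)"
      unfolding root_relations_def by blast
    have "tmap (\<lambda>t. bind t u) v = tmap (\<lambda>t. bind t (\<lambda>j. bind (s j) u)) r"
      unfolding v tmap_tmap bind_bind ..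
    moreover have "decorated X (bind (s j) u)" for j
      using v(3) assms(2) by (intro decorated_bind) auto
    ultimately have "tmap (\<lambda>t. bind t u) v \<in> root_relations"
      using v(2) unfolding root_relations_def by blast
    then show ?thesis unfolding all_relations_def by (intro tv.span_base) blast
  qed
qed

text \<open>As labels are distinct, the leaf \<open>i\<close> lies in exactly one child of the root.
  The substitution of \<open>w\<close> takes place inside this child, where
  \<open>null_substitute\<close> applies.\<close>

lemma inner_relations_substitute:
  assumes q: "decorated X (Node x ts)" "distinct (leaves (Node x ts))" "i \<in> set (leaves (Node x ts))"
    and w: "w \<in> ker_pi n" and dec: "\<And>j. decorated X (s j)" "\<And>j. decorated X (u j)"
  shows "tmap (\<lambda>t. bind (Node x ts) (s(i := bind t u))) w \<in> inner_relations"
proof -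
  obtain q where "q \<in> set ts" "i \<in> set (leaves q)" using q(3) by auto
  then obtain as bs where ts: "ts = as @ q # bs" by (auto dest: split_list)
  have out: "i \<notin> set (leaves t)" if "t \<in> set as \<union> set bs" for t
    using q(2) \<open>i \<in> set (leaves q)\<close> that unfolding ts by auto
  let ?b = "map (\<lambda>t. bind t s)"
  have "bind (Node x ts) (s(i := bind t u)) =
      Node x (?b as @ bind q (s(i := bind t u)) # ?b bs)" for t
    unfolding ts using out by (auto intro!: bind_cong)
  then have "tmap (\<lambda>t. bind (Node x ts) (s(i := bind t u))) w =
      tmap (\<lambda>t. Node x (?b as @ t # ?b bs)) (tmap (\<lambda>t. bind q (s(i := bind t u))) w)"
    unfolding tmap_tmap by simp
  moreover have "tmap (\<lambda>t. bind q (s(i := bind t u))) w \<in> null"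
    using q w dec \<open>i \<in> set (leaves q)\<close> unfolding ts by (intro null_substitute) auto
  moreover have "x \<in> X (length (?b as) + 1 + length (?b bs))" using q(1) unfolding ts by simp
  moreover have "list_all (decorated X) (?b as @ ?b bs)"
    using q(1) dec unfolding ts by (auto simp: list_all_iff intro!: decorated_bind)
  ultimately show ?thesis unfolding inner_relations_def by blast
qed

lemma graft_eq_bind:
  "graft i n q t = bind q ((\<lambda>j. Leaf (slot i n j))(i := bind t (\<lambda>l. Leaf (i + l))))"
proof -
  have "graft i n q t = bind q (\<lambda>j. if j = i then bind t (\<lambda>l. Leaf (i + l)) else Leaf (slot i n j))"
    by (simp only: graft_def relabel_def)
  also have "(\<lambda>j. if j = i then bind t (\<lambda>l. Leaf (i + l)) else Leaf (slot i n j)) =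
    (\<lambda>j. Leaf (slot i n j))(i := bind t (\<lambda>l. Leaf (i + l)))"
    by (simp only: fun_upd_def)
  finally show ?thesis .
qed

text \<open>If \<open>t\<close> has a root vertex, \<open>w\<close> is placed above it and an inner
  relation results, whatever the form of \<open>w\<close>. Only for the trivial tree does
  \<open>w\<close> itself reappear.\<close>

lemma all_relations_graft_right:
  assumes "t \<in> trees X m" "i < m" "w \<in> ker_pi n" "w \<in> tv.span all_relations"
  shows "tmap (graft i n t) w \<in> tv.span all_relations"
proof (cases t)
  case (Leaf j)
  then have "i = 0" "j = 0" using assms(1,2) Leaf_trees[of j X m] by auto
  moreover have "graft 0 n (Leaf 0) = (id :: 'v optree \<Rightarrow> 'v optree)"
    by (rule ext) (simp add: graft_one(1))
  ultimately have "tmap (graft i n t) w = w" unfolding Leaf by simp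
  then show ?thesis using assms(4) by simp
next
  case (Node x ts)
  have t: "decorated X (Node x ts)" "distinct (leaves (Node x ts))" "i \<in> set (leaves (Node x ts))"
    using assms(1,2) unfolding Node trees_def by simp_all
  have "graft i n t = (\<lambda>s. bind (Node x ts) ((\<lambda>j. Leaf (slot i n j))(i := bind s (\<lambda>l. Leaf (i + l)))))"
    unfolding Node by (rule ext) (rule graft_eq_bind)
  then have "tmap (graft i n t) w \<in> inner_relations"
    using inner_relations_substitute[OF t assms(3), of "\<lambda>j. Leaf (slot i n j)" "\<lambda>l. Leaf (i + l)"] by simp
  then show ?thesis unfolding all_relations_def by (intro tv.span_base) blast
qed

text \<open>The condition \<open>w \<in> ker_pi n\<close> is not redundant in the closure proof:
  grafting \<open>w\<close> onto a proper tree is recognised as an inner relation only for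
  \<open>w\<close> in the kernel.\<close>

definition relation_ideal :: "nat \<Rightarrow> ('k, 'v) tvec set" where
  "relation_ideal n = {w \<in> cmpt F n. w \<in> ker_pi n \<and> w \<in> tv.span all_relations}"

lemma tree_rep_all_relations:
  assumes "w \<in> tree_space X n"
  shows "tree_rep M n w \<in> tv.span all_relations \<longleftrightarrow> w \<in> tv.span all_relations"
proof -
  have d: "w - tree_rep M n w \<in> tv.span all_relations"
    using tree_rep_diff[of w M n] assms by (intro trel_all_relations) simp
  show ?thesis
  proof
    assume "tree_rep M n w \<in> tv.span all_relations"
    from tv.span_add[OF d this] show "w \<in> tv.span all_relations" by simp
  next
    assume "w \<in> tv.span all_relations"
    from tv.span_diff[OF this d] show "tree_rep M n w \<in> tv.span all_relations" by simp
  qed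
qed

lemma tree_rep_relation_ideal:
  assumes "w \<in> ker_pi n" "w \<in> tv.span all_relations"
  shows "tree_rep M n w \<in> relation_ideal n"
proof -
  have w: "w \<in> tree_space X n" "pi n w = 0" using assms(1) by (simp_all add: ker_pi_def)
  have c: "tree_rep M n w \<in> cmpt F n" by (rule tree_rep_cmpt[OF w(1)])
  have "pi n (tree_rep M n w) = 0"
    using pi_cmpt_F[OF c] w(2) unfolding pi_def by simp
  then show ?thesis
    using assms(2) iffD2[OF tree_rep_all_relations[OF w(1)]] c c[unfolded cmpt_F_iff]
    unfolding relation_ideal_def ker_pi_def by simp
qed

lemma relation_ideal_closed:
  assumes "f \<in> cmpt F m" "g \<in> cmpt F n" "i < m"
    and "f \<in> relation_ideal m \<or> g \<in> relation_ideal n"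
  shows "pcomp F m i n f g \<in> relation_ideal (m + n - 1)"
proof -
  have f: "f \<in> tree_space X m" and g: "g \<in> tree_space X n"
    using assms by (simp_all add: cmpt_F_iff)
  have "pi m f = 0 \<or> pi n g = 0" using assms(4) by (auto simp: relation_ideal_def ker_pi_def)
  then have "pcomp P m i n (pi m f) (pi n g) = 0"
    using pcomp_zero_left[OF assms(3) pi_closed[OF g]] pcomp_zero_right[OF assms(3) pi_closed[OF f]]
    by metis
  then have "tmap2 (graft i n) f g \<in> ker_pi (m + n - 1)"
    using pi_pcomp[OF assms(3) f g] pcomp_tree_space[OF assms(3) f g]
    unfolding ker_pi_def by simp
  moreover have "tmap2 (graft i n) f g \<in> tv.span all_relations"
    using assms(4)
  proof
    assume f': "f \<in> relation_ideal m"
    show ?thesis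
      unfolding tmap2_right
    proof (intro tv.span_sum tv.span_scale)
      fix s assume "s \<in> Poly_Mapping.keys g"
      then have "decorated X s" using g by (auto simp: tree_space_def trees_def)
      then show "tmap (\<lambda>t. graft i n t s) f \<in> tv.span all_relations"
        unfolding graft_def using f'
        by (intro all_relations_bind) (auto simp: relation_ideal_def decorated_relabel)
    qed
  next
    assume g': "g \<in> relation_ideal n"
    show ?thesis
      unfolding tmap2_left
    proof (intro tv.span_sum tv.span_scale)
      fix t assume "t \<in> Poly_Mapping.keys f"
      then show "tmap (graft i n t) g \<in> tv.span all_relations"
        using f g' assms(3)
        by (intro all_relations_graft_right) (auto simp: tree_space_def relation_ideal_def)
    qed
  qed
  ultimately have "tree_rep M (m + n - 1) (tmap2 (graft i n) f g) \<in> relation_ideal (m + n - 1)"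
    by (rule tree_rep_relation_ideal)
  then show ?thesis by (simp only: free_simps)
qed

lemma operad_ideal_relation_ideal: "operad_ideal F relation_ideal"
  unfolding operad_ideal_def S_submodule_def
proof (intro conjI allI impI ballI)
  fix n
  have "relation_ideal n = cmpt F n \<inter> (ker_pi n \<inter> tv.span all_relations)"
    unfolding relation_ideal_def by blast
  then show "module.subspace (scl F) (relation_ideal n)"
    unfolding free_simps using subspace_free subspace_ker_pi tv.subspace_span
    by (metis tv.subspace_inter)
  show "relation_ideal n \<subseteq> cmpt F n" by (auto simp: relation_ideal_def)
  fix \<sigma> :: "nat \<Rightarrow> nat" assume \<sigma>: "\<sigma> permutes {..<n}"
  show "act F n \<sigma> ` relation_ideal n \<subseteq> relation_ideal n"
  proof
    fix y assume "y \<in> act F n \<sigma> ` relation_ideal n"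
    then obtain w where y: "y = tree_rep M n (tmap (relabel \<sigma>) w)" and w: "w \<in> relation_ideal n" by auto
    have "tmap (relabel \<sigma>) w \<in> ker_pi n"
      using w \<sigma> by (auto simp: relation_ideal_def ker_pi_def pi_act act_tree_space act_zero)
    moreover have "tmap (relabel \<sigma>) w \<in> tv.span all_relations"
      unfolding relabel_def using w by (intro all_relations_bind) (auto simp: relation_ideal_def)
    ultimately show "y \<in> relation_ideal n" unfolding y by (rule tree_rep_relation_ideal)
  qed
next
  fix m n i :: nat and f g
  assume "i < m" "f \<in> relation_ideal m" "g \<in> cmpt F n"
  then show "pcomp F m i n f g \<in> relation_ideal (m + n - 1)"
    using relation_ideal_closed[of f m g n i] by (simp add: relation_ideal_def)
next
  fix m n i :: nat and f g
  assume "i < m" "f \<in> cmpt F m" "g \<in> relation_ideal n"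
  then show "pcomp F m i n f g \<in> relation_ideal (m + n - 1)"
    using relation_ideal_closed[of f m g n i] by (simp add: relation_ideal_def)
qed

lemma R_relation_ideal: "R n \<subseteq> relation_ideal n"
proof
  fix r assume r: "r \<in> R n"
  have "r = tmap (\<lambda>t. bind t Leaf) r" using tmap_cong[of r "\<lambda>t. bind t Leaf" id] by simp
  then have "r \<in> root_relations"
    unfolding root_relations_def using r by (intro CollectI exI[of _ Leaf] exI[of _ r] exI[of _ n]) simp
  then have "r \<in> tv.span all_relations" unfolding all_relations_def by (intro tv.span_base) blast
  then show "r \<in> relation_ideal n" using r R_ker R_cmpt unfolding relation_ideal_def by blast
qed

text \<open>The kernel is the intersection of all ideals containing \<open>R\<close>, and
  \<open>relation_ideal\<close> is one of them. Passing between a combination and its representative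
  changes it only by tree relations.\<close>

lemma ker_pi_all_relations:
  assumes "w \<in> ker_pi n"
  shows "w \<in> tv.span all_relations"
proof -
  have w: "w \<in> tree_space X n" using assms by (simp add: ker_pi_def)
  have "tree_rep M n w \<in> kernel F \<pi> n"
    using assms tree_rep_cmpt[OF w] by (simp add: kernel_def ker_pi_def pi_def)
  also have "kernel F \<pi> n \<subseteq> relation_ideal n"
    unfolding R_generates[symmetric] ideal_generated_def
    using operad_ideal_relation_ideal R_relation_ideal by blast
  finally show ?thesis
    using tree_rep_all_relations[OF w] by (simp add: relation_ideal_def)
qed

section \<open>Absence of relations up to the lowest arity of the generators\<close>

text \<open>
  A decorated tree with a vertex \<open>x\<close> of arity \<open>k\<close> such that \<open>X k = {0}\<close> is itself a relation.
\<close>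

lemma decorated_reduced:
  assumes "decorated X t" "tvec t \<notin> trel M" "2 \<le> m" "\<And>k. k < m \<Longrightarrow> X k = {0}"
  shows "t \<in> range Leaf \<or> m \<le> length (leaves t) \<and>
    (length (leaves t) = m \<longrightarrow> (\<exists>x js. t = Node x (map Leaf js)))"
  using assms(1,2)
proof (induction t)
  case (Node x ts)
  have X: "x \<in> X (length ts)" "list_all (decorated X) ts" using Node.prems by auto
  have arity: "m \<le> length ts"
  proof (rule ccontr)
    assume "\<not> m \<le> length ts"
    then have "x = 0" using X assms(4)[of "length ts"] by simp
    \<comment> \<open>Homogeneity with scalar 0: the subtracted multiple vanishes and the tree with
      decoration 0 remains.\<close>
    then have "tvec (Node x ts) \<in> tree_relations M"
      using tree_relations.homogeneous[of x M ts 0] X by simp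
    then show False using Node.prems tv.span_base by blast
  qed
  have sub: "t \<in> range Leaf \<or> 2 \<le> length (leaves t)" if "t \<in> set ts" for t
  proof -
    obtain as bs where ts: "ts = as @ t # bs" using \<open>t \<in> set ts\<close> by (auto dest: split_list)
    have "tvec t \<notin> trel M"
    proof
      assume "tvec t \<in> trel M"
      then have "tmap (\<lambda>t. Node x (as @ t # bs)) (tvec t) \<in> trel M"
        using X unfolding ts by (intro trel_inside) auto
      then show False using Node.prems unfolding ts by simp
    qed
    then show ?thesis using Node.IH[OF that] X that assms(3) by (auto simp: list_all_iff)
  qed
  have leaves: "length (leaves (Node x ts)) = sum_list (map (\<lambda>t. length (leaves t)) ts)"
    by (simp add: length_concat comp_def)
  have sub1: "1 \<le> length (leaves t)" if "t \<in> set ts" for t using sub[OF that] by auto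
  have len: "length us \<le> sum_list (map (\<lambda>t. length (leaves t)) us)" if "set us \<subseteq> set ts" for us
    using sum_list_mono[of us "\<lambda>_. 1" "\<lambda>t. length (leaves t)"] sub1 that by (auto simp: sum_list_triv)
  have "\<exists>x js. Node x ts = Node x (map Leaf js)" if "length (leaves (Node x ts)) = m"
  proof -
    have "t \<in> range Leaf" if t: "t \<in> set ts" for t
    proof (rule ccontr)
      assume "t \<notin> range Leaf"
      then have t2: "2 \<le> length (leaves t)" using sub[OF t] by blast
      obtain as bs where ts: "ts = as @ t # bs" using t by (auto dest: split_list)
      have "length ts < length (leaves (Node x ts))"
      proof -
        have "length as \<le> sum_list (map (\<lambda>t. length (leaves t)) as)"
          by (rule len) (auto simp: ts)
        moreover have "length bs \<le> sum_list (map (\<lambda>t. length (leaves t)) bs)"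
          by (rule len) (auto simp: ts)
        ultimately show ?thesis using t2 unfolding leaves unfolding ts by simp
      qed
      then show False using arity \<open>length (leaves (Node x ts)) = m\<close> by simp
    qed
    then have "ts \<in> lists (range Leaf)" by auto
    then obtain js where "ts = map Leaf js" unfolding lists_image by auto
    then show ?thesis by blast
  qed
  then show ?case using arity len[of ts] unfolding leaves by auto
qed simp

text \<open>A tree that is neither a leaf nor a relation has at least \<open>m\<close> leaves, so
  below arity \<open>m\<close> every term other than the trivial tree is a relation.\<close>

lemma tree_space_trelI:
  assumes "w \<in> tree_space X n" "Leaf 0 \<notin> Poly_Mapping.keys w"
    and "n < m" "2 \<le> m" "\<And>k. k < m \<Longrightarrow> X k = {0}"
  shows "w \<in> trel M"
proof -
  have "(\<Sum>t\<in>Poly_Mapping.keys w. tscale (Poly_Mapping.lookup w t) (tvec t)) \<in> trel M"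
  proof (intro tv.span_sum tv.span_scale)
    fix t assume t: "t \<in> Poly_Mapping.keys w"
    then have tn: "t \<in> trees X n" using assms unfolding tree_space_def by blast
    then have "decorated X t" "distinct (leaves t)" "set (leaves t) = {..<n}"
      by (auto simp: trees_def)
    moreover from this have "length (leaves t) = n" using distinct_card[of "leaves t"] by simp
    ultimately show "tvec t \<in> trel M"
      using decorated_reduced[of t m] assms t Leaf_trees[of _ X n] tn by fastforce
  qed
  then show ?thesis using tvec_expand[of w] by simp
qed

text \<open>A leaf can only occur in arity 1, where all other trees are relations because generators
  start in arity 2. Its coefficient is then read off from the image, a multiple of the non-zero
  identity. Hence every term of an element of the kernel has a root vertex.\<close>

lemma ker_pi_Leaf:
  assumes "r \<in> ker_pi n" "q \<in> Poly_Mapping.keys r"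
  shows "q \<notin> range Leaf"
proof
  assume "q \<in> range Leaf"
  moreover have r: "r \<in> tree_space X n" "pi n r = 0" using assms by (auto simp: ker_pi_def)
  moreover have "q \<in> trees X n" using assms(2) r(1) unfolding tree_space_def by blast
  ultimately have n: "n = 1" and q: "q = Leaf 0" using Leaf_trees by blast+
  let ?c = "Poly_Mapping.lookup r (Leaf 0)"
  let ?l = "tscale ?c (tvec (Leaf 0)) :: ('k, 'v) tvec"
  have l: "tvec (Leaf 0) \<in> tree_space X n" using n tvec_tree_space[OF Leaf_tree] by simp
  have d: "r - ?l \<in> tree_space X n"
    using r l by (intro tv.subspace_diff[OF subspace_tree_space] tree_space_intros)
  have "Leaf 0 \<notin> Poly_Mapping.keys (r - ?l)" by (simp add: in_keys_iff lookup_minus)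
  then have "r - ?l \<in> trel M" using d n X_small by (intro tree_space_trelI[where m = 2]) auto
  then have "pi n (r - ?l) = 0" using d by (intro pi_trel)
  moreover have "pi n (r - ?l) = - scl P ?c (one P)"
    using pi_diff[OF r(1) tree_space_intros(3)[OF l]] pi_scale[OF l] r(2) pi_one n
    by (simp del: tscale_single)
  ultimately have "scl P ?c (one P) = 0" by simp
  then have "?c = 0" using one_nz by simp
  then show False using assms q by (simp add: in_keys_iff)
qed

text \<open>Elements of \<open>R\<close> are representatives, hence fixed by
  \<open>tree_rep\<close>, which sends relations to 0.\<close>

lemma R_trelI: "r \<in> R n \<Longrightarrow> r \<in> trel M \<Longrightarrow> r = 0"
  using R_cmpt[of n] tree_rep_eq_0[of r M n] by (auto simp: cmpt_F_iff)

lemma R_below: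
  assumes "n < m" "2 \<le> m" "\<And>k. k < m \<Longrightarrow> X k = {0}"
  shows "R n = {0}"
proof -
  have "r = 0" if "r \<in> R n" for r
  proof (rule R_trelI[OF that])
    have "r \<in> ker_pi n" using that R_ker by blast
    then show "r \<in> trel M"
      using assms ker_pi_Leaf[of r n "Leaf 0"] by (intro tree_space_trelI) (auto simp: ker_pi_def)
  qed
  then show ?thesis using tv.subspace_0[OF R_subspace] by blast
qed

lemma corolla_relation:
  assumes "w \<in> tree_space X m" "2 \<le> m" "\<And>k. k < m \<Longrightarrow> X k = {0}"
  shows "\<exists>x\<in>X m. w - tvec (Node x (map Leaf [0..<m])) \<in> trel M"
  using assms(1)
proof (induction rule: tree_space_induct)
  case zero
  have "tvec (Node 0 (map Leaf [0..<m])) \<in> tree_relations M"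
    using tree_relations.homogeneous[of 0 M "map Leaf [0..<m]" 0] vs.subspace_0[OF X_subspace]
    by (simp add: list_all_iff)
  then have "0 - tvec (Node 0 (map Leaf [0..<m])) \<in> trel M"
    by (intro tv.span_diff tv.span_zero tv.span_base)
  then show ?case using vs.subspace_0[OF X_subspace] by blast
next
  case (add v w)
  then obtain x y where xy: "x \<in> X m" "v - tvec (Node x (map Leaf [0..<m])) \<in> trel M"
    "y \<in> X m" "w - tvec (Node y (map Leaf [0..<m])) \<in> trel M" by blast
  have "tvec (Node (x + y) (map Leaf [0..<m])) - tvec (Node x (map Leaf [0..<m])) -
      tvec (Node y (map Leaf [0..<m])) \<in> trel M" (is "?a \<in> _")
    using tree_relations.additive[of x M "map Leaf [0..<m]" y] xy
    by (intro tv.span_base) (simp add: list_all_iff)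
  then have "(v - tvec (Node x (map Leaf [0..<m]))) + (w - tvec (Node y (map Leaf [0..<m]))) - ?a \<in> trel M"
    by (rule tv.span_diff[OF tv.span_add[OF xy(2,4)]])
  then have "v + w - tvec (Node (x + y) (map Leaf [0..<m])) \<in> trel M" by (simp add: algebra_simps)
  then show ?case using vs.subspace_add[OF X_subspace] xy by blast
next
  case (single t c)
  show ?case
  proof (cases "tvec t \<in> trel M")
    case True
    have "tvec (Node 0 (map Leaf [0..<m])) \<in> tree_relations M"
      using tree_relations.homogeneous[of 0 M "map Leaf [0..<m]" 0] vs.subspace_0[OF X_subspace]
      by (simp add: list_all_iff)
    then have "tscale c (tvec t) - tvec (Node 0 (map Leaf [0..<m])) \<in> trel M"
      using True by (intro tv.span_diff tv.span_scale) (auto intro: tv.span_base)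
    then show ?thesis using vs.subspace_0[OF X_subspace] by blast
  next
    case False
    have t: "decorated X t" "distinct (leaves t)" "set (leaves t) = {..<m}"
      using single by (auto simp: trees_def)
    then have "length (leaves t) = m" using distinct_card[of "leaves t"] by simp
    then obtain x js where x: "t = Node x (map Leaf js)"
      using decorated_reduced[OF t(1) False assms(2,3)] \<open>2 \<le> m\<close> by (cases t) auto
    have "leaves t = js" unfolding x by (simp add: comp_def concat_map_singleton)
    then have js: "distinct js" "set js = {..<m}" "length js = m"
      using t(2,3) \<open>length (leaves t) = m\<close> by metis+
    have xX: "x \<in> X m" using t(1) js(3) unfolding x by simp
    \<comment> \<open>The order \<open>js\<close> of the leaves is a permutation of the inputs;
      equivariance moves it from the leaves to the decoration.\<close>
    define \<sigma> where "\<sigma> i = (if i < m then js ! i else i)" for i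
    have "bij_betw \<sigma> {..<m} {..<m}"
    proof -
      have "bij_betw ((!) js) {..<m} {..<m}"
        using bij_betw_nth[OF js(1), of "{..<m}" "{..<m}"] js(2,3) by metis
      moreover have "bij_betw \<sigma> {..<m} {..<m} = bij_betw ((!) js) {..<m} {..<m}"
        by (rule bij_betw_cong) (simp add: \<sigma>_def)
      ultimately show ?thesis by simp
    qed
    then have \<sigma>: "\<sigma> permutes {..<m}" by (intro bij_imp_permutes) (auto simp: \<sigma>_def)
    have "map (\<lambda>i. map Leaf [0..<m] ! \<sigma> i) [0..<m] = (map Leaf js :: 'v optree list)"
    proof (rule nth_equalityI)
      show "length (map (\<lambda>i. map Leaf [0..<m] ! \<sigma> i) [0..<m]) = length (map Leaf js)"
        using js(3) by simp
      fix i assume "i < length (map (\<lambda>i. map Leaf [0..<m] ! \<sigma> i) [0..<m])"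
      then have i: "i < m" by simp
      then have "js ! i \<in> set js" using js(3) by simp
      then have "js ! i < m" unfolding js(2) by simp
      then show "map (\<lambda>i. map Leaf [0..<m] ! \<sigma> i) [0..<m] ! i = map Leaf js ! i"
        using i js(3) by (simp add: \<sigma>_def)
    qed
    then have "tvec (Node (act P m \<sigma> x) (map Leaf [0..<m])) - tvec t \<in> trel M"
      using tree_relations.equivariant[of x M "map Leaf [0..<m]" \<sigma>] xX \<sigma> unfolding x
      by (intro tv.span_base) (simp add: list_all_iff)
    moreover have "tvec (Node (scl P c (act P m \<sigma> x)) (map Leaf [0..<m])) -
        tscale c (tvec (Node (act P m \<sigma> x) (map Leaf [0..<m]))) \<in> trel M"
      using tree_relations.homogeneous[of "act P m \<sigma> x" M "map Leaf [0..<m]" c] X_act[OF \<sigma> xX]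
      by (intro tv.span_base) (simp add: list_all_iff del: tscale_single)
    ultimately have "- (tscale c (tvec (Node (act P m \<sigma> x) (map Leaf [0..<m])) - tvec t) +
      (tvec (Node (scl P c (act P m \<sigma> x)) (map Leaf [0..<m])) -
        tscale c (tvec (Node (act P m \<sigma> x) (map Leaf [0..<m]))))) \<in> trel M"
      by (rule tv.span_neg[OF tv.span_add[OF tv.span_scale]])
    then have "tscale c (tvec t) - tvec (Node (scl P c (act P m \<sigma> x)) (map Leaf [0..<m])) \<in> trel M"
      by (simp only: tv.scale_right_diff_distrib) (simp add: algebra_simps del: tscale_single)
    then show ?thesis using vs.subspace_scale[OF X_subspace X_act[OF \<sigma> xX]] by blast
  qed
qed

text \<open>Modulo tree relations an element of the lowest arity is a single corolla decorated by
  some \<open>x\<close>, and \<open>pi\<close> sends this corolla back to \<open>x\<close>. In the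
  kernel \<open>x = 0\<close>, and the corolla is itself a relation.\<close>

lemma R_lowest:
  assumes "2 \<le> m" "\<And>k. k < m \<Longrightarrow> X k = {0}"
  shows "R m = {0}"
proof -
  have "r = 0" if r: "r \<in> R m" for r
  proof (rule R_trelI[OF that])
    let ?c = "\<lambda>x. tvec (Node x (map Leaf [0..<m])) :: ('k, 'v) tvec"
    have rk: "r \<in> tree_space X m" "pi m r = 0" using r R_ker[of m] by (auto simp: ker_pi_def)
    obtain x where x: "x \<in> X m" "r - ?c x \<in> trel M"
      using corolla_relation[OF rk(1) assms] by blast
    have c: "?c x \<in> tree_space X m" using corolla_tree[of x M m] x by (intro tvec_tree_space) simp
    have "0 = pi m (r - ?c x)"
      using x rk c by (intro pi_trel[symmetric] tv.subspace_diff[OF subspace_tree_space]) auto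
    also have "\<dots> = - x"
      using rk c hom(7)[OF x(1)] by (simp add: pi_diff pi_def[of m "?c x"] free_gen_def)
    finally have "x = 0" by simp
    then have "?c x \<in> tree_relations M"
      using tree_relations.homogeneous[of 0 M "map Leaf [0..<m]" 0] vs.subspace_0[OF X_subspace]
      by (simp add: list_all_iff)
    then show "r \<in> trel M" using tv.span_add[OF x(2) tv.span_base] by fastforce
  qed
  then show ?thesis using tv.subspace_0[OF R_subspace] by blast
qed

section \<open>Coordinates on the composite of the generators with the operad\<close>

abbreviation pit :: "nat \<Rightarrow> 'v optree \<Rightarrow> 'v" where
  "pit n t \<equiv> pi n (tvec t)"

definition Xb :: "nat \<Rightarrow> 'v set" where
  "Xb k = (SOME B. B \<subseteq> X k \<and> vs.independent B \<and> X k \<subseteq> vs.span B)"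

lemma Xb: "Xb k \<subseteq> X k" "vs.independent (Xb k)" "vs.span (Xb k) = X k"
proof -
  let ?Q = "\<lambda>B. B \<subseteq> X k \<and> vs.independent B \<and> X k \<subseteq> vs.span B"
  obtain B where "B \<subseteq> X k" "vs.independent B" "X k \<subseteq> vs.span B"
    by (rule vs.maximal_independent_subset)
  then have "?Q B" by (intro conjI)
  then have *: "?Q (Xb k)" unfolding Xb_def by (rule someI[of ?Q])
  then show "Xb k \<subseteq> X k" "vs.independent (Xb k)" by blast+
  show "vs.span (Xb k) = X k" using * vs.span_minimal[OF _ X_subspace] by blast
qed

text \<open>Images of trees span \<open>P(n)\<close>, so a basis can be chosen among them. The trees
  are kept instead of their images because they serve as children of a root vertex.\<close>

definition Cb :: "nat \<Rightarrow> 'v optree set" where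
  "Cb n = (SOME C. C \<subseteq> trees X n \<and> inj_on (pit n) C \<and> vs.independent (pit n ` C) \<and>
    cmpt P n \<subseteq> vs.span (pit n ` C))"

lemma Cb: "Cb n \<subseteq> trees X n" "inj_on (pit n) (Cb n)" "vs.independent (pit n ` Cb n)"
  "vs.span (pit n ` Cb n) = cmpt P n"
proof -
  have sub: "pit n ` trees X n \<subseteq> cmpt P n" using pi_closed tvec_tree_space by blast
  obtain B where B: "B \<subseteq> pit n ` trees X n" "vs.independent B" "pit n ` trees X n \<subseteq> vs.span B"
    by (rule vs.maximal_independent_subset)
  obtain C where C: "C \<subseteq> trees X n" "inj_on (pit n) C" "B = pit n ` C"
    using B(1) unfolding subset_image_inj by blast
  have "cmpt P n \<subseteq> vs.span B"
  proof
    fix y assume "y \<in> cmpt P n"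
    then obtain w where w: "w \<in> tree_space X n" "y = pi n w" using pi_surj by blast
    have "pi n w \<in> vs.span B"
      using w(1)
    proof (induction rule: tree_space_induct)
      case (single t c)
      then have "pit n t \<in> vs.span B" using B(3) by blast
      then show ?case using pi_scale[OF tvec_tree_space[OF single]] vs.span_scale by metis
    qed (auto simp: pi_add vs.span_zero vs.span_add)
    then show "y \<in> vs.span B" using w by simp
  qed
  let ?Q = "\<lambda>C. C \<subseteq> trees X n \<and> inj_on (pit n) C \<and> vs.independent (pit n ` C) \<and>
    cmpt P n \<subseteq> vs.span (pit n ` C)"
  have "?Q C" using \<open>cmpt P n \<subseteq> vs.span B\<close> B(2) C(1,2) unfolding C(3) by (intro conjI)
  then have *: "?Q (Cb n)" unfolding Cb_def by (rule someI[of ?Q])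
  then show "Cb n \<subseteq> trees X n" "inj_on (pit n) (Cb n)" "vs.independent (pit n ` Cb n)" by blast+
  have "pit n ` Cb n \<subseteq> cmpt P n" using * sub by blast
  then show "vs.span (pit n ` Cb n) = cmpt P n"
    using * vs.span_minimal[OF _ subspace_cmpt] by blast
qed

definition std :: "'v optree \<Rightarrow> 'v optree" where
  "std t = relabel (rk (set (leaves t))) t"

text \<open>The basis \<open>Cb\<close> transported along \<open>en\<close> to any finite set of
  labels: these trees represent a basis of the value of \<open>P\<close> on their leaf set.\<close>

definition canonical :: "'v optree \<Rightarrow> bool" where
  "canonical u \<longleftrightarrow> u \<in> relabel (en (set (leaves u))) ` Cb (card (set (leaves u)))"

text \<open>The coordinate of the class of \<open>t\<close> at the basis element \<open>u\<close>,
  extended by 0 to trees whose leaves do not match. It thereby becomes a functional on all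
  combinations of trees, with no reference to a label set.\<close>

definition cf :: "'v optree \<Rightarrow> 'v optree \<Rightarrow> 'k" where
  "cf u t = (let n = card (set (leaves u)) in
    if decorated X t \<and> distinct (leaves t) \<and> set (leaves t) = set (leaves u)
    then vs.representation (pit n ` Cb n) (pit n (std t)) (pit n (std u)) else 0)"

lemma relabel_en_Cb:
  assumes "finite T" "c \<in> Cb (card T)"
  shows "set (leaves (relabel (en T) c)) = T" "distinct (leaves (relabel (en T) c))"
    "decorated X (relabel (en T) c)" "relabel (rk T) (relabel (en T) c) = c"
proof -
  have c: "c \<in> trees X (card T)" using assms Cb(1) by blast
  show "set (leaves (relabel (en T) c)) = T" "distinct (leaves (relabel (en T) c))"
    using relabel_en_leaves[OF assms(1) c] by simp_all
  show "decorated X (relabel (en T) c)"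
    using c unfolding trees_def by (intro decorated_relabel) blast
  have "set (leaves c) \<subseteq> {..<card T}" using c unfolding trees_def by blast
  then show "relabel (rk T) (relabel (en T) c) = c" by (intro relabel_rk_en assms(1))
qed

lemma canonical_relabel_en: "finite T \<Longrightarrow> c \<in> Cb (card T) \<Longrightarrow> canonical (relabel (en T) c)"
  unfolding canonical_def relabel_en_Cb(1) by (rule imageI)

lemma canonicalD:
  assumes "canonical u"
  shows "std u \<in> Cb (card (set (leaves u)))" "distinct (leaves u)" "decorated X u"
    "relabel (en (set (leaves u))) (std u) = u"
proof -
  obtain c where c: "c \<in> Cb (card (set (leaves u)))" "u = relabel (en (set (leaves u))) c"
    using assms unfolding canonical_def by blast
  note r = relabel_en_Cb[OF _ c(1), folded c(2)]
  show "distinct (leaves u)" "decorated X u" using r by simp_all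
  have "std u = c" unfolding std_def using r by simp
  then show "std u \<in> Cb (card (set (leaves u)))" "relabel (en (set (leaves u))) (std u) = u"
    using c by simp_all
qed

lemma cf_canonical:
  assumes "canonical u" "canonical t"
  shows "cf u t = (if u = t then 1 else 0)"
proof (cases "set (leaves t) = set (leaves u)")
  case True
  let ?n = "card (set (leaves u))"
  have st: "std t \<in> Cb ?n" "std u \<in> Cb ?n" using canonicalD(1)[of t] canonicalD(1)[of u] assms True by simp_all
  have "cf u t = vs.representation (pit ?n ` Cb ?n) (pit ?n (std t)) (pit ?n (std u))"
    unfolding cf_def Let_def using True canonicalD[OF assms(2)] by simp
  also have "\<dots> = (if pit ?n (std t) = pit ?n (std u) then 1 else 0)"
    using st Cb(3) by (subst vs.representation_basis) auto
  also have "pit ?n (std t) = pit ?n (std u) \<longleftrightarrow> std t = std u"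
    using st Cb(2) by (auto dest: inj_onD)
  also have "std t = std u \<longleftrightarrow> u = t"
    using canonicalD(4)[of t] canonicalD(4)[of u] assms True by metis
  finally show ?thesis .
next
  case False
  then show ?thesis unfolding cf_def Let_def by auto
qed

lemma pi_std_trees:
  assumes "decorated X t" "distinct (leaves t)"
  shows "std t \<in> trees X (card (set (leaves t)))"
  unfolding std_def using assms by (intro relabel_rk_trees) auto

text \<open>For a common leaf set \<open>T\<close> the functional \<open>cf u\<close> is a
  coordinate of the image in \<open>P\<close>, so that it vanishes wherever \<open>pi\<close> does.
  The membership in \<open>tree_space\<close> is part of the induction because \<open>pi\<close> is
  known to be additive only there.\<close>

lemma lin_ext_cf:
  assumes "Poly_Mapping.keys w \<subseteq> {t. decorated X t \<and> distinct (leaves t) \<and> set (leaves t) = T}"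
    and "set (leaves u) = T"
  shows "lin_ext (cf u) w = vs.representation (pit (card T) ` Cb (card T))
      (pi (card T) (tmap (relabel (rk T)) w)) (pit (card T) (std u)) \<and>
    tmap (relabel (rk T)) w \<in> tree_space X (card T)"
  using assms(1)
proof (induction rule: tvec_induct[consumes 1, case_names zero add scale])
  case zero
  then show ?case by (simp add: tree_space_intros vs.representation_zero)
next
  case (add v w)
  let ?n = "card T"
  have "pi ?n (tmap (relabel (rk T)) v) \<in> vs.span (pit ?n ` Cb ?n)"
    "pi ?n (tmap (relabel (rk T)) w) \<in> vs.span (pit ?n ` Cb ?n)"
    using add pi_closed unfolding Cb(4) by blast+
  then show ?case using add by (simp add: pi_add tree_space_intros vs.representation_add[OF Cb(3)])
next
  case (scale t c)
  let ?n = "card T"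
  have t: "decorated X t" "distinct (leaves t)" "set (leaves t) = T" using scale by blast+
  then have std: "std t \<in> trees X ?n" "relabel (rk T) t = std t"
    using pi_std_trees[of t] by (simp_all add: std_def)
  have "pit ?n (std t) \<in> vs.span (pit ?n ` Cb ?n)"
    unfolding Cb(4) by (intro pi_closed tvec_tree_space std)
  then show ?case
    using t std assms(2) pi_scale[OF tvec_tree_space[OF std(1)], of c] tvec_tree_space[OF std(1)]
      tree_space_intros(3)[OF tvec_tree_space[OF std(1)], of c]
    by (simp add: cf_def Let_def vs.representation_scale[OF Cb(3)])
qed

text \<open>All terms have the same multiset of leaves, so either all or none of them match the
  leaves of \<open>u\<close>. In the first case \<open>cf u\<close> is a coordinate of 0, in the
  second it vanishes term by term.\<close>

lemma lin_ext_cf_eq_0: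
  assumes N: "\<And>t. t \<in> Poly_Mapping.keys w \<Longrightarrow> decorated X t \<and> mset (leaves t) = N"
    and pi0: "\<And>T n. n = card T \<Longrightarrow>
      (\<And>t. t \<in> Poly_Mapping.keys w \<Longrightarrow> relabel (rk T) t \<in> trees X n) \<Longrightarrow>
      pi n (tmap (relabel (rk T)) w) = 0"
  shows "lin_ext (cf u) w = 0"
proof (cases "\<exists>t\<in>Poly_Mapping.keys w. distinct (leaves t) \<and> set (leaves t) = set (leaves u)")
  case True
  define T where "T = set (leaves u)"
  obtain t0 where t0: "t0 \<in> Poly_Mapping.keys w" "distinct (leaves t0)" "set (leaves t0) = T"
    using True unfolding T_def by blast
  have k: "decorated X t \<and> distinct (leaves t) \<and> set (leaves t) = T" if "t \<in> Poly_Mapping.keys w" for t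
  proof -
    have m: "mset (leaves t) = mset (leaves t0)" using N[OF that] N[OF t0(1)] by simp
    show ?thesis using N[OF that] mset_eq_setD[OF m] mset_eq_imp_distinct_iff[OF m] t0 by simp
  qed
  then have "Poly_Mapping.keys w \<subseteq> {t. decorated X t \<and> distinct (leaves t) \<and> set (leaves t) = T}"
    by blast
  note l = lin_ext_cf[OF this T_def[symmetric]]
  have "pi (card T) (tmap (relabel (rk T)) w) = 0"
    using k by (intro pi0 refl relabel_rk_trees) blast+
  then show ?thesis using l by (simp add: vs.representation_zero)
next
  case False
  then show ?thesis by (intro lin_ext_eq_0) (auto simp: cf_def Let_def)
qed

section \<open>Vanishing of the coordinates of \<open>P\<close> on relations\<close>

lemma tree_relations_keys:
  "w \<in> tree_relations M \<Longrightarrow> \<exists>N. \<forall>t\<in>Poly_Mapping.keys w. decorated X t \<and> mset (leaves t) = N"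
proof (induction rule: tree_relations.induct)
  case (additive x ts y)
  have "x + y \<in> X (length ts)" using additive vs.subspace_add[OF X_subspace] by simp
  moreover have "Poly_Mapping.keys (tvec (Node (x + y) ts) - tvec (Node x ts) - tvec (Node y ts) :: ('k, 'v) tvec)
      \<subseteq> {Node (x + y) ts, Node x ts, Node y ts}"
    by (auto simp: in_keys_iff lookup_minus lookup_single when_def split: if_splits)
  ultimately show ?case using additive by (intro exI[of _ "mset (concat (map leaves ts))"]) auto
next
  case (homogeneous x ts c)
  have "scl P c x \<in> X (length ts)" using homogeneous vs.subspace_scale[OF X_subspace] by simp
  moreover have "Poly_Mapping.keys (tvec (Node (scl P c x) ts) - tscale c (tvec (Node x ts)) :: ('k, 'v) tvec)
      \<subseteq> {Node (scl P c x) ts, Node x ts}"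
    by (auto simp: in_keys_iff lookup_minus lookup_single when_def split: if_splits)
  ultimately show ?case using homogeneous by (intro exI[of _ "mset (concat (map leaves ts))"]) auto
next
  case (equivariant x ts \<sigma>)
  let ?us = "map (\<lambda>i. ts ! \<sigma> i) [0..<length ts]"
  have us: "mset ?us = mset ts"
    using mset_permute_list[OF equivariant(3)] unfolding permute_list_def by simp
  then have "mset (concat (map leaves ?us)) = mset (concat (map leaves ts))"
    unfolding mset_concat sum_mset_sum_list[symmetric] mset_map by simp
  moreover have "act P (length ts) \<sigma> x \<in> X (length ts)" using equivariant X_act by simp
  moreover have "list_all (decorated X) ?us"
    using equivariant(2) mset_eq_setD[OF us] by (simp only: list_all_iff M_simps)
  moreover have "Poly_Mapping.keys (tvec (Node (act M (length ts) \<sigma> x) ts) - tvec (Node x ?us) :: ('k, 'v) tvec)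
      \<subseteq> {Node (act P (length ts) \<sigma> x) ts, Node x ?us}"
    by (auto simp: in_keys_iff lookup_minus lookup_single when_def split: if_splits)
  ultimately show ?case
    using equivariant by (intro exI[of _ "mset (concat (map leaves ts))"]) auto
next
  case (at_subtree w x ss ts)
  then obtain N where "\<forall>t\<in>Poly_Mapping.keys w. decorated X t \<and> mset (leaves t) = N" by blast
  then show ?case
    using at_subtree keys_tmap[of "\<lambda>t. Node x (ss @ t # ts)" w]
    by (intro exI[of _ "mset (concat (map leaves ss)) + N + mset (concat (map leaves ts))"]) fastforce
qed

lemma tree_spaceI: "(\<And>t. t \<in> Poly_Mapping.keys w \<Longrightarrow> t \<in> trees X n) \<Longrightarrow> w \<in> tree_space X n"
  unfolding tree_space_def by blast

lemma cf_tree_relations: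
  assumes "w \<in> tree_relations M"
  shows "lin_ext (cf u) w = 0"
proof -
  obtain N where N: "\<And>t. t \<in> Poly_Mapping.keys w \<Longrightarrow> decorated X t \<and> mset (leaves t) = N"
    using tree_relations_keys[OF assms] by blast
  show ?thesis
  proof (rule lin_ext_cf_eq_0[OF N])
    fix T and n :: nat
    assume t: "\<And>t. t \<in> Poly_Mapping.keys w \<Longrightarrow> relabel (rk T) t \<in> trees X n"
    show "pi n (tmap (relabel (rk T)) w) = 0"
    proof (rule pi_trel)
      show "tmap (relabel (rk T)) w \<in> tree_space X n"
        using t keys_tmap by (intro tree_spaceI) blast
      show "tmap (relabel (rk T)) w \<in> trel M"
        using assms by (intro trel_relabel tv.span_base)
    qed
  qed
qed

lemma cf_null:
  assumes "w \<in> null"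
  shows "lin_ext (cf u) w = 0"
proof -
  obtain v w0 m where w: "w = tmap (\<lambda>t. bind t v) w0" and w0: "w0 \<in> ker_pi m"
    and v: "\<And>j. decorated X (v j)" using assms unfolding null_def by blast
  have k: "t \<in> trees X m" if "t \<in> Poly_Mapping.keys w0" for t
    using that w0 unfolding ker_pi_def tree_space_def by blast
  have r: "tmap (relabel (rk T)) w = tmap (\<lambda>t. bind t (\<lambda>j. relabel (rk T) (v j))) w0" for T
    unfolding w tmap_tmap relabel_def bind_bind ..
  have "lin_ext (cf u) w = 0" if "w0 \<noteq> 0"
  proof -
    obtain t0 where t0: "t0 \<in> Poly_Mapping.keys w0" using \<open>w0 \<noteq> 0\<close> by (metis all_not_in_conv keys_eq_empty)
    have N: "decorated X (bind t v) \<and> mset (leaves (bind t v)) = mset (leaves (bind t0 v))"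
      if "t \<in> Poly_Mapping.keys w0" for t
    proof
      show "decorated X (bind t v)"
        using k[OF that] v unfolding trees_def by (blast intro: decorated_bind)
      show "mset (leaves (bind t v)) = mset (leaves (bind t0 v))"
        unfolding mset_leaves_bind mset_leaves_trees[OF k[OF that]] mset_leaves_trees[OF k[OF t0]] ..
    qed
    \<comment> \<open>The terms of \<open>w\<close> share their multiset of leaves, so the single
      term \<open>bind t0 v\<close> decides whether all of them match the leaves of
      \<open>u\<close>.\<close>
    define good where "good \<longleftrightarrow> distinct (leaves (bind t0 v)) \<and> set (leaves (bind t0 v)) = set (leaves u)"
    show ?thesis
    proof (cases good)
      case True
      define T where "T = set (leaves u)"
      have g: "decorated X (bind t v) \<and> distinct (leaves (bind t v)) \<and> set (leaves (bind t v)) = T"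
        if "t \<in> Poly_Mapping.keys w0" for t
      proof -
        have m: "mset (leaves (bind t v)) = mset (leaves (bind t0 v))" using N[OF that] by simp
        show ?thesis
          using N[OF that] mset_eq_setD[OF m] mset_eq_imp_distinct_iff[OF m] True
          by (simp add: good_def T_def)
      qed
      have keys: "Poly_Mapping.keys w \<subseteq> {t. decorated X t \<and> distinct (leaves t) \<and> set (leaves t) = T}"
        unfolding w using keys_tmap[of "\<lambda>t. bind t v" w0] g by blast
      have "tmap (relabel (rk T)) w \<in> ker_pi (card T)"
        unfolding r
      proof (rule ker_pi_bind[OF w0])
        show "decorated X (relabel (rk T) (v j))" for j by (intro decorated_relabel v)
        fix t assume t: "t \<in> Poly_Mapping.keys w0"
        have "relabel (rk T) (bind t v) \<in> trees X (card T)"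
          using g[OF t] by (intro relabel_rk_trees) blast+
        then show "bind t (\<lambda>j. relabel (rk T) (v j)) \<in> trees X (card T)"
          by (simp add: relabel_def bind_bind)
      qed
      then show ?thesis
        using lin_ext_cf[OF keys T_def[symmetric]] by (simp add: ker_pi_def vs.representation_zero)
    next
      case False
      have "cf u (bind t v) = 0" if "t \<in> Poly_Mapping.keys w0" for t
      proof -
        have m: "mset (leaves (bind t v)) = mset (leaves (bind t0 v))" using N[OF that] by simp
        show ?thesis
          using mset_eq_setD[OF m] mset_eq_imp_distinct_iff[OF m] False
          by (auto simp: good_def cf_def Let_def)
      qed
      then show ?thesis unfolding w lin_ext_tmap by (rule lin_ext_eq_0)
    qed
  qed
  then show ?thesis unfolding w by (cases "w0 = 0") auto
qed

section \<open>Coordinates of a root vertex with its children\<close>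

text \<open>
  \<open>lam b us\<close> reads off the coordinate of a tree at \<open>b \<otimes> us\<close>; at most one summand is non-zero, and
  the sum over all permutations makes the equivariance relations evident.
\<close>

definition lam :: "'v \<Rightarrow> 'v optree list \<Rightarrow> 'v optree \<Rightarrow> 'k" where
  "lam b us t = (case t of Leaf j \<Rightarrow> 0 | Node x ts \<Rightarrow>
    if length ts = length us then
      \<Sum>\<sigma>\<in>{\<sigma>. \<sigma> permutes {..<length us}}.
        vs.representation (Xb (length us)) (act P (length us) (inv \<sigma>) x) b *
        (\<Prod>i<length us. cf (us ! i) (ts ! \<sigma> i))
    else 0)"

lemma nth_append_Cons_neq: "j \<noteq> length ss \<Longrightarrow> (ss @ t # ts) ! j = (ss @ t' # ts) ! j"
  by (cases "j < length ss") (auto simp: nth_append nth_Cons')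

text \<open>In each summand exactly one factor depends on the child \<open>t\<close>, namely the one
  of the index \<open>i0\<close> with \<open>\<sigma> i0 = length ss\<close>. The summand is
  therefore a multiple of \<open>cf (us ! i0)\<close> as a functional of \<open>t\<close>.\<close>

lemma lam_inside:
  assumes "\<And>u. lin_ext (cf u) w = 0"
  shows "lin_ext (lam b us) (tmap (\<lambda>t. Node x (ss @ t # ts)) w) = 0"
\<comment> \<open>The entry \<open>undefined\<close> only holds the place of the varying child; no
  value of it is ever used.\<close>
proof (cases "length (ss @ undefined # ts) = length us")
  case True
  let ?k = "length us"
  have "lin_ext (\<lambda>t. vs.representation (Xb ?k) (act P ?k (inv \<sigma>) x) b *
      (\<Prod>i<?k. cf (us ! i) ((ss @ t # ts) ! \<sigma> i))) w = 0" if \<sigma>: "\<sigma> permutes {..<?k}" for \<sigma>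
  proof -
    define i0 where "i0 = inv \<sigma> (length ss)"
    have i0: "\<sigma> i0 = length ss" unfolding i0_def by (rule permutes_inverses[OF \<sigma>])
    then have mem: "i0 \<in> {..<?k}" using permutes_in_image[OF \<sigma>, of i0] True by simp
    have other: "(ss @ t # ts) ! \<sigma> i = (ss @ undefined # ts) ! \<sigma> i" if "i \<noteq> i0" for i t
    proof -
      have "\<sigma> i \<noteq> \<sigma> i0" using that inj_eq[OF permutes_inj[OF \<sigma>], of i i0] by blast
      then show ?thesis unfolding i0 by (rule nth_append_Cons_neq)
    qed
    have "(\<Prod>i<?k. cf (us ! i) ((ss @ t # ts) ! \<sigma> i)) =
        cf (us ! i0) t * (\<Prod>i\<in>{..<?k} - {i0}. cf (us ! i) ((ss @ undefined # ts) ! \<sigma> i))" for t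
    proof -
      have "(\<Prod>i<?k. cf (us ! i) ((ss @ t # ts) ! \<sigma> i)) = cf (us ! i0) ((ss @ t # ts) ! \<sigma> i0) *
          (\<Prod>i\<in>{..<?k} - {i0}. cf (us ! i) ((ss @ t # ts) ! \<sigma> i))"
        by (rule prod.remove) (use mem in auto)
      also have "(\<Prod>i\<in>{..<?k} - {i0}. cf (us ! i) ((ss @ t # ts) ! \<sigma> i)) =
          (\<Prod>i\<in>{..<?k} - {i0}. cf (us ! i) ((ss @ undefined # ts) ! \<sigma> i))"
      proof (rule prod.cong[OF refl])
        fix i assume "i \<in> {..<?k} - {i0}"
        then have "i \<noteq> i0" by blast
        from other[OF this, of t]
        show "cf (us ! i) ((ss @ t # ts) ! \<sigma> i) = cf (us ! i) ((ss @ undefined # ts) ! \<sigma> i)"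
          by (rule arg_cong)
      qed
      finally show ?thesis by (simp add: i0)
    qed
    then show ?thesis
      by (simp only: lin_ext_mult_left lin_ext_mult_right assms mult_zero_left mult_zero_right)
  qed
  then have z: "(\<Sum>\<sigma>\<in>{\<sigma>. \<sigma> permutes {..<?k}}.
      lin_ext (\<lambda>t. vs.representation (Xb ?k) (act P ?k (inv \<sigma>) x) b *
        (\<Prod>i<?k. cf (us ! i) ((ss @ t # ts) ! \<sigma> i))) w) = 0"
    by (intro sum.neutral ballI) (simp only: mem_Collect_eq)
  have "length (ss @ t # ts) = length us" for t using True by simp
  then have "lam b us (Node x (ss @ t # ts)) = (\<Sum>\<sigma>\<in>{\<sigma>. \<sigma> permutes {..<?k}}.
      vs.representation (Xb ?k) (act P ?k (inv \<sigma>) x) b *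
        (\<Prod>i<?k. cf (us ! i) ((ss @ t # ts) ! \<sigma> i)))" for t
    by (simp only: lam_def optree.case simp_thms if_True)
  then show ?thesis unfolding lin_ext_tmap by (simp only: lin_ext_fun_sum z)
next
  case False
  then have "length (ss @ t # ts) \<noteq> length us" for t by simp
  then show ?thesis unfolding lin_ext_tmap
    by (intro lin_ext_eq_0) (simp only: lam_def optree.case if_False)
qed

text \<open>Replacing the summation index \<sigma> by \<tau> \<circ> \<sigma> moves \<tau> from the
  decoration to the children, since
  \<open>inv (\<tau> \<circ> \<sigma>) \<circ> \<tau> = inv \<sigma>\<close>.\<close>

lemma lam_equivariant:
  assumes "\<tau> permutes {..<length ts}" "x \<in> X (length ts)"
  shows "lam b us (Node (act P (length ts) \<tau> x) ts) =
    lam b us (Node x (map (\<lambda>i. ts ! \<tau> i) [0..<length ts]))"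
proof (cases "length ts = length us")
  case True
  let ?k = "length us"
  have \<tau>: "\<tau> permutes {..<?k}" and x: "x \<in> cmpt P ?k" using assms True X_subset by auto
  let ?f = "\<lambda>\<sigma>. vs.representation (Xb ?k) (act P ?k (inv \<sigma>) (act P ?k \<tau> x)) b *
        (\<Prod>i<?k. cf (us ! i) (ts ! \<sigma> i))"
  have "sum ?f {\<sigma>. \<sigma> permutes {..<?k}} = (\<Sum>\<sigma>\<in>{\<sigma>. \<sigma> permutes {..<?k}}. ?f (\<tau> \<circ> \<sigma>))"
    by (rule setum_permutations_compose_left[OF \<tau>])
  also have "\<dots> = (\<Sum>\<sigma>\<in>{\<sigma>. \<sigma> permutes {..<?k}}.
      vs.representation (Xb ?k) (act P ?k (inv \<sigma>) x) b *
        (\<Prod>i<?k. cf (us ! i) (map (\<lambda>i. ts ! \<tau> i) [0..<?k] ! \<sigma> i)))"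
  proof (rule sum.cong[OF refl])
    fix \<sigma> assume "\<sigma> \<in> {\<sigma>. \<sigma> permutes {..<?k}}"
    then have \<sigma>: "\<sigma> permutes {..<?k}" by simp
    have "act P ?k (inv (\<tau> \<circ> \<sigma>)) (act P ?k \<tau> x) = act P ?k (inv (\<tau> \<circ> \<sigma>) \<circ> \<tau>) x"
      using \<sigma> \<tau> x by (intro act_comp[symmetric] permutes_inv permutes_compose)
    also have "inv (\<tau> \<circ> \<sigma>) \<circ> \<tau> = inv \<sigma>"
      using permutes_bij[OF \<sigma>] permutes_bij[OF \<tau>] permutes_inv_o(2)[OF \<tau>]
      by (simp add: o_inv_distrib comp_assoc)
    finally have a: "act P ?k (inv (\<tau> \<circ> \<sigma>)) (act P ?k \<tau> x) = act P ?k (inv \<sigma>) x" .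
    have "(\<Prod>i<?k. cf (us ! i) (ts ! (\<tau> \<circ> \<sigma>) i)) =
        (\<Prod>i<?k. cf (us ! i) (map (\<lambda>i. ts ! \<tau> i) [0..<?k] ! \<sigma> i))"
    proof (rule prod.cong[OF refl])
      fix i assume "i \<in> {..<?k}"
      then have "\<sigma> i < ?k" using permutes_in_image[OF \<sigma>, of i] by simp
      then show "cf (us ! i) (ts ! (\<tau> \<circ> \<sigma>) i) = cf (us ! i) (map (\<lambda>i. ts ! \<tau> i) [0..<?k] ! \<sigma> i)"
        by simp
    qed
    with a show "?f (\<tau> \<circ> \<sigma>) = vs.representation (Xb ?k) (act P ?k (inv \<sigma>) x) b *
        (\<Prod>i<?k. cf (us ! i) (map (\<lambda>i. ts ! \<tau> i) [0..<?k] ! \<sigma> i))" by simp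
  qed
  finally show ?thesis using True by (simp add: lam_def)
qed (simp add: lam_def)

lemma lam_add:
  assumes "x \<in> X (length ts)" "y \<in> X (length ts)"
  shows "lam b us (Node (x + y) ts) = lam b us (Node x ts) + lam b us (Node y ts)"
proof (cases "length ts = length us")
  case True
  let ?k = "length us"
  have "vs.representation (Xb ?k) (act P ?k (inv \<sigma>) (x + y)) b =
      vs.representation (Xb ?k) (act P ?k (inv \<sigma>) x) b + vs.representation (Xb ?k) (act P ?k (inv \<sigma>) y) b"
    if "\<sigma> permutes {..<?k}" for \<sigma>
    using assms True that X_subset[of ?k]
    by (subst act_add) (auto simp: permutes_inv subset_iff Xb X_act vs.representation_add)
  then show ?thesis using True
    by (simp add: lam_def distrib_right sum.distrib)
qed (simp add: lam_def)

lemma lam_scale: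
  assumes "x \<in> X (length ts)"
  shows "lam b us (Node (scl P c x) ts) = c * lam b us (Node x ts)"
proof (cases "length ts = length us")
  case True
  let ?k = "length us"
  have "vs.representation (Xb ?k) (act P ?k (inv \<sigma>) (scl P c x)) b =
      c * vs.representation (Xb ?k) (act P ?k (inv \<sigma>) x) b"
    if "\<sigma> permutes {..<?k}" for \<sigma>
    using assms True that X_subset[of ?k]
    by (subst act_scl) (auto simp: permutes_inv subset_iff Xb X_act vs.representation_scale)
  then show ?thesis using True
    by (simp add: lam_def sum_distrib_left mult.assoc)
qed (simp add: lam_def)

lemma lam_tree_relations:
  assumes "w \<in> tree_relations M"
  shows "lin_ext (lam b us) w = 0"
  using assms
proof (cases rule: tree_relations.cases)
  case (additive x ts y)
  then show ?thesis by (simp add: lam_add)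
next
  case (homogeneous x ts c)
  then show ?thesis by (simp add: lam_scale del: tscale_single)
next
  case (equivariant x ts \<sigma>)
  then show ?thesis using lam_equivariant[of \<sigma> ts x b us] by simp
next
  case (at_subtree w' x ss ts)
  then show ?thesis using lam_inside[OF cf_tree_relations] by simp
qed

lemma lam_inner_relations: "w \<in> inner_relations \<Longrightarrow> lin_ext (lam b us) w = 0"
  unfolding inner_relations_def using lam_inside[OF cf_null] by auto

lemma lam_nonzeroE:
  assumes "lam b us t \<noteq> 0"
  obtains x ts \<sigma> where "t = Node x ts" "length ts = length us" "\<sigma> permutes {..<length us}"
    "\<And>i. i < length us \<Longrightarrow> cf (us ! i) (ts ! \<sigma> i) \<noteq> 0"
proof (cases t)
  case (Leaf j)
  then show ?thesis using assms by (simp add: lam_def)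
next
  case (Node x ts)
  then have l: "length ts = length us" using assms by (auto simp: lam_def split: if_splits)
  then obtain \<sigma> where \<sigma>: "\<sigma> permutes {..<length us}" and
    nz: "(\<Prod>i<length us. cf (us ! i) (ts ! \<sigma> i)) \<noteq> 0"
    using assms Node by (auto simp: lam_def elim!: sum.not_neutral_contains_not_neutral)
  have "cf (us ! i) (ts ! \<sigma> i) \<noteq> 0" if "i < length us" for i
    using nz that by simp
  with Node l \<sigma> that show ?thesis by blast
qed

text \<open>Each non-zero factor \<open>cf\<close> forces a child to have the leaves of its partner
  in \<open>us\<close>. Used in contrapositive form, this disposes of combinations with the wrong
  labels.\<close>

lemma lam_leaves:
  assumes "lam b us t \<noteq> 0" "\<And>u. u \<in> set us \<Longrightarrow> distinct (leaves u)"
  shows "mset (leaves t) = mset (concat (map leaves us))"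
proof -
  obtain x ts \<sigma> where t: "t = Node x ts" "length ts = length us" and \<sigma>: "\<sigma> permutes {..<length us}"
    and nz: "\<And>i. i < length us \<Longrightarrow> cf (us ! i) (ts ! \<sigma> i) \<noteq> 0"
    using assms(1) by (rule lam_nonzeroE) blast
  let ?ts = "map (\<lambda>i. ts ! \<sigma> i) [0..<length us]"
  have "mset ?ts = mset ts"
    using mset_permute_list[of \<sigma> ts] \<sigma> t(2) unfolding permute_list_def by simp
  then have "mset (concat (map leaves ?ts)) = mset (concat (map leaves ts))"
    unfolding mset_concat sum_mset_sum_list[symmetric] mset_map by simp
  moreover have "map mset (map leaves ?ts) = map mset (map leaves us)"
  proof (rule nth_equalityI)
    fix i assume "i < length (map mset (map leaves ?ts))"
    then have i: "i < length us" by simp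
    then have "distinct (leaves (ts ! \<sigma> i))" "set (leaves (ts ! \<sigma> i)) = set (leaves (us ! i))"
      using nz[OF i] by (auto simp: cf_def Let_def split: if_splits)
    then have "mset (leaves (ts ! \<sigma> i)) = mset (leaves (us ! i))"
      using i assms(2)[of "us ! i"] by (simp add: set_eq_iff_mset_eq_distinct[symmetric])
    then show "map mset (map leaves ?ts) ! i = map mset (map leaves us) ! i" using i by simp
  qed simp
  then have "mset (concat (map leaves ?ts)) = mset (concat (map leaves us))"
    unfolding mset_concat by (rule arg_cong)
  ultimately show ?thesis using t by simp
qed

end

section \<open>Counting ordered families of basis trees\<close>

lemma sum_Pow_card:
  assumes "finite S"
  shows "(\<Sum>T\<in>Pow S. g (card T)) = (\<Sum>j\<le>card S. of_nat (card S choose j) * (g j :: real))"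
proof -
  have "(\<Sum>T\<in>Pow S. g (card T)) = (\<Sum>j\<le>card S. \<Sum>T\<in>{T\<in>Pow S. card T = j}. g (card T))"
    by (rule sum.group[symmetric]) (use assms in \<open>auto intro: card_mono\<close>)
  also have "\<dots> = (\<Sum>j\<le>card S. of_nat (card S choose j) * g j)"
  proof (rule sum.cong[OF refl])
    fix j
    have "(\<Sum>T\<in>{T\<in>Pow S. card T = j}. g (card T)) = (\<Sum>T\<in>{T\<in>Pow S. card T = j}. g j)"
      by (rule sum.cong) auto
    then show "(\<Sum>T\<in>{T\<in>Pow S. card T = j}. g (card T)) = of_nat (card S choose j) * g j"
      using n_subsets[OF assms, of j] by (simp add: Pow_def)
  qed
  finally show ?thesis .
qed

section \<open>Finite-dimensionality of the operad\<close>

lemma finite_dim_basis: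
  fixes s :: "'a::field \<Rightarrow> 'b::ab_group_add \<Rightarrow> 'b"
  assumes "vector_space s" "module.subspace s V" "finite_dim s V" "B \<subseteq> V"
    "\<not> module.dependent s B" "V \<subseteq> module.span s B"
  shows "finite B" "card B = vector_space.dim s V"
proof -
  interpret vector_space s by (rule assms(1))
  obtain B' where B': "finite B'" "V \<subseteq> span B'" using assms(3) unfolding finite_dim_def by blast
  show "finite B" using independent_span_bound[OF B'(1) assms(5)] B'(2) assms(4) by blast
  show "card B = dim V" by (rule basis_card_eq_dim[OF assms(4,6,5)])
qed

locale finite_presented_operad = presented_operad_relations P X \<pi> R
  for P :: "('k::field, 'v::ab_group_add) operad" and X \<pi> R +
  assumes X_finite: "locally_finite P X"
    and R_finite: "locally_finite (free_operad (restrict_smodule P X)) R"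
begin

text \<open>Structure maps of an operad are linear on components only, so \<open>h\<close> is not
  assumed linear beyond \<open>V\<close>, and membership in \<open>V\<close> has to accompany the
  induction on the span.\<close>

lemma span_image_on:
  assumes "vs.subspace V" "B \<subseteq> V" "x \<in> vs.span B"
    and add: "\<And>x y. x \<in> V \<Longrightarrow> y \<in> V \<Longrightarrow> h (x + y) = h x + h y"
    and scale: "\<And>c x. x \<in> V \<Longrightarrow> h (scl P c x) = scl P c (h x)"
  shows "h x \<in> vs.span (h ` B)"
proof -
  have "x \<in> V \<and> h x \<in> vs.span (h ` B)"
    using assms(3)
  proof (induction rule: vs.span_induct_alt)
    case base
    have "h 0 = 0" using scale[of 0 0] vs.subspace_0[OF assms(1)] by simp
    then show ?case using vs.subspace_0[OF assms(1)] vs.span_zero by simp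
  next
    case (step c x y)
    have x: "x \<in> V" using step(1) assms(2) by blast
    have cx: "scl P c x \<in> V" by (rule vs.subspace_scale[OF assms(1) x])
    have "h (scl P c x + y) = scl P c (h x) + h y"
      using add[OF cx, of y] scale[OF x, of c] step(2) by simp
    moreover have "scl P c (h x) + h y \<in> vs.span (h ` B)"
      using step by (intro vs.span_add[OF vs.span_scale[OF vs.span_base]]) auto
    ultimately show ?case using vs.subspace_add[OF assms(1) cx] step(2) by simp
  qed
  then show ?thesis ..
qed

lemma finite_dim_bounded_basis:
  assumes "vs.subspace V" "finite_dim (scl P) V"
  obtains B where "finite B" "B \<subseteq> V" "V \<subseteq> vs.span B"
proof -
  obtain B where B: "B \<subseteq> V" "vs.independent B" "V \<subseteq> vs.span B"
    by (rule vs.maximal_independent_subset)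
  then show ?thesis
    using finite_dim_basis(1)[OF vector_space_scl assms B] that by blast
qed

text \<open>Every operation of arity \<open>n \<ge> 2\<close> is a generator plus compositions of operations of smaller arity.\<close>

lemma P_finite: "finite_dim (scl P) (cmpt P n)"
proof (induction n rule: less_induct)
  case (less n)
  consider "n = 0" | "n = 1" | "2 \<le> n" by linarith
  then show ?case
  proof cases
    case 1
    have "cmpt P 0 \<subseteq> vs.span {}" unfolding P0 by simp
    then show ?thesis unfolding finite_dim_def 1 by (intro exI[of _ "{}"]) simp
  next
    case 2
    have "cmpt P 1 \<subseteq> vs.span {one P}"
      unfolding P1 using vs.span_scale[OF vs.span_base[of "one P" "{one P}"]] by blast
    then show ?thesis unfolding finite_dim_def 2 by (intro exI[of _ "{one P}"]) simp
  next
    case 3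
    have "\<forall>m. \<exists>B. m < n \<longrightarrow> finite B \<and> B \<subseteq> cmpt P m \<and> cmpt P m \<subseteq> vs.span B"
    proof
      fix m
      show "\<exists>B. m < n \<longrightarrow> finite B \<and> B \<subseteq> cmpt P m \<and> cmpt P m \<subseteq> vs.span B"
      proof (cases "m < n")
        case True
        obtain B where "finite B" "B \<subseteq> cmpt P m" "cmpt P m \<subseteq> vs.span B"
          by (rule finite_dim_bounded_basis[OF subspace_cmpt less[OF True]])
        then show ?thesis by (intro exI[of _ B] impI conjI)
      qed simp
    qed
    from choice[OF this] obtain B where
      B: "\<And>m. m < n \<Longrightarrow> finite (B m) \<and> B m \<subseteq> cmpt P m \<and> cmpt P m \<subseteq> vs.span (B m)"
      by blast
    obtain BX where BX: "finite BX" "X n \<subseteq> vs.span BX"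
      using X_finite unfolding locally_finite_def finite_dim_def by blast
    \<comment> \<open>By bilinearity, compositions of basis elements span all decomposables. Both
      arities are at least 2 with \<open>m + k - 1 = n\<close>, so \<open>m\<close>,
      \<open>k\<close> and \<open>i\<close> are below \<open>n\<close> and \<open>Q\<close> is
      finite.\<close>
    define Q where "Q = (\<Union>\<sigma>\<in>{\<sigma>. \<sigma> permutes {..<n}}. \<Union>m<n. \<Union>k<n. \<Union>i<n.
      (\<lambda>(f, g). act P n \<sigma> (pcomp P m i k f g)) ` (B m \<times> B k))"
    have "decomposables P n \<subseteq> vs.span Q"
      unfolding decomposables_def
    proof (rule vs.span_minimal)
      show "vs.subspace (vs.span Q)" by (rule vs.subspace_span)
      show "{act P n \<sigma> (pcomp P m i k f g) |\<sigma> m i k f g.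
        \<sigma> permutes {..<n} \<and> 2 \<le> m \<and> 2 \<le> k \<and> i < m \<and> m + k - 1 = n \<and>
        f \<in> cmpt P m \<and> g \<in> cmpt P k} \<subseteq> vs.span Q"
      proof (rule subsetI, elim CollectE exE conjE)
        fix y \<sigma> m i k f g
        assume y: "y = act P n \<sigma> (pcomp P m i k f g)" and \<sigma>: "\<sigma> permutes {..<n}"
          and mk: "2 \<le> m" "2 \<le> k" "i < m" "m + k - 1 = n" and fg: "f \<in> cmpt P m" "g \<in> cmpt P k"
        have lt: "m < n" "k < n" "i < n" using mk by linarith+
        have cl: "pcomp P m i k f g \<in> cmpt P n" if "f \<in> cmpt P m" "g \<in> cmpt P k" for f g
          using pcomp_closed[OF mk(3) that] mk(4) by simp
        have f: "f \<in> vs.span (B m)" and g: "g \<in> vs.span (B k)" using B lt fg by blast+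
        have inner: "act P n \<sigma> (pcomp P m i k f' g) \<in> vs.span Q" if "f' \<in> B m" for f'
        proof -
          have f': "f' \<in> cmpt P m" using that B lt by blast
          have "act P n \<sigma> (pcomp P m i k f' g) \<in> vs.span ((\<lambda>g. act P n \<sigma> (pcomp P m i k f' g)) ` B k)"
          proof (rule span_image_on[OF subspace_cmpt _ g])
            show "B k \<subseteq> cmpt P k" using B[OF lt(2)] by blast
            fix x y c assume x: "x \<in> cmpt P k"
            show "act P n \<sigma> (pcomp P m i k f' (scl P c x)) = scl P c (act P n \<sigma> (pcomp P m i k f' x))"
              by (simp only: pcomp_scl_right[OF mk(3) f' x] act_scl[OF \<sigma> cl[OF f' x]])
            assume y: "y \<in> cmpt P k"
            show "act P n \<sigma> (pcomp P m i k f' (x + y)) =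
                act P n \<sigma> (pcomp P m i k f' x) + act P n \<sigma> (pcomp P m i k f' y)"
              by (simp only: pcomp_add_right[OF mk(3) f' x y] act_add[OF \<sigma> cl[OF f' x] cl[OF f' y]])
          qed
          moreover have "(\<lambda>g. act P n \<sigma> (pcomp P m i k f' g)) ` B k \<subseteq> Q"
          proof
            fix z assume "z \<in> (\<lambda>g. act P n \<sigma> (pcomp P m i k f' g)) ` B k"
            then obtain g' where "g' \<in> B k" "z = act P n \<sigma> (pcomp P m i k f' g')" by blast
            then have "z \<in> (\<lambda>(f, g). act P n \<sigma> (pcomp P m i k f g)) ` (B m \<times> B k)"
              using \<open>f' \<in> B m\<close> by (intro image_eqI[of _ _ "(f', g')"]) simp_all
            then show "z \<in> Q"
              unfolding Q_def using lt \<sigma>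
              by (intro UN_I[of \<sigma>] UN_I[of m] UN_I[of k] UN_I[of i]) simp_all
          qed
          ultimately show ?thesis using vs.span_mono by blast
        qed
        have y_span: "y \<in> vs.span ((\<lambda>f. act P n \<sigma> (pcomp P m i k f g)) ` B m)"
          unfolding y
        proof (rule span_image_on[OF subspace_cmpt _ f])
          show "B m \<subseteq> cmpt P m" using B[OF lt(1)] by blast
          fix x y c assume x: "x \<in> cmpt P m"
          show "act P n \<sigma> (pcomp P m i k (scl P c x) g) = scl P c (act P n \<sigma> (pcomp P m i k x g))"
            by (simp only: pcomp_scl_left[OF mk(3) x fg(2)] act_scl[OF \<sigma> cl[OF x fg(2)]])
          assume y: "y \<in> cmpt P m"
          show "act P n \<sigma> (pcomp P m i k (x + y) g) =
              act P n \<sigma> (pcomp P m i k x g) + act P n \<sigma> (pcomp P m i k y g)"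
            by (simp only: pcomp_add_left[OF mk(3) x y fg(2)] act_add[OF \<sigma> cl[OF x fg(2)] cl[OF y fg(2)]])
        qed
        have "(\<lambda>f. act P n \<sigma> (pcomp P m i k f g)) ` B m \<subseteq> vs.span Q" using inner by blast
        from vs.span_minimal[OF this vs.subspace_span] y_span show "y \<in> vs.span Q" by blast
      qed
    qed
    moreover have "\<forall>y\<in>cmpt P n. \<exists>x\<in>X n. y - x \<in> decomposables P n"
      using generators 3 unfolding minimal_generators_def by blast
    ultimately have dec: "\<exists>x\<in>X n. y - x \<in> vs.span Q" if "y \<in> cmpt P n" for y
      using that by blast
    have "cmpt P n \<subseteq> vs.span (BX \<union> Q)"
    proof
      fix y assume "y \<in> cmpt P n"
      then obtain x where "x \<in> vs.span BX" "y - x \<in> vs.span Q" using dec BX(2) by blast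
      then have "x \<in> vs.span (BX \<union> Q)" "y - x \<in> vs.span (BX \<union> Q)"
        using vs.span_mono[of BX "BX \<union> Q"] vs.span_mono[of Q "BX \<union> Q"] by blast+
      from vs.span_add[OF this] show "y \<in> vs.span (BX \<union> Q)" by simp
    qed
    moreover have "finite Q"
      unfolding Q_def using B
      by (intro finite_UN_I finite_imageI finite_cartesian_product finite_permutations finite_lessThan) blast+
    ultimately show ?thesis using BX(1) unfolding finite_dim_def by blast
  qed
qed

lemma finite_Xb: "finite (Xb k)" and card_Xb: "card (Xb k) = vs.dim (X k)"
proof -
  have "finite_dim (scl P) (X k)" using X_finite unfolding locally_finite_def by blast
  note b = finite_dim_basis[OF vector_space_scl X_subspace this Xb(1,2) equalityD2[OF Xb(3)]]
  show "finite (Xb k)" "card (Xb k) = vs.dim (X k)" by (rule b)+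
qed

lemma finite_Cb: "finite (Cb n)" and card_Cb: "card (Cb n) = vs.dim (cmpt P n)"
proof -
  have "pit n ` Cb n \<subseteq> cmpt P n" using Cb(1) pi_closed tvec_tree_space by blast
  note b = finite_dim_basis[OF vector_space_scl subspace_cmpt P_finite this Cb(3) equalityD2[OF Cb(4)]]
  show "finite (Cb n)" by (rule finite_imageD[OF b(1) Cb(2)])
  show "card (Cb n) = vs.dim (cmpt P n)" using b(2) card_image[OF Cb(2)] by simp
qed

definition Rb :: "nat \<Rightarrow> ('k, 'v) tvec set" where
  "Rb k = (SOME B. B \<subseteq> R k \<and> tv.independent B \<and> R k \<subseteq> tv.span B)"

lemma Rb: "Rb k \<subseteq> R k" "tv.independent (Rb k)" "R k \<subseteq> tv.span (Rb k)"
proof -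
  let ?Q = "\<lambda>B. B \<subseteq> R k \<and> tv.independent B \<and> R k \<subseteq> tv.span B"
  obtain B where "B \<subseteq> R k" "tv.independent B" "R k \<subseteq> tv.span B"
    by (rule tv.maximal_independent_subset)
  then have "?Q B" by (intro conjI)
  then have "?Q (Rb k)" unfolding Rb_def by (rule someI[of ?Q])
  then show "Rb k \<subseteq> R k" "tv.independent (Rb k)" "R k \<subseteq> tv.span (Rb k)" by blast+
qed

lemma finite_Rb: "finite (Rb k)" and card_Rb: "card (Rb k) = tv.dim (R k)"
proof -
  have "finite_dim tscale (R k)" using R_finite unfolding locally_finite_def free_simps by blast
  note b = finite_dim_basis[OF tv.vector_space_axioms R_subspace this Rb]
  show "finite (Rb k)" "card (Rb k) = tv.dim (R k)" by (rule b)+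
qed

text \<open>Ordered partitions of \<open>S\<close> into \<open>k\<close> blocks, with a basis
  element of \<open>P\<close> on each block: in the language of species, a basis of the
  \<open>k\<close>-th power of \<open>P\<close> on the label set \<open>S\<close>.\<close>

definition families :: "nat set \<Rightarrow> nat \<Rightarrow> 'v optree list set" where
  "families S k = {us. length us = k \<and> (\<forall>u\<in>set us. canonical u) \<and>
    distinct (concat (map leaves us)) \<and> set (concat (map leaves us)) = S}"

abbreviation Pz :: "real fps" where
  "Pz \<equiv> gen_series P (cmpt P)"

lemma Cb_0: "Cb 0 = {}"
proof -
  have "c \<notin> Cb 0" for c
  proof
    assume c: "c \<in> Cb 0"
    then have "pit 0 c \<in> cmpt P 0" using Cb(1) pi_closed tvec_tree_space by blast
    then have "pit 0 c = 0" unfolding P0 by simp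
    moreover have "pit 0 c \<in> pit 0 ` Cb 0" using c by (rule imageI)
    ultimately show False using Cb(3)[of 0] vs.dependent_zero[of "pit 0 ` Cb 0"] by simp
  qed
  then show ?thesis by blast
qed

lemma Pz_nth: "Pz $ n = card (Cb n) / fact n"
proof (cases "n = 0")
  case True
  then show ?thesis by (simp only: gen_series_def fps_nth_Abs_fps Cb_0 card.empty) simp
next
  case False
  then show ?thesis by (simp only: gen_series_def fps_nth_Abs_fps if_False card_Cb)
qed

lemma canonical_leaves:
  assumes "canonical u"
  shows "leaves u \<noteq> []"
proof
  assume "leaves u = []"
  then have "card (set (leaves u)) = 0" by simp
  then show False using canonicalD(1)[OF assms] Cb_0 by (metis empty_iff)
qed

lemma canonical_set_eq:
  assumes "finite T"
  shows "{u. canonical u \<and> set (leaves u) = T} = relabel (en T) ` Cb (card T)"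
    "card {u. canonical u \<and> set (leaves u) = T} = card (Cb (card T))"
proof -
  show e: "{u. canonical u \<and> set (leaves u) = T} = relabel (en T) ` Cb (card T)"
  proof (intro subset_antisym subsetI)
    fix u assume "u \<in> {u. canonical u \<and> set (leaves u) = T}"
    then show "u \<in> relabel (en T) ` Cb (card T)" unfolding canonical_def by auto
  next
    fix u assume "u \<in> relabel (en T) ` Cb (card T)"
    then obtain c where c: "c \<in> Cb (card T)" "u = relabel (en T) c" by blast
    show "u \<in> {u. canonical u \<and> set (leaves u) = T}"
      using canonical_relabel_en[OF assms c(1)] relabel_en_Cb(1)[OF assms c(1)] c(2) by simp
  qed
  have "inj_on (relabel (en T)) (Cb (card T))"
    using relabel_en_Cb(4)[OF assms] by (metis inj_onI)
  then show "card {u. canonical u \<and> set (leaves u) = T} = card (Cb (card T))"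
    unfolding e by (rule card_image)
qed

lemma families_Suc:
  "families S (Suc k) = (\<Union>T\<in>Pow S. (\<lambda>(u, us). u # us) ` ({u. canonical u \<and> set (leaves u) = T} \<times> families (S - T) k))"
proof (intro subset_antisym subsetI)
  fix vs assume "vs \<in> families S (Suc k)"
  then obtain u us where vs: "vs = u # us" "length us = k" "canonical u" "\<forall>u\<in>set us. canonical u"
    and d: "distinct (concat (map leaves us))" "set (leaves u) \<inter> set (concat (map leaves us)) = {}"
    and S: "set (leaves u) \<union> set (concat (map leaves us)) = S"
    unfolding families_def by (cases vs) auto
  have "set (concat (map leaves us)) = S - set (leaves u)" using d(2) S by blast
  then have "us \<in> families (S - set (leaves u)) k" using vs d unfolding families_def by blast
  moreover have "set (leaves u) \<in> Pow S" using S by blast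
  ultimately show "vs \<in> (\<Union>T\<in>Pow S. (\<lambda>(u, us). u # us) ` ({u. canonical u \<and> set (leaves u) = T} \<times> families (S - T) k))"
    using vs(1,3) by (intro UN_I[of "set (leaves u)"] image_eqI[of _ _ "(u, us)"]) auto
next
  fix vs assume "vs \<in> (\<Union>T\<in>Pow S. (\<lambda>(u, us). u # us) ` ({u. canonical u \<and> set (leaves u) = T} \<times> families (S - T) k))"
  then obtain u us where vs: "vs = u # us" "canonical u" "set (leaves u) \<subseteq> S" "us \<in> families (S - set (leaves u)) k"
    by auto
  then show "vs \<in> families S (Suc k)"
    using canonicalD(2)[OF vs(2)] unfolding families_def by auto
qed

text \<open>Splitting off the first block \<open>T\<close> sums over all subsets of
  \<open>S\<close>, which produces a binomial convolution. That is multiplication of exponential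
  generating series, so the count follows \<open>Pz ^ k\<close>.\<close>

lemma card_families:
  assumes "finite S"
  shows "finite (families S k) \<and> real (card (families S k)) = fact (card S) * (Pz ^ k) $ card S"
  using assms
proof (induction k arbitrary: S)
  case 0
  have "families S 0 = (if S = {} then {[]} else {})" unfolding families_def by auto
  then show ?case using 0 by auto
next
  case (Suc k)
  let ?C = "\<lambda>T. {u. canonical u \<and> set (leaves u) = T}"
  let ?n = "card S"
  have fin: "finite (?C T \<times> families (S - T) k)" if "T \<in> Pow S" for T
    using that Suc finite_subset[of T S] canonical_set_eq(1)[of T] finite_Cb by auto
  have inj: "inj_on (\<lambda>(u, us). u # us) B" for B :: "('v optree \<times> 'v optree list) set"
    by (auto simp: inj_on_def)
  have "card (families S (Suc k)) = (\<Sum>T\<in>Pow S. card ((\<lambda>(u, us). u # us) ` (?C T \<times> families (S - T) k)))"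
    unfolding families_Suc
  proof (rule card_UN_disjoint)
    show "finite (Pow S)" using Suc by simp
    show "\<forall>T\<in>Pow S. finite ((\<lambda>(u, us). u # us) ` (?C T \<times> families (S - T) k))"
      using fin by blast
    show "\<forall>T\<in>Pow S. \<forall>T'\<in>Pow S. T \<noteq> T' \<longrightarrow>
      (\<lambda>(u, us). u # us) ` (?C T \<times> families (S - T) k) \<inter> (\<lambda>(u, us). u # us) ` (?C T' \<times> families (S - T') k) = {}"
      by (intro ballI impI) auto
  qed
  also have "\<dots> = (\<Sum>T\<in>Pow S. card (Cb (card T)) * card (families (S - T) k))"
    using Suc finite_subset[of _ S]
    by (intro sum.cong refl) (simp add: card_image[OF inj] card_cartesian_product canonical_set_eq(2))
  finally have "real (card (families S (Suc k))) = (\<Sum>T\<in>Pow S. real (card (Cb (card T))) * real (card (families (S - T) k)))"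
    by simp
  also have "\<dots> = (\<Sum>T\<in>Pow S. (\<lambda>j. real (card (Cb j)) * (fact (?n - j) * (Pz ^ k) $ (?n - j))) (card T))"
  proof (rule sum.cong[OF refl])
    fix T assume "T \<in> Pow S"
    then have T: "finite T" "finite (S - T)" "card (S - T) = ?n - card T"
      using Suc(2) finite_subset[of T S] by (auto simp: card_Diff_subset)
    then show "real (card (Cb (card T))) * real (card (families (S - T) k)) =
      (\<lambda>j. real (card (Cb j)) * (fact (?n - j) * (Pz ^ k) $ (?n - j))) (card T)"
      using Suc(1)[OF T(2)] by simp
  qed
  also have "\<dots> = (\<Sum>j\<le>?n. of_nat (?n choose j) * (real (card (Cb j)) * (fact (?n - j) * (Pz ^ k) $ (?n - j))))"
    by (rule sum_Pow_card[OF Suc(2)])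
  also have "\<dots> = (\<Sum>j=0..?n. fact ?n * (Pz $ j * (Pz ^ k) $ (?n - j)))"
  proof (rule sum.cong)
    fix j assume "j \<in> {0..?n}"
    then have "real (?n choose j) = fact ?n / (fact j * fact (?n - j))"
      by (intro binomial_fact) simp
    then show "of_nat (?n choose j) * (real (card (Cb j)) * (fact (?n - j) * (Pz ^ k) $ (?n - j))) =
        fact ?n * (Pz $ j * (Pz ^ k) $ (?n - j))"
      by (simp add: Pz_nth)
  qed auto
  also have "\<dots> = fact ?n * (Pz ^ Suc k) $ ?n"
    by (simp add: fps_mult_nth sum_distrib_left)
  finally show ?case using fin Suc(2) unfolding families_Suc by auto
qed

text \<open>No canonical tree lacks leaves, because \<open>P(0) = 0\<close>. Sums over
  \<open>k \<le> n\<close> therefore take in all families on \<open>n\<close> labels.\<close>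

lemma families_length:
  assumes "us \<in> families S k"
  shows "k \<le> card S"
proof -
  have us: "length us = k" "\<forall>u\<in>set us. canonical u" "distinct (concat (map leaves us))"
    "set (concat (map leaves us)) = S" using assms unfolding families_def by blast+
  have "k = sum_list (map (\<lambda>_. 1) us)" using us(1) by (simp add: sum_list_triv)
  also have "\<dots> \<le> sum_list (map (\<lambda>u. length (leaves u)) us)"
    using us(2) canonical_leaves by (intro sum_list_mono) (simp add: Suc_leI)
  also have "\<dots> = length (concat (map leaves us))" by (simp add: length_concat comp_def)
  also have "\<dots> = card S" using distinct_card[OF us(3)] us(4) by simp
  finally show ?thesis .
qed

text \<open>Disjoint non-empty leaf sets keep the members apart. Hence the symmetric group acts
  freely on the orderings of a family, which is the source of the factor \<open>fact k\<close> in
  \<open>card_reps\<close>.\<close>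

lemma families_distinct:
  assumes "us \<in> families S k"
  shows "distinct us"
proof -
  have us: "\<forall>u\<in>set us. canonical u" "distinct (concat (map leaves us))"
    using assms unfolding families_def by blast+
  show ?thesis
    using us
  proof (induction us)
    case (Cons u us)
    then have "set (leaves u) \<inter> set (concat (map leaves us)) = {}" "leaves u \<noteq> []"
      using canonical_leaves by auto
    then have "u \<notin> set us" by (cases "leaves u") auto
    then show ?case using Cons by simp
  qed simp
qed

lemma families_permute:
  assumes "us \<in> families S k" "mset vs = mset us"
  shows "vs \<in> families S k"
proof -
  have "mset (concat (map leaves vs)) = mset (concat (map leaves us))"
    using assms(2) unfolding mset_concat sum_mset_sum_list[symmetric] mset_map by simp
  note m = mset_eq_setD[OF this] mset_eq_imp_distinct_iff[OF this]
  show ?thesis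
    using assms(1) mset_eq_setD[OF assms(2)] mset_eq_length[OF assms(2)] m
    unfolding families_def by simp
qed

text \<open>A choice of one ordering for each unordered family \<open>V\<close>. The group acts
  freely, so pairing these orderings with a basis of \<open>X(k)\<close> yields a basis of the
  coinvariants.\<close>

definition rep :: "nat set \<Rightarrow> nat \<Rightarrow> 'v optree set \<Rightarrow> 'v optree list" where
  "rep S k V = (SOME us. us \<in> families S k \<and> set us = V)"

definition reps :: "nat set \<Rightarrow> nat \<Rightarrow> 'v optree list set" where
  "reps S k = rep S k ` set ` families S k"

lemma rep: "us \<in> families S k \<Longrightarrow> rep S k (set us) \<in> families S k \<and> set (rep S k (set us)) = set us"
  unfolding rep_def by (rule someI[of "\<lambda>vs. vs \<in> families S k \<and> set vs = set us"]) blast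

lemma reps_families: "reps S k \<subseteq> families S k"
  unfolding reps_def using rep by blast

lemma reps_unique: "us \<in> reps S k \<Longrightarrow> vs \<in> reps S k \<Longrightarrow> set us = set vs \<Longrightarrow> us = vs"
  unfolding reps_def using rep by auto

lemma reps_exists: "us \<in> families S k \<Longrightarrow> \<exists>vs\<in>reps S k. set vs = set us"
  unfolding reps_def using rep by blast

lemma card_reps:
  assumes "finite S"
  shows "finite (reps S k)" "real (card (reps S k)) * fact k = fact (card S) * (Pz ^ k) $ card S"
proof -
  have fin: "finite (families S k)" and c: "real (card (families S k)) = fact (card S) * (Pz ^ k) $ card S"
    using card_families[OF assms] by blast+
  show "finite (reps S k)" using fin reps_families finite_subset by blast
  have families: "families S k = (\<Union>us\<in>reps S k. permutations_of_set (set us))"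
  proof (intro subset_antisym subsetI)
    fix us assume "us \<in> families S k"
    then show "us \<in> (\<Union>us\<in>reps S k. permutations_of_set (set us))"
    proof -
      obtain vs where "vs \<in> reps S k" "set vs = set us" using reps_exists[OF \<open>us \<in> families S k\<close>] by blast
      moreover from this have "us \<in> permutations_of_set (set vs)"
        using families_distinct[OF \<open>us \<in> families S k\<close>] by (intro permutations_of_setI) simp_all
      ultimately show ?thesis by blast
    qed
  next
    fix vs assume "vs \<in> (\<Union>us\<in>reps S k. permutations_of_set (set us))"
    then obtain us where us: "us \<in> families S k" "vs \<in> permutations_of_set (set us)"
      using reps_families by blast
    have "mset vs = mset us"
      using permutations_of_setD[OF us(2)] families_distinct[OF us(1)]
      by (simp only: set_eq_iff_mset_eq_distinct)
    then show "vs \<in> families S k" by (rule families_permute[OF us(1)])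
  qed
  have "card (families S k) = (\<Sum>us\<in>reps S k. card (permutations_of_set (set us)))"
    unfolding families
  proof (rule card_UN_disjoint)
    show "finite (reps S k)" by fact
    show "\<forall>us\<in>reps S k. \<forall>vs\<in>reps S k. us \<noteq> vs \<longrightarrow>
      permutations_of_set (set us) \<inter> permutations_of_set (set vs) = {}"
    proof (intro ballI impI equals0I)
      fix us vs ws assume "us \<in> reps S k" "vs \<in> reps S k" "us \<noteq> vs"
        "ws \<in> permutations_of_set (set us) \<inter> permutations_of_set (set vs)"
      then show False using permutations_of_setD(1) reps_unique by (metis IntD1 IntD2)
    qed
  qed simp
  also have "\<dots> = (\<Sum>us\<in>reps S k. fact k)"
  proof (rule sum.cong[OF refl])
    fix us assume "us \<in> reps S k"
    then have us: "us \<in> families S k" using reps_families by blast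
    then have "card (set us) = k" using distinct_card[OF families_distinct[OF us]] unfolding families_def by simp
    then show "card (permutations_of_set (set us)) = fact k" by simp
  qed
  finally show "real (card (reps S k)) * fact k = fact (card S) * (Pz ^ k) $ card S"
    using c by simp
qed

section \<open>The dimension inequality\<close>

text \<open>These trees represent a basis of the arity \<open>n\<close> part of
  \<open>X \<circ> P\<close>; duality with the functionals \<open>lam\<close> is proved in
  \<open>lam_tree_dual\<close>.\<close>

definition basis_trees :: "nat \<Rightarrow> 'v optree set" where
  "basis_trees n = (\<Union>k\<le>n. (\<lambda>(b, us). Node b us) ` (Xb k \<times> reps {..<n} k))"

text \<open>The value \<open>Leaf 0\<close> beyond the list only keeps \<open>sub us\<close>
  decorated everywhere; a relation of arity \<open>length us\<close> has no leaves there.\<close>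

definition sub :: "'v optree list \<Rightarrow> nat \<Rightarrow> 'v optree" where
  "sub us j = (if j < length us then us ! j else Leaf 0)"

text \<open>The counterpart of \<open>basis_trees\<close> with \<open>R\<close> in place of
  \<open>X\<close>. After application of \<open>Lam\<close> these elements suffice to span what all
  relations at the root contribute.\<close>

definition basis_relations :: "nat \<Rightarrow> ('k, 'v) tvec set" where
  "basis_relations n = (\<Union>k\<le>n. (\<lambda>(r, us). tmap (\<lambda>t. bind t (sub us)) r) ` (Rb k \<times> reps {..<n} k))"

definition lam_tree :: "'v optree \<Rightarrow> 'v optree \<Rightarrow> 'k" where
  "lam_tree e = (case e of Leaf j \<Rightarrow> (\<lambda>_. 0) | Node b us \<Rightarrow> lam b us)"

text \<open>This plays the role of the map from formal combinations of trees to
  \<open>X \<circ> P\<close>, the target being modelled by the span of \<open>basis_trees n\<close>.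
  The trivial tree goes to 0.\<close>

definition Lam :: "nat \<Rightarrow> ('k, 'v) tvec \<Rightarrow> ('k, 'v) tvec" where
  "Lam n w = (\<Sum>e\<in>basis_trees n. tscale (lin_ext (lam_tree e) w) (tvec e))"

lemma basis_trees_cases:
  assumes "e \<in> basis_trees n"
  obtains b us k where "e = Node b us" "b \<in> Xb k" "us \<in> reps {..<n} k" "us \<in> families {..<n} k" "length us = k"
proof -
  obtain b us k where e: "e = Node b us" "b \<in> Xb k" "us \<in> reps {..<n} k"
    using assms unfolding basis_trees_def by (elim UN_E imageE SigmaE) simp
  moreover have "us \<in> families {..<n} k" using e(3) reps_families by blast
  moreover from this have "length us = k" unfolding families_def by blast
  ultimately show ?thesis by (rule that)
qed

lemma finite_basis_trees: "finite (basis_trees n)"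
  unfolding basis_trees_def
  by (intro finite_UN_I finite_imageI finite_cartesian_product finite_Xb card_reps finite_atMost finite_lessThan)

lemma card_basis_trees: "card (basis_trees n) = (\<Sum>k\<le>n. card (Xb k) * card (reps {..<n} k))"
proof -
  have len: "length us = k" if "us \<in> reps {..<n} k" for us k
    using that reps_families[of "{..<n}" k] unfolding families_def by blast
  have inj: "inj_on (\<lambda>(b, us). Node b us) B" for B :: "('v \<times> 'v optree list) set"
    by (intro inj_onI) (simp add: case_prod_beta prod_eq_iff)
  have "card (basis_trees n) = (\<Sum>k\<le>n. card ((\<lambda>(b, us). Node b us) ` (Xb k \<times> reps {..<n} k)))"
    unfolding basis_trees_def
  proof (rule card_UN_disjoint)
    show "\<forall>k\<in>{..n}. finite ((\<lambda>(b, us). Node b us) ` (Xb k \<times> reps {..<n} k))"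
      by (intro ballI finite_imageI finite_cartesian_product finite_Xb card_reps finite_lessThan)
    show "\<forall>k\<in>{..n}. \<forall>l\<in>{..n}. k \<noteq> l \<longrightarrow>
      (\<lambda>(b, us). Node b us) ` (Xb k \<times> reps {..<n} k) \<inter> (\<lambda>(b, us). Node b us) ` (Xb l \<times> reps {..<n} l) = {}"
    proof (intro ballI impI equals0I)
      fix k l e
      assume "k \<noteq> l" and e: "e \<in> (\<lambda>(b, us). Node b us) ` (Xb k \<times> reps {..<n} k) \<inter>
        (\<lambda>(b, us). Node b us) ` (Xb l \<times> reps {..<n} l)"
      obtain b us where 1: "e = Node b us" "us \<in> reps {..<n} k"
        using IntD1[OF e] by (elim imageE SigmaE) simp
      obtain b' us' where 2: "e = Node b' us'" "us' \<in> reps {..<n} l"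
        using IntD2[OF e] by (elim imageE SigmaE) simp
      show False using 1 2 len \<open>k \<noteq> l\<close> by (metis optree.inject(2))
    qed
  qed simp
  also have "\<dots> = (\<Sum>k\<le>n. card (Xb k) * card (reps {..<n} k))"
    by (simp only: card_image[OF inj] card_cartesian_product)
  finally show ?thesis .
qed

lemma card_basis_relations:
  "finite (basis_relations n)" "card (basis_relations n) \<le> (\<Sum>k\<le>n. card (Rb k) * card (reps {..<n} k))"
proof -
  have fin: "finite (Rb k \<times> reps {..<n} k)" for k
    by (intro finite_cartesian_product finite_Rb card_reps finite_lessThan)
  show "finite (basis_relations n)"
    unfolding basis_relations_def by (intro finite_UN_I finite_imageI fin finite_atMost)
  have "card (basis_relations n) \<le>
      (\<Sum>k\<le>n. card ((\<lambda>(r, us). tmap (\<lambda>t. bind t (sub us)) r) ` (Rb k \<times> reps {..<n} k)))"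
    unfolding basis_relations_def by (rule card_UN_le) simp
  also have "\<dots> \<le> (\<Sum>k\<le>n. card (Rb k \<times> reps {..<n} k))"
    by (intro sum_mono card_image_le fin)
  finally show "card (basis_relations n) \<le> (\<Sum>k\<le>n. card (Rb k) * card (reps {..<n} k))"
    by (simp only: card_cartesian_product)
qed

lemma Lam_add: "Lam n (v + w) = Lam n v + Lam n w"
  unfolding Lam_def lin_ext_add tv.scale_left_distrib sum.distrib ..

lemma Lam_scale: "Lam n (tscale c w) = tscale c (Lam n w)"
  unfolding Lam_def lin_ext_scale tv.scale_sum_right tv.scale_scale ..

lemma Lam_zero: "Lam n 0 = 0"
  using Lam_scale[of n 0 0] by (simp only: tv.scale_zero_left)

lemma Lam_diff: "Lam n (v - w) = Lam n v - Lam n w"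
  using Lam_add[of n "v - w" w] by (simp add: algebra_simps)

lemma Lam_sum: "Lam n (sum w I) = (\<Sum>i\<in>I. Lam n (w i))"
  by (induction I rule: infinite_finite_induct) (simp_all add: Lam_add Lam_zero)

lemma Lam_eq_0: "(\<And>e. e \<in> basis_trees n \<Longrightarrow> lin_ext (lam_tree e) w = 0) \<Longrightarrow> Lam n w = 0"
  unfolding Lam_def by (intro sum.neutral ballI) simp

lemma Lam_inner_relations: "w \<in> inner_relations \<Longrightarrow> Lam n w = 0"
  by (rule Lam_eq_0, erule basis_trees_cases) (simp only: lam_tree_def optree.case lam_inner_relations)

lemma Lam_trel:
  assumes "w \<in> trel M"
  shows "Lam n w = 0"
proof (rule Lam_eq_0, erule basis_trees_cases)
  fix e b and us :: "'v optree list" assume "e = Node b us"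
  then show "lin_ext (lam_tree e) w = 0"
    using lin_ext_span_eq_0[OF assms lam_tree_relations] by (simp only: lam_tree_def optree.case)
qed

text \<open>A non-zero product matches the entries of \<open>us\<close> with those of
  \<open>us'\<close> up to \<sigma>. Both lists are then the chosen ordering of the same set, and
  distinctness of the entries leaves only the identity permutation.\<close>

lemma lam_basis_trees:
  assumes "b \<in> Xb k" "b' \<in> Xb k" "us \<in> reps {..<n} k" "us' \<in> reps {..<n} k"
  shows "lam b us (Node b' us') = (if b = b' \<and> us = us' then 1 else 0)"
proof -
  have usA: "us \<in> families {..<n} k" "us' \<in> families {..<n} k" using assms reps_families by blast+
  then have len: "length us = k" "length us' = k" and can: "\<forall>u\<in>set us. canonical u" "\<forall>u\<in>set us'. canonical u"
    unfolding families_def by blast+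
  have id: "us = us' \<and> \<sigma> = id"
    if \<sigma>: "\<sigma> permutes {..<k}" and nz: "(\<Prod>i<k. cf (us ! i) (us' ! \<sigma> i)) \<noteq> 0" for \<sigma>
  proof -
    have eq: "us ! i = us' ! \<sigma> i" and si: "\<sigma> i < k" if i: "i < k" for i
    proof -
      show si: "\<sigma> i < k" using permutes_in_image[OF \<sigma>, of i] i by simp
      have "cf (us ! i) (us' ! \<sigma> i) \<noteq> 0" using nz i by simp
      moreover have "canonical (us ! i)" "canonical (us' ! \<sigma> i)"
        using can len i si by simp_all
      ultimately show "us ! i = us' ! \<sigma> i" using cf_canonical by metis
    qed
    have "set us \<subseteq> set us'"
    proof
      fix u assume "u \<in> set us"
      then obtain i where "i < k" "u = us ! i" using len by (metis in_set_conv_nth)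
      then show "u \<in> set us'" using eq si len by (metis nth_mem)
    qed
    moreover have "card (set us) = card (set us')"
      using distinct_card[OF families_distinct[OF usA(1)]] distinct_card[OF families_distinct[OF usA(2)]] len by simp
    ultimately have "set us = set us'" by (metis card_subset_eq List.finite_set)
    then have us: "us = us'" using reps_unique assms by blast
    have "\<sigma> i = i" for i
    proof (cases "i < k")
      case True
      then show ?thesis
        using eq[OF True] si[OF True] us len nth_eq_iff_index_eq[OF families_distinct[OF usA(2)], of i "\<sigma> i"] by simp
    next
      case False
      then show ?thesis using permutes_not_in[OF \<sigma>, of i] by simp
    qed
    then show ?thesis using us by (simp add: fun_eq_iff)
  qed
  let ?h = "\<lambda>\<sigma>. vs.representation (Xb k) (act P k (inv \<sigma>) b') b * (\<Prod>i<k. cf (us ! i) (us' ! \<sigma> i))"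
  have l: "lam b us (Node b' us') = sum ?h {\<sigma>. \<sigma> permutes {..<k}}"
    unfolding lam_def optree.case len by (simp only: if_True refl)
  also have "\<dots> = sum ?h {id}"
  proof (rule sum.mono_neutral_right)
    show "finite {\<sigma>. \<sigma> permutes {..<k}}" by (rule finite_permutations) simp
    show "{id} \<subseteq> {\<sigma>. \<sigma> permutes {..<k}}" using permutes_id by blast
    show "\<forall>\<sigma>\<in>{\<sigma>. \<sigma> permutes {..<k}} - {id}. ?h \<sigma> = 0" using id by fastforce
  qed
  finally have l: "lam b us (Node b' us') = ?h id" by simp
  show ?thesis
  proof (cases "us = us'")
    case True
    have "(\<Prod>i<k. cf (us ! i) (us' ! id i)) = 1"
      using can(1) len(1) by (intro prod.neutral) (simp add: cf_canonical flip: True)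
    moreover have "act P k (inv id) b' = b'"
      using assms(2) Xb(1) X_subset act_id by (simp add: subset_iff)
    moreover have "vs.representation (Xb k) b' b = (if b' = b then 1 else 0)"
      by (simp add: vs.representation_basis[OF Xb(2) assms(2)])
    ultimately show ?thesis using l True by simp
  next
    case False
    then have "(\<Prod>i<k. cf (us ! i) (us' ! id i)) = 0" using id[OF permutes_id] by blast
    then show ?thesis using l False by simp
  qed
qed

lemma lam_tree_dual:
  assumes "e \<in> basis_trees n" "e' \<in> basis_trees n"
  shows "lam_tree e e' = (if e = e' then 1 else 0)"
proof -
  obtain b us k where e: "e = Node b us" "b \<in> Xb k" "us \<in> reps {..<n} k" "length us = k"
    using assms(1) by (rule basis_trees_cases)
  obtain b' us' k' where e': "e' = Node b' us'" "b' \<in> Xb k'" "us' \<in> reps {..<n} k'" "length us' = k'"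
    using assms(2) by (rule basis_trees_cases)
  show ?thesis
  proof (cases "k = k'")
    case True
    then show ?thesis using lam_basis_trees[of b k b' us n us'] e e' by (simp add: lam_tree_def)
  next
    case False
    then show ?thesis using e e' by (auto simp: lam_tree_def lam_def)
  qed
qed

lemma Lam_basis_trees: "e \<in> basis_trees n \<Longrightarrow> Lam n (tvec e) = tvec e"
proof -
  assume e: "e \<in> basis_trees n"
  have "Lam n (tvec e) = (\<Sum>e'\<in>basis_trees n. if e' = e then tvec e else 0)"
    unfolding Lam_def by (rule sum.cong[OF refl]) (simp add: lam_tree_dual e)
  also have "\<dots> = tvec e" using e finite_basis_trees by simp
  finally show ?thesis .
qed

lemma independent_basis_trees: "tv.independent (tvec ` basis_trees n :: ('k, 'v) tvec set)"
proof (rule tv.independent_if_scalars_zero)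
  show "finite (tvec ` basis_trees n :: ('k, 'v) tvec set)" using finite_basis_trees by simp
  fix f :: "('k, 'v) tvec \<Rightarrow> 'k" and x :: "('k, 'v) tvec"
  assume s: "(\<Sum>x\<in>tvec ` basis_trees n. tscale (f x) x) = 0" and "x \<in> tvec ` basis_trees n"
  then obtain e where e: "e \<in> basis_trees n" "x = tvec e" by blast
  have inj: "inj_on (tvec :: _ \<Rightarrow> ('k, 'v) tvec) (basis_trees n)"
    by (rule inj_onI) (metis lookup_single_eq lookup_single_not_eq one_neq_zero)
  have "0 = Poly_Mapping.lookup (\<Sum>e'\<in>basis_trees n. tscale (f (tvec e')) (tvec e')) e"
    using s by (simp add: sum.reindex[OF inj])
  also have "\<dots> = (\<Sum>e'\<in>basis_trees n. if e' = e then f (tvec e') else 0)"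
    by (simp add: lookup_sum lookup_single when_def)
  also have "\<dots> = f x" using e finite_basis_trees by simp
  finally show "f x = 0" ..
qed

section \<open>The image of the kernel in the composite\<close>

lemma sub_decorated:
  assumes "us \<in> families S k"
  shows "decorated X (sub us j)"
proof (cases "j < length us")
  case True
  then have "canonical (us ! j)" using assms unfolding families_def by simp
  then show ?thesis using canonicalD(3) True by (simp add: sub_def)
qed (simp add: sub_def)

lemma R_keys: "r \<in> R k \<Longrightarrow> q \<in> Poly_Mapping.keys r \<Longrightarrow> q \<in> trees X k"
  using R_ker[of k] unfolding ker_pi_def tree_space_def by blast

lemma trees_leaves_less: "q \<in> trees X k \<Longrightarrow> j \<in> set (leaves q) \<Longrightarrow> j < k"
  unfolding trees_def by blast

lemma Lam_root_basis:
  assumes "r \<in> R k" "us \<in> reps {..<n} k"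
  shows "Lam n (tmap (\<lambda>t. bind t (sub us)) r) \<in> tv.span (Lam n ` basis_relations n)"
proof -
  have "r \<in> tv.span (Rb k)" using assms(1) Rb(3) by blast
  have "us \<in> families {..<n} k" using assms(2) reps_families by blast
  then have k: "k \<le> n" using families_length[of us "{..<n}" k] by simp
  show ?thesis
    using \<open>r \<in> tv.span (Rb k)\<close>
  proof (induction rule: tv.span_induct_alt)
    case base
    then show ?case by (simp add: Lam_zero tv.span_zero)
  next
    case (step c x y)
    have "tmap (\<lambda>t. bind t (sub us)) x \<in> basis_relations n"
      unfolding basis_relations_def using step(1) assms(2) k
      by (intro UN_I[of k] image_eqI[of _ _ "(x, us)"]) simp_all
    then have "Lam n (tmap (\<lambda>t. bind t (sub us)) x) \<in> tv.span (Lam n ` basis_relations n)"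
      by (intro tv.span_base imageI)
    from tv.span_add[OF tv.span_scale[OF this] step(2)] show ?case
      by (simp only: tmap_add tmap_scale Lam_add Lam_scale)
  qed
qed

text \<open>Reordering the substituted family amounts to letting a permutation act on the relation,
  and \<open>R\<close> is stable under this action up to tree relations, which \<open>Lam\<close>
  kills.\<close>

lemma Lam_root_canonical:
  assumes r: "r \<in> R k" and us: "us \<in> families {..<n} k"
  shows "Lam n (tmap (\<lambda>t. bind t (sub us)) r) \<in> tv.span (Lam n ` basis_relations n)"
proof -
  obtain vs where vs: "vs \<in> reps {..<n} k" "set vs = set us" using reps_exists[OF us] by blast
  have vsA: "vs \<in> families {..<n} k" using vs(1) reps_families by blast
  have len: "length us = k" "length vs = k" using us vsA unfolding families_def by blast+
  have "mset us = mset vs"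
    using vs(2) families_distinct[OF us] families_distinct[OF vsA] by (simp only: set_eq_iff_mset_eq_distinct)
  then obtain \<tau> where "\<tau> permutes {..<length vs}" and usp: "permute_list \<tau> vs = us"
    by (rule mset_eq_permutation)
  then have \<tau>: "\<tau> permutes {..<k}" using len by simp
  have sub_eq: "sub us j = sub vs (\<tau> j)" if "j < k" for j
  proof -
    have "\<tau> j < k" using permutes_in_image[OF \<tau>, of j] that by simp
    moreover have "us ! j = vs ! \<tau> j"
      using that len permute_list_nth[of \<tau> vs j] \<tau> usp by simp
    ultimately show ?thesis using that len by (simp add: sub_def)
  qed
  have "bind q (sub us) = bind (relabel \<tau> q) (sub vs)" if "q \<in> Poly_Mapping.keys r" for q
    unfolding relabel_def bind_bind bind.simps
    by (rule bind_cong) (rule sub_eq, rule trees_leaves_less[OF R_keys[OF r that]])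
  then have eq: "tmap (\<lambda>t. bind t (sub us)) r = tmap (\<lambda>t. bind t (sub vs)) (tmap (relabel \<tau>) r)"
    unfolding tmap_tmap by (rule tmap_cong)
  define r' where "r' = tree_rep M k (tmap (relabel \<tau>) r)"
  have "r \<in> tree_space X k" using r R_ker[of k] unfolding ker_pi_def by blast
  then have "tmap (relabel \<tau>) r - r' \<in> trel M"
    unfolding r'_def using \<tau> by (intro tree_rep_diff) (simp add: act_tree_space)
  then have "tmap (\<lambda>t. bind t (sub vs)) (tmap (relabel \<tau>) r - r') \<in> trel M"
    by (rule trel_bind) (simp add: sub_decorated[OF vsA])
  from Lam_trel[OF this, of n]
  have "Lam n (tmap (\<lambda>t. bind t (sub us)) r) = Lam n (tmap (\<lambda>t. bind t (sub vs)) r')"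
    unfolding eq tmap_diff Lam_diff by simp
  then show ?thesis
    using Lam_root_basis[OF R_act[OF \<tau> r, folded r'_def] vs(1)] by simp
qed

text \<open>No term of \<open>r\<close> is a bare leaf, so an element of the kernel substituted for
  the leaf \<open>m\<close> sits above a root vertex, and \<open>Lam\<close> does not see
  it.\<close>

lemma Lam_root_replace:
  assumes r: "r \<in> R k" and s: "\<And>j. decorated X (s j)" and m: "m < k"
    and w: "w \<in> ker_pi l" and u: "\<And>j. decorated X (u j)"
  shows "Lam n (tmap2 (\<lambda>q t. bind q (s(m := bind t u))) r w) = 0"
proof -
  have "Lam n (tmap (\<lambda>t. bind q (s(m := bind t u))) w) = 0" if q: "q \<in> Poly_Mapping.keys r" for q
  proof -
    have "q \<notin> range Leaf" using q r R_ker ker_pi_Leaf by blast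
    then obtain x ts where x: "q = Node x ts" by (cases q) auto
    have "q \<in> trees X k" by (rule R_keys[OF r q])
    then have dq: "decorated X q" "distinct (leaves q)" and lq: "set (leaves q) = {..<k}"
      unfolding trees_def by blast+
    have mq: "m \<in> set (leaves q)" unfolding lq using m by simp
    show ?thesis
      unfolding x by (rule Lam_inner_relations, rule inner_relations_substitute[OF dq[unfolded x] mq[unfolded x] w s u])
  qed
  then show ?thesis
    unfolding tmap2_left Lam_sum Lam_scale by (intro sum.neutral ballI) (simp only: tv.scale_zero_right)
qed

text \<open>The trees in \<open>Cb\<close> represent a basis of \<open>P\<close>, so the
  standardised tree is a combination of them up to an element of the kernel.\<close>

lemma canonical_expand:
  assumes "decorated X t" "distinct (leaves t)" "set (leaves t) = S"
  obtains a where "tvec (std t) - (\<Sum>c\<in>Cb (card S). tscale (a c) (tvec c)) \<in> ker_pi (card S)"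
proof -
  let ?n = "card S"
  have st: "tvec (std t) \<in> tree_space X ?n"
    using pi_std_trees[OF assms(1,2)] assms(3) by (intro tvec_tree_space) simp
  have "pit ?n (std t) \<in> vs.span (pit ?n ` Cb ?n)"
    unfolding Cb(4) by (rule pi_closed[OF st])
  then obtain b where b: "pit ?n (std t) = (\<Sum>v\<in>pit ?n ` Cb ?n. scl P (b v) v)"
    using vs.span_finite[of "pit ?n ` Cb ?n"] finite_Cb by auto
  define a where "a c = b (pit ?n c)" for c
  have c: "tscale (a c) (tvec c) \<in> tree_space X ?n" if "c \<in> Cb ?n" for c
    using that Cb(1) by (intro tree_space_intros tvec_tree_space) blast
  have "pi ?n (\<Sum>c\<in>Cb ?n. tscale (a c) (tvec c)) = (\<Sum>c\<in>Cb ?n. pi ?n (tscale (a c) (tvec c)))"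
    by (rule pi_sum[OF c])
  also have "\<dots> = (\<Sum>c\<in>Cb ?n. scl P (b (pit ?n c)) (pit ?n c))"
  proof (rule sum.cong[OF refl])
    fix c assume "c \<in> Cb ?n"
    then have "tvec c \<in> tree_space X ?n" using Cb(1) by (intro tvec_tree_space) blast
    then show "pi ?n (tscale (a c) (tvec c)) = scl P (b (pit ?n c)) (pit ?n c)"
      unfolding a_def by (rule pi_scale)
  qed
  also have "\<dots> = pit ?n (std t)" unfolding b sum.reindex[OF Cb(2)] by simp
  finally have eq: "pi ?n (\<Sum>c\<in>Cb ?n. tscale (a c) (tvec c)) = pit ?n (std t)" .
  have sm: "(\<Sum>c\<in>Cb ?n. tscale (a c) (tvec c)) \<in> tree_space X ?n"
    by (rule tv.subspace_sum[OF subspace_tree_space c])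
  have "pi ?n (tvec (std t) - (\<Sum>c\<in>Cb ?n. tscale (a c) (tvec c))) = 0"
    unfolding pi_diff[OF st sm] eq by simp
  moreover have "tvec (std t) - (\<Sum>c\<in>Cb ?n. tscale (a c) (tvec c)) \<in> tree_space X ?n"
    by (rule tv.subspace_diff[OF subspace_tree_space st sm])
  ultimately show ?thesis using that unfolding ker_pi_def by blast
qed

lemma mset_concat_leaves_upd:
  assumes "mset (leaves t) = mset (leaves (s m))"
  shows "mset (concat (map (\<lambda>j. leaves ((s(m := t)) j)) js)) = mset (concat (map (\<lambda>j. leaves (s j)) js))"
  by (induction js) (simp_all add: assms)

text \<open>The trees \<open>s j\<close> are replaced one at a time by combinations of basis trees.\<close>

lemma Lam_root_proper:
  assumes r: "r \<in> R k" and "\<And>j. decorated X (s j)"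
    and "mset (concat (map (\<lambda>j. leaves (s j)) [0..<k])) = mset [0..<n]"
    and "\<And>j. m \<le> j \<Longrightarrow> j < k \<Longrightarrow> canonical (s j)" "m \<le> k"
  shows "Lam n (tmap (\<lambda>t. bind t s) r) \<in> tv.span (Lam n ` basis_relations n)"
  using assms(2-)
proof (induction m arbitrary: s)
  case 0
  define us where "us = map s [0..<k]"
  have cm: "mset (concat (map leaves us)) = mset [0..<n]"
    using 0(2) by (simp add: us_def comp_def)
  note d = mset_eq_imp_distinct_iff[OF cm] mset_eq_setD[OF cm]
  have "\<forall>u\<in>set us. canonical u" using 0(3) by (simp add: us_def)
  moreover have "distinct (concat (map leaves us))" using d(1) by simp
  moreover have "set (concat (map leaves us)) = {..<n}" unfolding d(2) by (simp add: atLeast0LessThan)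
  moreover have "length us = k" by (simp add: us_def)
  ultimately have us: "us \<in> families {..<n} k" unfolding families_def by blast
  have "bind q s = bind q (sub us)" if "q \<in> Poly_Mapping.keys r" for q
    using trees_leaves_less[OF R_keys[OF r that]] by (intro bind_cong) (simp add: sub_def us_def)
  then have "tmap (\<lambda>t. bind t s) r = tmap (\<lambda>t. bind t (sub us)) r" by (rule tmap_cong)
  then show ?case using Lam_root_canonical[OF r us] by simp
next
  case (Suc m)
  define S where "S = set (leaves (s m))"
  let ?n = "card S"
  let ?u = "\<lambda>l. Leaf (en S l)"
  have mk: "m < k" using Suc.prems by simp
  have "distinct (concat (map (\<lambda>j. leaves (s j)) [0..<k]))"
    using mset_eq_imp_distinct_iff[OF Suc.prems(2)] by simp
  then have dm: "distinct (leaves (s m))" using mk by (auto simp: distinct_concat_iff)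
  obtain a where a: "tvec (std (s m)) - (\<Sum>c\<in>Cb ?n. tscale (a c) (tvec c)) \<in> ker_pi ?n"
    by (rule canonical_expand[OF Suc.prems(1) dm S_def[symmetric]])
  let ?H = "tmap2 (\<lambda>q t. bind q (s(m := bind t ?u))) r"
  let ?G = "\<lambda>c. tmap (\<lambda>q. bind q (s(m := relabel (en S) c))) r"
  have G: "?H (tvec c) = ?G c" for c
    unfolding tmap2_single_right relabel_def tv.scale_one ..
  have Hsum: "?H (sum f I) = (\<Sum>i\<in>I. ?H (f i))" for f :: "'v optree \<Rightarrow> ('k, 'v) tvec" and I
    by (induction I rule: infinite_finite_induct) simp_all
  \<comment> \<open>The error of expanding \<open>s m\<close> in the basis lies in the kernel and is
    invisible to \<open>Lam\<close> once placed at the leaf \<open>m\<close>. The value at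
    \<open>s\<close> is thus a combination of values at substitutions that are canonical at
    \<open>m\<close> as well.\<close>
  have "Lam n (?H (tvec (std (s m)) - (\<Sum>c\<in>Cb ?n. tscale (a c) (tvec c)))) = 0"
    by (rule Lam_root_replace[OF r Suc.prems(1) mk a]) simp
  then have eq: "Lam n (?G (std (s m))) = (\<Sum>c\<in>Cb ?n. tscale (a c) (Lam n (?G c)))"
    unfolding tmap2_diff_right Hsum tmap2_scale_right G Lam_diff Lam_sum Lam_scale by simp
  have fS: "finite S" by (simp add: S_def)
  have "relabel (en S) (std (s m)) = s m"
    unfolding std_def S_def[symmetric] using fS by (intro relabel_en_rk) (simp_all add: S_def)
  then have "s(m := relabel (en S) (std (s m))) = s" by simp
  then have "Lam n (tmap (\<lambda>t. bind t s) r) = (\<Sum>c\<in>Cb ?n. tscale (a c) (Lam n (?G c)))"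
    using eq by simp
  also have "\<dots> \<in> tv.span (Lam n ` basis_relations n)"
  proof (intro tv.span_sum tv.span_scale)
    fix c assume c: "c \<in> Cb ?n"
    note rc = relabel_en_Cb[OF fS c] and can = canonical_relabel_en[OF fS c]
    let ?s = "s(m := relabel (en S) c)"
    show "Lam n (?G c) \<in> tv.span (Lam n ` basis_relations n)"
    proof (rule Suc.IH)
      show "decorated X (?s j)" for j using Suc.prems(1) rc(3) by simp
      have "mset (leaves (relabel (en S) c)) = mset (leaves (s m))"
        using rc(1,2) dm S_def by (simp only: set_eq_iff_mset_eq_distinct[symmetric])
      from mset_concat_leaves_upd[of "relabel (en S) c" s m, OF this]
      show "mset (concat (map (\<lambda>j. leaves (?s j)) [0..<k])) = mset [0..<n]"
        using Suc.prems(2) by simp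
      show "canonical (?s j)" if "m \<le> j" "j < k" for j
        using that Suc.prems(3)[of j] can by (cases "j = m") simp_all
      show "m \<le> k" using mk by simp
    qed
  qed
  finally show ?case .
qed

lemma Lam_root_relations:
  assumes "w \<in> root_relations"
  shows "Lam n w \<in> tv.span (Lam n ` basis_relations n)"
proof -
  obtain s r k where w: "w = tmap (\<lambda>t. bind t s) r" and r: "r \<in> R k" and s: "\<And>j. decorated X (s j)"
    using assms unfolding root_relations_def by blast
  let ?N = "mset (concat (map (\<lambda>j. leaves (s j)) [0..<k]))"
  show ?thesis
  proof (cases "?N = mset [0..<n]")
    case True
    show ?thesis unfolding w by (rule Lam_root_proper[OF r s True, of k]) simp_all
  next
    case False
    \<comment> \<open>A coordinate at a basis tree of arity \<open>n\<close> can be non-zero only on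
      trees with leaves \<open>0, ..., n - 1\<close>, each occurring once; all terms of
      \<open>w\<close> have the multiset \<open>?N\<close> instead.\<close>
    have "Lam n w = 0"
      unfolding w
    proof (rule Lam_eq_0, unfold lin_ext_tmap, rule lin_ext_eq_0)
      fix e q assume e: "e \<in> basis_trees n" and q: "q \<in> Poly_Mapping.keys r"
      obtain b us l where us: "e = Node b us" "us \<in> families {..<n} l" using e by (rule basis_trees_cases)
      have "mset (leaves (bind q s)) = ?N"
        unfolding mset_leaves_bind mset_leaves_trees[OF R_keys[OF r q]]
        by (simp add: mset_concat comp_def flip: sum_mset_sum_list)
      moreover have "mset (concat (map leaves us)) = mset [0..<n]"
      proof -
        have "distinct (concat (map leaves us))" "set (concat (map leaves us)) = set [0..<n]"
          using us(2) unfolding families_def by (simp_all add: atLeast0LessThan)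
        then show ?thesis by (simp only: set_eq_iff_mset_eq_distinct[symmetric] distinct_upt)
      qed
      moreover have "distinct (leaves u)" if "u \<in> set us" for u
        using us(2) that canonicalD(2) unfolding families_def by blast
      ultimately have "lam b us (bind q s) = 0"
        using lam_leaves[of b us "bind q s"] False by metis
      then show "lam_tree e (bind q s) = 0" by (simp only: us lam_tree_def optree.case)
    qed
    then show ?thesis by (simp only: tv.span_zero)
  qed
qed

text \<open>The kernel is spanned by the three kinds of relations, and only those at the root
  survive \<open>Lam\<close>. This bounds the dimension of its image by that of
  \<open>R \<circ> P\<close>.\<close>

lemma Lam_ker_pi:
  assumes "w \<in> ker_pi n"
  shows "Lam n w \<in> tv.span (Lam n ` basis_relations n)"
  using ker_pi_all_relations[OF assms]
proof (induction rule: tv.span_induct_alt)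
  case base
  then show ?case by (simp only: Lam_zero tv.span_zero)
next
  case (step c x y)
  have "Lam n x \<in> tv.span (Lam n ` basis_relations n)"
    using step(1) Lam_trel[of x n] tv.span_base[of x "tree_relations M"] Lam_inner_relations[of x n] Lam_root_relations[of x n]
    unfolding all_relations_def by (metis UnE tv.span_zero)
  from tv.span_add[OF tv.span_scale[OF this] step(2)] show ?case
    by (simp only: Lam_add Lam_scale)
qed

lemma basis_trees_trees:
  assumes "e \<in> basis_trees n"
  shows "e \<in> trees X n"
proof -
  obtain b us k where e: "e = Node b us" "b \<in> Xb k" "us \<in> families {..<n} k" "length us = k"
    using assms by (rule basis_trees_cases)
  have "b \<in> X (length us)" using e Xb(1) by blast
  moreover have "list_all (decorated X) us"
    using e(3) canonicalD(3) unfolding families_def list_all_iff by blast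
  ultimately show ?thesis using e(3) unfolding e(1) trees_def families_def by simp
qed

text \<open>Modulo the kernel each basis tree equals a combination of trees in \<open>Cb n\<close>.
  As \<open>Lam\<close> fixes the basis trees, they lie in the span of its values on
  \<open>Cb n\<close> and on \<open>basis_relations n\<close>, and they are independent. The unit of
  \<open>P\<close> is dealt with in \<open>composite_ge\<close>.\<close>

theorem dimension_inequality:
  "(\<Sum>k\<le>n. card (Xb k) * card (reps {..<n} k)) \<le>
    card (Cb n) + (\<Sum>k\<le>n. card (Rb k) * card (reps {..<n} k))"
proof -
  let ?Z = "Lam n ` basis_relations n" and ?C = "Lam n ` tvec ` Cb n :: ('k, 'v) tvec set"
  have "tvec ` basis_trees n \<subseteq> tv.span (?Z \<union> ?C)"
  proof
    fix y :: "('k, 'v) tvec" assume "y \<in> tvec ` basis_trees n"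
    then obtain e where e: "e \<in> basis_trees n" "y = tvec e" by blast
    have et: "decorated X e" "distinct (leaves e)" "set (leaves e) = {..<n}"
      using basis_trees_trees[OF e(1)] unfolding trees_def by blast+
    have "pit n e \<in> vs.span (pit n ` Cb n)"
      unfolding Cb(4) by (rule pi_closed[OF tvec_tree_space[OF basis_trees_trees[OF e(1)]]])
    \<comment> \<open>The expansion of the class of \<open>e\<close> in the basis of
      \<open>P(n)\<close> is lifted to a combination of the trees themselves.\<close>
    then have "pit n e \<in> pi n ` tv.span (tvec ` Cb n)"
    proof (induction rule: vs.span_induct_alt)
      case base
      then show ?case by (intro image_eqI[of _ _ 0]) (simp_all add: tv.span_zero)
    next
      case (step c x y)
      then obtain d w where d: "d \<in> Cb n" "x = pit n d" and w: "w \<in> tv.span (tvec ` Cb n)" "y = pi n w"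
        by blast
      have sub: "tv.span (tvec ` Cb n) \<subseteq> tree_space X n"
        using Cb(1) tvec_tree_space by (intro tv.span_minimal subspace_tree_space) blast
      have dw: "tvec d \<in> tv.span (tvec ` Cb n)" using d(1) by (intro tv.span_base imageI)
      have wt: "w \<in> tree_space X n" and dt: "tvec d \<in> tree_space X n" using sub dw w(1) by blast+
      have "pi n (tscale c (tvec d) + w) = scl P c x + y"
        unfolding pi_add[OF tree_space_intros(3)[OF dt] wt] pi_scale[OF dt] d(2) w(2) ..
      moreover have "tscale c (tvec d) + w \<in> tv.span (tvec ` Cb n)"
        by (intro tv.span_add tv.span_scale dw w)
      ultimately show ?case by (intro image_eqI[of _ _ "tscale c (tvec d) + w"]) simp_all
    qed
    then obtain w where w: "w \<in> tv.span (tvec ` Cb n)" "pit n e = pi n w" by blast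
    have wt: "w \<in> tree_space X n"
      using w(1) tv.span_minimal[OF _ subspace_tree_space, of "tvec ` Cb n" X n] Cb(1) tvec_tree_space by blast
    have "tvec e - w \<in> ker_pi n"
    proof -
      have et: "tvec e \<in> tree_space X n" by (rule tvec_tree_space[OF basis_trees_trees[OF e(1)]])
      show ?thesis
        using pi_diff[OF et wt] tv.subspace_diff[OF subspace_tree_space et wt] w(2)
        unfolding ker_pi_def by simp
    qed
    then have "Lam n (tvec e - w) \<in> tv.span (?Z \<union> ?C)"
      using Lam_ker_pi tv.span_mono[of ?Z "?Z \<union> ?C"] by blast
    moreover have "Lam n w \<in> tv.span (?Z \<union> ?C)"
      using w(1)
    proof (induction rule: tv.span_induct_alt)
      case base
      then show ?case by (simp only: Lam_zero tv.span_zero)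
    next
      case (step c x y)
      have "Lam n x \<in> tv.span (?Z \<union> ?C)" using step(1) by (intro tv.span_base) blast
      from tv.span_add[OF tv.span_scale[OF this] step(2)] show ?case
        by (simp only: Lam_add Lam_scale)
    qed
    ultimately have "Lam n (tvec e - w) + Lam n w \<in> tv.span (?Z \<union> ?C)" by (rule tv.span_add)
    then show "y \<in> tv.span (?Z \<union> ?C)"
      unfolding e(2) using Lam_basis_trees[OF e(1)] by (simp add: Lam_diff)
  qed
  moreover have "finite (?Z \<union> ?C)" using card_basis_relations(1) finite_Cb by blast
  ultimately have "card (tvec ` basis_trees n :: ('k, 'v) tvec set) \<le> card (?Z \<union> ?C)"
    using tv.independent_span_bound[OF _ independent_basis_trees] by blast
  also have "\<dots> \<le> card ?Z + card ?C" by (rule card_Un_le)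
  also have "\<dots> \<le> card (basis_relations n) + card (Cb n)"
    using card_image_le[OF card_basis_relations(1), of "Lam n" n] finite_Cb
    by (intro add_mono) (simp_all add: image_image card_image_le)
  finally have "card (tvec ` basis_trees n :: ('k, 'v) tvec set) \<le> card (basis_relations n) + card (Cb n)" .
  moreover have "inj_on (tvec :: _ \<Rightarrow> ('k, 'v) tvec) (basis_trees n)"
    by (rule inj_onI) (metis lookup_single_eq lookup_single_not_eq one_neq_zero)
  then have "card (tvec ` basis_trees n :: ('k, 'v) tvec set) = card (basis_trees n)"
    by (rule card_image)
  ultimately show ?thesis
    using card_basis_relations(2)[of n] unfolding card_basis_trees by linarith
qed

section \<open>From dimensions to generating series\<close>

lemma Xb_empty_iff: "Xb k = {} \<longleftrightarrow> X k = {0}"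
proof
  assume "Xb k = {}"
  then show "X k = {0}" using Xb(3)[of k] by (simp only: vs.span_empty)
next
  assume "X k = {0}"
  then have "Xb k \<subseteq> {0}" using Xb(1)[of k] by simp
  moreover have "0 \<notin> Xb k" using Xb(2)[of k] vs.dependent_zero by blast
  ultimately show "Xb k = {}" by blast
qed

lemma Rb_empty:
  assumes "R k = {0}"
  shows "Rb k = {}"
proof -
  have "Rb k \<subseteq> {0}" using assms Rb(1)[of k] by simp
  moreover have "0 \<notin> Rb k" using Rb(2)[of k] tv.dependent_zero by blast
  ultimately show "Rb k = {}" by blast
qed

abbreviation Xz :: "real fps" where
  "Xz \<equiv> gen_series P X"

abbreviation Rz :: "real fps" where
  "Rz \<equiv> gen_series F R"

lemma Xz_nth: "Xz $ k = card (Xb k) / fact k"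
proof (cases "k = 0")
  case True
  have "Xb 0 = {}" using Xb_empty_iff X_small by simp
  then show ?thesis using True by (simp add: gen_series_def)
next
  case False
  then show ?thesis by (simp only: gen_series_def fps_nth_Abs_fps if_False card_Xb)
qed

lemma Rz_nth: "Rz $ k = card (Rb k) / fact k"
proof (cases "k = 0")
  case True
  have "R 0 = {0}" by (rule R_below[of 0 2]) (simp_all add: X_small)
  then have "Rb 0 = {}" by (rule Rb_empty)
  then show ?thesis using True by (simp add: gen_series_def)
next
  case False
  then show ?thesis by (simp only: gen_series_def fps_nth_Abs_fps if_False card_Rb free_simps)
qed

text \<open>The denominator \<open>fact k\<close> of \<open>H $ k\<close> cancels against the number
  of orderings of a family, so the composition counts roots with unordered families of
  children.\<close>

lemma compose_Pz_nth:
  assumes "\<And>k. H $ k = real (c k) / fact k"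
  shows "(H oo Pz) $ n = real (\<Sum>k\<le>n. c k * card (reps {..<n} k)) / fact n"
proof -
  have "(H oo Pz) $ n = (\<Sum>k\<le>n. real (c k) * real (card (reps {..<n} k)) / fact n)"
    unfolding fps_compose_nth
  proof (rule sum.cong)
    fix k
    have "real (card (reps {..<n} k)) * fact k = fact n * (Pz ^ k) $ n"
      using card_reps(2)[of "{..<n}" k] by simp
    then have "(Pz ^ k) $ n = real (card (reps {..<n} k)) * fact k / fact n"
      by (simp add: field_simps)
    then show "H $ k * (Pz ^ k) $ n = real (c k) * real (card (reps {..<n} k)) / fact n"
      by (simp add: assms)
  qed auto
  then show ?thesis by (simp add: sum_divide_distrib)
qed

lemma Pz_1: "Pz $ 1 = 1"
proof -
  have "{one P} \<subseteq> cmpt P 1" "cmpt P 1 \<subseteq> vs.span {one P}" "vs.independent {one P}"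
    using one_closed one_nz vs.span_scale[OF vs.span_base[of "one P" "{one P}"]]
    unfolding P1 by (blast, blast, simp)
  then have "card {one P} = vs.dim (cmpt P 1)" by (intro vs.basis_card_eq_dim)
  then show ?thesis by (simp add: gen_series_def)
qed

lemma composite_ge: "fps_X $ n \<le> ((fps_X - Xz + Rz) oo Pz) $ n"
proof -
  let ?x = "\<Sum>k\<le>n. card (Xb k) * card (reps {..<n} k)"
  let ?r = "\<Sum>k\<le>n. card (Rb k) * card (reps {..<n} k)"
  have P0: "Pz $ 0 = 0" by (simp add: gen_series_def)
  have "((fps_X - Xz + Rz) oo Pz) $ n = Pz $ n - (Xz oo Pz) $ n + (Rz oo Pz) $ n"
    using P0 by (simp add: fps_compose_add_distrib fps_compose_sub_distrib)
  also have "\<dots> = Pz $ n - real ?x / fact n + real ?r / fact n"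
    using compose_Pz_nth[OF Xz_nth] compose_Pz_nth[OF Rz_nth] by simp
  finally have eq: "((fps_X - Xz + Rz) oo Pz) $ n = Pz $ n - real ?x / fact n + real ?r / fact n" .
  show ?thesis
  proof (cases "n = 1")
    \<comment> \<open>In arity 1 the sum over generators is empty, and the term \<open>z\<close> on
      the left is matched by the identity of \<open>P\<close>. In every other arity the left-hand
      side is 0.\<close>
    case True
    have "Xb 0 = {}" "Xb 1 = {}" using Xb_empty_iff X_small by simp_all
    then have x0: "?x = 0" using True by simp
    have "((fps_X - Xz + Rz) oo Pz) $ n = Pz $ n + real ?r / fact n"
      using eq unfolding x0 by simp
    moreover have "0 \<le> real ?r / fact n" by (intro divide_nonneg_nonneg of_nat_0_le_iff) simp
    moreover have "fps_X $ n = Pz $ n" using Pz_1 True by simp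
    ultimately show ?thesis by linarith
  next
    case False
    have "real ?x \<le> real (card (Cb n) + ?r)"
      using dimension_inequality[of n] by (rule of_nat_mono)
    then have "real ?x / fact n \<le> (real (card (Cb n)) + real ?r) / fact n"
      by (intro divide_right_mono) simp_all
    then show ?thesis using eq False by (simp add: Pz_nth add_divide_distrib)
  qed
qed

lemma series_low:
  "(fps_X - Xz + Rz) $ 0 = 0" "(fps_X - Xz + Rz) $ 1 = 1"
proof -
  have "R j = {0}" if "j < 2" for j by (rule R_below[OF that]) (simp_all add: X_small)
  then have "Xb 0 = {}" "Xb 1 = {}" "Rb 0 = {}" "Rb 1 = {}"
    using Xb_empty_iff X_small Rb_empty by simp_all
  then show "(fps_X - Xz + Rz) $ 0 = 0" "(fps_X - Xz + Rz) $ 1 = 1"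
    by (simp_all add: Xz_nth Rz_nth)
qed

lemma inverse_series_le:
  assumes "\<And>n. 0 \<le> (fps_X / (fps_X - Xz + Rz)) $ n"
  shows "fps_inv (fps_X - Xz + Rz) $ n \<le> Pz $ n"
proof (rule fps_inv_le[OF series_low assms])
  show "Pz $ 0 = 0" by (simp add: gen_series_def)
  show "0 \<le> Pz $ n" for n by (simp add: Pz_nth)
qed (rule composite_ge)

text \<open>In the lowest arity \<open>m\<close> of \<open>X\<close> there are generators but no
  relations, so the coefficient of degree \<open>m\<close> of the series is negative, while those
  strictly between 1 and \<open>m\<close> vanish. This is the situation of
  \<open>fps_not_polynomial\<close>.\<close>

lemma infinite_operad_if:
  assumes "\<And>n. 0 \<le> (fps_X / (fps_X - Xz + Rz)) $ n" "X n \<noteq> {0}"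
  shows "infinite_operad P"
proof -
  define m where "m = (LEAST n. X n \<noteq> {0})"
  have m: "X m \<noteq> {0}" and below: "\<And>k. k < m \<Longrightarrow> X k = {0}"
    unfolding m_def using LeastI[of "\<lambda>n. X n \<noteq> {0}", OF assms(2)]
      not_less_Least[of _ "\<lambda>n. X n \<noteq> {0}"] by metis+
  have m2: "2 \<le> m" using m X_small[of m] by linarith
  have Xb: "Xb j = {}" if "j < m" for j using below[OF that] Xb_empty_iff by simp
  have Rb: "Rb j = {}" if jm: "j \<le> m" for j
  proof (rule Rb_empty)
    consider "j < m" | "j = m" using jm by linarith
    then show "R j = {0}"
    proof cases
      case 1
      show ?thesis by (rule R_below[OF 1 m2]) (rule below)
    next
      case 2
      show ?thesis unfolding 2 by (rule R_lowest[OF m2]) (rule below)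
    qed
  qed
  have "infinite {n. Pz $ n \<noteq> 0}"
  proof (rule fps_not_polynomial[OF series_low assms(1) _ _ composite_ge m2])
    show "Pz $ 0 = 0" by (simp add: gen_series_def)
    show "0 \<le> Pz $ n" for n by (simp add: Pz_nth)
    show "(fps_X - Xz + Rz) $ j = 0" if "1 < j" "j < m" for j
      using that Xb[of j] Rb[of j] by (simp add: Xz_nth Rz_nth)
    have "0 < card (Xb m)" using m Xb_empty_iff finite_Xb by (simp add: card_gt_0_iff)
    then show "(fps_X - Xz + Rz) $ m < 0"
      using m2 Rb[of m] by (simp add: Xz_nth Rz_nth)
  qed
  moreover have "{n. Pz $ n \<noteq> 0} \<subseteq> {n. cmpt P n \<noteq> {0}}"
  proof (rule subsetI, rule CollectI, rule notI)
    fix n assume "n \<in> {n. Pz $ n \<noteq> 0}" and n: "cmpt P n = {0}"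
    then have "Pz $ n \<noteq> 0" by simp
    then have "Cb n \<noteq> {}" unfolding Pz_nth by force
    then obtain c where c: "c \<in> Cb n" by blast
    then have "pit n c \<in> cmpt P n" using Cb(1) pi_closed tvec_tree_space by blast
    then have "pit n c = 0" unfolding n by simp
    moreover have "pit n c \<in> pit n ` Cb n" using c by (rule imageI)
    ultimately have "0 \<in> pit n ` Cb n" by simp
    then show False using Cb(3)[of n] vs.dependent_zero[of "pit n ` Cb n"] by simp
  qed
  ultimately have "infinite {n. cmpt P n \<noteq> {0}}" using finite_subset by metis
  then show ?thesis unfolding infinite_operad_def by (simp only: simp_thms)
qed

end

text \<open>If \<open>X\<close> vanishes, then \<open>P\<close> is spanned by the identity and
  \<open>f\<close> is t, so the condition on t/f holds although \<open>P\<close> is finite.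
  Infinitude is therefore asserted in the presence of a non-zero generator.\<close>

theorem theorem4p1:
  fixes P :: "('k::field_char_0, 'v::ab_group_add) operad"
    and X :: "nat \<Rightarrow> 'v set"
    and R :: "nat \<Rightarrow> ('k, 'v) tvec set"
    and f :: "real fps"
  assumes "symmetric_operad P" and "connected_operad P"
    and "minimal_generators P X"
    and "minimal_relations P X R"
    and "locally_finite P X"
    and "locally_finite (free_operad (restrict_smodule P X)) R"
    and "f = fps_X - gen_series P X + gen_series (free_operad (restrict_smodule P X)) R"
    and "\<forall>n. fps_nth (fps_X / f) n \<ge> 0"
  shows "((\<exists>n. X n \<noteq> {0}) \<longrightarrow> infinite_operad P) \<and>
    (\<forall>n. fps_nth (gen_series P (cmpt P)) n \<ge> fps_nth (fps_inv f) n)"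
proof -
  obtain \<pi> where \<pi>: "natural_surjection P X \<pi>" and
    gens: "minimal_ideal_generators (free_operad (restrict_smodule P X))
      (kernel (free_operad (restrict_smodule P X)) \<pi>) R"
    using assms(4) unfolding minimal_relations_def by blast
  interpret finite_presented_operad P X \<pi> R
    unfolding finite_presented_operad_def finite_presented_operad_axioms_def
      presented_operad_relations_def presented_operad_relations_axioms_def
      presented_operad_def presented_operad_axioms_def
    using assms(1-3,5,6) \<pi> gens[unfolded minimal_ideal_generators_def] by blast
  have "\<And>n. 0 \<le> (fps_X / (fps_X - Xz + Rz)) $ n"
    using assms(8) unfolding assms(7) by blast
  then show ?thesis
    unfolding assms(7) using infinite_operad_if inverse_series_le by blast
qed

end
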